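(* Let $\mathfrak n\subset A$ be a non-zero ideal and let $x_*\in Y_*(\mathfrak n)(K)$ be such that $\mathcal P(x_* ):=\gamma^{-1}(x_* )\subset Y_0(\mathfrak n)(\bar K)$ is contained in $Y_0(\mathfrak n)(K^{\rm sep})$. Then any $x\in\mathcal P(x_* )$ is represented by a pair $(\phi,\Lambda)$ such that $\phi$ is virtually $K$-rational and defined over a polyquadratic extension of $K$.
   Context: Let $A=\mathbb{F}_q[T]$, $Q=\mathbb{F}_q(T)$, $K$ a field containing $Q$, $\bar K$ an algebraic closure, $K^{\rm sep}\subset\bar K$ the separable closure of $K$, $G_K=\mathrm{Gal}(K^{\rm sep}/K)$. For a field $L$ with $Q\subset L\subset\bar K$, $L\{\tau\}$ is the skew polynomial ring with $\tau c=c^q\tau$, and $\partial(\sum c_i\tau^i)=c_0$. A Drinfeld $A$-module over $L$ is an $\mathbb{F}_q$-algebra homomorphism $\phi:A\to L\{\tau\}$ with $\partial(\phi_a)=a$ for all $a$ and $\phi_a\neq a$ for some $a$; its rank is the $\tau$-degree of $\phi_T$. All Drinfeld $A$-modules here are of rank two. An isogeny $\mu:\phi\to\psi$ is a non-zero $\mu\in\bar K\{\tau\}$ with $\mu\phi_a=\psi_a\mu$ for all $a\in A$; it is an isomorphism if $\mu\in\bar K^\times$. For $s\in G_K$, ${}^s\phi$ is obtained by applying $s$ to coefficients. $\phi$ is virtually $K$-rational if it is defined over $K^{\rm sep}$ and isogenous to ${}^s\phi$ for every $s\in G_K$. A polyquadratic extension of $K$ is a finite Galois extension with Galois group isomorphic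 to $(\mathbb Z/2\mathbb Z)^m$ for some $m\ge0$. $\phi$ makes $\bar K$ an $A$-module via $a\cdot\lambda=\phi_a(\lambda)$, where $(\sum c_i\tau^i)(\lambda)=\sum c_i\lambda^{q^i}$; $\phi[\mathfrak n]$ is the $\mathfrak n$-torsion; a cyclic $\mathfrak n$-kernel is a finite $A$-submodule $\Lambda\cong A/\mathfrak n$. $Y_0(\mathfrak n)$ is the Drinfeld modular curve of $\Gamma_0(\mathfrak n)$-level, a smooth affine curve over $Q$, coarse moduli variety of pairs $(\phi,\Lambda)$ with $\phi$ a rank-two Drinfeld $A$-module and $\Lambda$ a cyclic $\mathfrak n$-kernel. For a field $L$ with $K\subset L\subset \bar K$, points of $Y_0(\mathfrak n)(L)$ are the $\bar K$-isomorphism classes $[\phi,\Lambda]$ represented by pairs with $\phi$ over $L$ and $\Lambda$ an $L$-rational (Galois-stable) cyclic $\mathfrak n$-kernel, where $(\phi,\Lambda)\cong(\phi',\Lambda')$ if there is a $\bar K$-isomorphism $\nu:\phi\to\phi'$ with $\nu\Lambda=\Lambda'$. For $\mathfrak m\mid\mathfrak n$ with $\mathfrak m$ and $\mathfrak n'=\mathfrak n/\mathfrak m$ coprime, the Atkin-Lehner involution $w_{\mathfrak m}$ (defined over $Q$) is $w_{\mathfrak m}[\phi,\Lambda]=[\phi_{\mathfrak m},\mu_{\mathfrak m}(\phi[\mathfrak m]\oplus\Lambda_{\mathfrak n'})]$, where $\Lambda=\Lambda_{\mathfrak m}\oplus\Lambda_{\mathfrak n'}$ with $\Lambda_{\mathfrak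 m}\cong A/\mathfrak m$, $\Lambda_{\mathfrak n'}\cong A/\mathfrak n'$, and $\mu_{\mathfrak m}:\phi\to\phi_{\mathfrak m}$ is an isogeny with kernel $\Lambda_{\mathfrak m}$. $\mathcal W(\mathfrak n)$ is the group of all these involutions, $Y_*(\mathfrak n)=Y_0(\mathfrak n)/\mathcal W(\mathfrak n)$ the quotient curve over $Q$, and $\gamma:Y_0(\mathfrak n)\to Y_*(\mathfrak n)$ the quotient morphism. *)

theory Defs
  imports
    "HOL-Computational_Algebra.Polynomial"
    "HOL-Library.Cardinality"
    "HOL-Library.Set_Algebras"
    "HOL-Algebra.Bij"
    "HOL-Algebra.Product_Groups"
    "HOL-Algebra.Elementary_Groups"
begin

text \<open>
  Conventions.  The finite field with \<open>q\<close> elements is a type \<open>'f\<close> with \<open>q = CARD('f)\<close>, and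
  \<open>A = 'f poly\<close>.  All fields are subfields (as sets) of one algebraically closed field \<open>'k\<close>, the
  algebraic closure of \<open>K\<close>.  The inclusion of \<open>A\<close> into \<open>'k\<close> is an injective ring homomorphism
  \<open>\<iota>\<close>; the field \<open>Q\<close> is the set of quotients of its values.
\<close>

section \<open>Fields and Galois groups\<close>

definition subfield_of :: "'k::field set \<Rightarrow> bool" where
  "subfield_of L \<longleftrightarrow> 0 \<in> L \<and> 1 \<in> L \<and>
     (\<forall>x\<in>L. \<forall>y\<in>L. x + y \<in> L \<and> x * y \<in> L) \<and> (\<forall>x\<in>L. - x \<in> L \<and> inverse x \<in> L)"

definition polys_over :: "'k::field set \<Rightarrow> 'k poly set" where
  "polys_over L = {p. \<forall>i. coeff p i \<in> L}"

definition algebraic_closure_of :: "'k::alg_closed_field set \<Rightarrow> bool" where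
  "algebraic_closure_of K \<longleftrightarrow> (\<forall>x::'k. \<exists>p\<in>polys_over K. p \<noteq> 0 \<and> poly p x = 0)"

definition is_minpoly :: "'k::field set \<Rightarrow> 'k \<Rightarrow> 'k poly \<Rightarrow> bool" where
  "is_minpoly K x p \<longleftrightarrow> p \<in> polys_over K \<and> lead_coeff p = 1 \<and> poly p x = 0 \<and>
     (\<forall>r\<in>polys_over K. r \<noteq> 0 \<and> poly r x = 0 \<longrightarrow> degree p \<le> degree r)"

text \<open>The separable closure of \<open>K\<close> inside \<open>'k\<close>; \<^const>\<open>rsquarefree\<close> says that there are no
  multiple roots in the algebraically closed field \<open>'k\<close>.\<close>

definition sep_closure :: "'k::alg_closed_field set \<Rightarrow> 'k set" where
  "sep_closure K = {x. \<exists>p. is_minpoly K x p \<and> rsquarefree p}"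

text \<open>Elements of the Galois group are functions that are \<^const>\<open>undefined\<close> outside \<open>L\<close>, as in
  \<^const>\<open>BijGroup\<close>.\<close>

definition gal_group :: "'k::field set \<Rightarrow> 'k set \<Rightarrow> ('k \<Rightarrow> 'k) monoid" where
  "gal_group L K = BijGroup L
     \<lparr>carrier := {s \<in> Bij L. (\<forall>x\<in>L. \<forall>y\<in>L. s (x + y) = s x + s y \<and> s (x * y) = s x * s y) \<and>
                            (\<forall>x\<in>K. s x = x)}\<rparr>"

definition abs_galois :: "'k::alg_closed_field set \<Rightarrow> ('k \<Rightarrow> 'k) set" where
  "abs_galois K = carrier (gal_group (sep_closure K) K)"

definition finite_extension :: "'k::field set \<Rightarrow> 'k set \<Rightarrow> bool" where
  "finite_extension K L \<longleftrightarrow> subfield_of L \<and> K \<subseteq> L \<and>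
     (\<exists>B. finite B \<and> B \<subseteq> L \<and> (\<forall>x\<in>L. \<exists>c. (\<forall>b\<in>B. c b \<in> K) \<and> x = (\<Sum>b\<in>B. c b * b)))"

definition finite_galois :: "'k::alg_closed_field set \<Rightarrow> 'k set \<Rightarrow> bool" where
  "finite_galois K L \<longleftrightarrow> finite_extension K L \<and> L \<subseteq> sep_closure K \<and>
     (\<forall>x\<in>L. \<forall>p. is_minpoly K x p \<longrightarrow> (\<forall>y. poly p y = 0 \<longrightarrow> y \<in> L))"

definition polyquadratic :: "'k::alg_closed_field set \<Rightarrow> 'k set \<Rightarrow> bool" where
  "polyquadratic K L \<longleftrightarrow> finite_galois K L \<and>
     (\<exists>m::nat. gal_group L K \<cong> product_group {..<m} (\<lambda>_. integer_mod_group 2))"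

section \<open>The base ring and its ideals\<close>

definition A_embedding :: "('f::{finite,field} poly \<Rightarrow> 'k::field) \<Rightarrow> bool" where
  "A_embedding \<iota> \<longleftrightarrow> inj \<iota> \<and> \<iota> 1 = 1 \<and> (\<forall>a b. \<iota> (a + b) = \<iota> a + \<iota> b \<and> \<iota> (a * b) = \<iota> a * \<iota> b)"

definition Q_field :: "('f::{finite,field} poly \<Rightarrow> 'k::field) \<Rightarrow> 'k set" where
  "Q_field \<iota> = {\<iota> a / \<iota> b | a b. b \<noteq> 0}"

definition is_ideal :: "'r::comm_ring_1 set \<Rightarrow> bool" where
  "is_ideal I \<longleftrightarrow> 0 \<in> I \<and> (\<forall>x\<in>I. \<forall>y\<in>I. x + y \<in> I) \<and> (\<forall>a. \<forall>x\<in>I. a * x \<in> I)"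

definition ideal_prod :: "'r::comm_ring_1 set \<Rightarrow> 'r set \<Rightarrow> 'r set" where
  "ideal_prod I J = \<Inter>{L. is_ideal L \<and> (\<forall>x\<in>I. \<forall>y\<in>J. x * y \<in> L)}"

definition coprime_ideals :: "'r::comm_ring_1 set \<Rightarrow> 'r set \<Rightarrow> bool" where
  "coprime_ideals I J \<longleftrightarrow> I + J = UNIV"

section \<open>Skew polynomials and Drinfeld modules\<close>

text \<open>A skew polynomial \<open>\<Sum>i. c\<^sub>i \<tau>^i\<close> is stored as the polynomial with coefficients \<open>c\<^sub>i\<close>.  Addition,
  the \<open>\<tau>\<close>-degree, \<open>\<partial>\<close> and constants are then the usual ones, but the ring multiplication is the
  following one, determined by \<open>\<tau> c = c^q \<tau>\<close>.\<close>

definition skew_mult :: "nat \<Rightarrow> 'k::field poly \<Rightarrow> 'k poly \<Rightarrow> 'k poly" where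
  "skew_mult q f g =
     (\<Sum>i\<le>degree f. \<Sum>j\<le>degree g. monom (coeff f i * coeff g j ^ (q ^ i)) (i + j))"

definition skew_eval :: "nat \<Rightarrow> 'k::field poly \<Rightarrow> 'k \<Rightarrow> 'k" where
  "skew_eval q f x = (\<Sum>i\<le>degree f. coeff f i * x ^ (q ^ i))"

type_synonym ('f, 'k) amodule = "'f poly \<Rightarrow> 'k poly"

abbreviation T :: "'f::field poly" where
  "T \<equiv> monom 1 1"

text \<open>Rank two Drinfeld \<open>A\<close>-modules over \<open>L\<close>.\<close>

definition drinfeld ::
  "('f::{finite,field} poly \<Rightarrow> 'k::field) \<Rightarrow> 'k set \<Rightarrow> ('f, 'k) amodule \<Rightarrow> bool" where
  "drinfeld \<iota> L \<phi> \<longleftrightarrow>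
     (\<forall>a. \<phi> a \<in> polys_over L) \<and>
     (\<forall>c. \<phi> [:c:] = [:\<iota> [:c:]:]) \<and>
     (\<forall>a b. \<phi> (a + b) = \<phi> a + \<phi> b) \<and>
     (\<forall>a b. \<phi> (a * b) = skew_mult CARD('f) (\<phi> a) (\<phi> b)) \<and>
     (\<forall>a. coeff (\<phi> a) 0 = \<iota> a) \<and>
     (\<exists>a. \<phi> a \<noteq> [:\<iota> a:]) \<and>
     degree (\<phi> T) = 2"

definition isogeny ::
  "'k::field poly \<Rightarrow> ('f::{finite,field}, 'k) amodule \<Rightarrow> ('f, 'k) amodule \<Rightarrow> bool" where
  "isogeny \<mu> \<phi> \<psi> \<longleftrightarrow>
     \<mu> \<noteq> 0 \<and> (\<forall>a. skew_mult CARD('f) \<mu> (\<phi> a) = skew_mult CARD('f) (\<psi> a) \<mu>)"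

definition isogenous ::
  "('f::{finite,field}, 'k::field) amodule \<Rightarrow> ('f, 'k) amodule \<Rightarrow> bool" where
  "isogenous \<phi> \<psi> \<longleftrightarrow> (\<exists>\<mu>. isogeny \<mu> \<phi> \<psi>)"

definition conj_module :: "('k \<Rightarrow> 'k) \<Rightarrow> ('f::field, 'k::field) amodule \<Rightarrow> ('f, 'k) amodule" where
  "conj_module s \<phi> = (\<lambda>a. map_poly s (\<phi> a))"

definition virtually_rational ::
  "('f::{finite,field} poly \<Rightarrow> 'k::alg_closed_field) \<Rightarrow> 'k set \<Rightarrow> ('f, 'k) amodule \<Rightarrow> bool" where
  "virtually_rational \<iota> K \<phi> \<longleftrightarrow>
     drinfeld \<iota> (sep_closure K) \<phi> \<and> (\<forall>s\<in>abs_galois K. isogenous \<phi> (conj_module s \<phi>))"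

abbreviation act :: "('f::{finite,field}, 'k::field) amodule \<Rightarrow> 'f poly \<Rightarrow> 'k \<Rightarrow> 'k" where
  "act \<phi> a \<equiv> skew_eval CARD('f) (\<phi> a)"

definition torsion :: "('f::{finite,field}, 'k::field) amodule \<Rightarrow> 'f poly set \<Rightarrow> 'k set" where
  "torsion \<phi> \<nn> = {z. \<forall>a\<in>\<nn>. act \<phi> a z = 0}"

definition submodule :: "('f::{finite,field}, 'k::field) amodule \<Rightarrow> 'k set \<Rightarrow> bool" where
  "submodule \<phi> \<Lambda> \<longleftrightarrow> 0 \<in> \<Lambda> \<and> (\<forall>x\<in>\<Lambda>. \<forall>y\<in>\<Lambda>. x + y \<in> \<Lambda>) \<and> (\<forall>a. \<forall>x\<in>\<Lambda>. act \<phi> a x \<in> \<Lambda>)"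

text \<open>\<open>h\<close> is an isomorphism of \<open>A\<close>-modules from \<open>A/\<nn>\<close>, whose elements are the cosets
  \<open>a +o \<nn>\<close>, to \<open>\<Lambda>\<close>.\<close>

definition cyclic_kernel ::
  "('f::{finite,field}, 'k::field) amodule \<Rightarrow> 'f poly set \<Rightarrow> 'k set \<Rightarrow> bool" where
  "cyclic_kernel \<phi> \<nn> \<Lambda> \<longleftrightarrow> finite \<Lambda> \<and> submodule \<phi> \<Lambda> \<and>
     (\<exists>h. bij_betw h (range (\<lambda>a. a +o \<nn>)) \<Lambda> \<and>
          (\<forall>a b. h ((a + b) +o \<nn>) = h (a +o \<nn>) + h (b +o \<nn>)) \<and>
          (\<forall>a b. h ((a * b) +o \<nn>) = act \<phi> a (h (b +o \<nn>))))"

section \<open>The points of \<open>Y\<^sub>0(\<nn>)\<close> and the Atkin-Lehner involutions\<close>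

type_synonym ('f, 'k) pt = "('f, 'k) amodule \<times> 'k set"

definition pairs ::
  "('f::{finite,field} poly \<Rightarrow> 'k::field) \<Rightarrow> 'f poly set \<Rightarrow> ('f, 'k) pt set" where
  "pairs \<iota> \<nn> = {(\<phi>, \<Lambda>). drinfeld \<iota> UNIV \<phi> \<and> cyclic_kernel \<phi> \<nn> \<Lambda>}"

definition pair_iso ::
  "('f::{finite,field} poly \<Rightarrow> 'k::field) \<Rightarrow> 'f poly set \<Rightarrow> (('f, 'k) pt \<times> ('f, 'k) pt) set" where
  "pair_iso \<iota> \<nn> = {((\<phi>, \<Lambda>), (\<phi>', \<Lambda>')). (\<phi>, \<Lambda>) \<in> pairs \<iota> \<nn> \<and> (\<phi>', \<Lambda>') \<in> pairs \<iota> \<nn> \<and>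
     (\<exists>c. c \<noteq> 0 \<and> isogeny [:c:] \<phi> \<phi>' \<and> skew_eval CARD('f) [:c:] ` \<Lambda> = \<Lambda>')}"

definition Y0 ::
  "('f::{finite,field} poly \<Rightarrow> 'k::field) \<Rightarrow> 'f poly set \<Rightarrow> ('f, 'k) pt set set" where
  "Y0 \<iota> \<nn> = pairs \<iota> \<nn> // pair_iso \<iota> \<nn>"

definition Y0_points ::
  "('f::{finite,field} poly \<Rightarrow> 'k::alg_closed_field) \<Rightarrow> 'f poly set \<Rightarrow> 'k set \<Rightarrow> ('f, 'k) pt set set"
  where
  "Y0_points \<iota> \<nn> L = {x \<in> Y0 \<iota> \<nn>. \<exists>(\<phi>, \<Lambda>)\<in>x. drinfeld \<iota> L \<phi> \<and>
     \<Lambda> \<subseteq> sep_closure L \<and> (\<forall>s\<in>abs_galois L. s ` \<Lambda> = \<Lambda>)}"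

text \<open>\<open>\<mm>\<close> and \<open>\<mm>'\<close> are coprime with product \<open>\<nn>\<close>.\<close>

definition exact_factors :: "'r::comm_ring_1 set \<Rightarrow> 'r set \<Rightarrow> 'r set \<Rightarrow> bool" where
  "exact_factors \<nn> \<mm> \<mm>' \<longleftrightarrow>
     is_ideal \<mm> \<and> is_ideal \<mm>' \<and> coprime_ideals \<mm> \<mm>' \<and> ideal_prod \<mm> \<mm>' = \<nn>"

text \<open>An isogeny is separable because \<open>\<iota>\<close> is injective, so it is enough to prescribe the set of
  zeros of \<open>\<mu>\<close>.  The set on the right is a single isomorphism class if \<open>x\<close> is one.\<close>

definition atkin_lehner ::
  "('f::{finite,field} poly \<Rightarrow> 'k::field) \<Rightarrow> 'f poly set \<Rightarrow> 'f poly set \<Rightarrow> 'f poly set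
     \<Rightarrow> ('f, 'k) pt set \<Rightarrow> ('f, 'k) pt set" where
  "atkin_lehner \<iota> \<nn> \<mm> \<mm>' x = {p. \<exists>\<phi> \<Lambda> \<Lambda>\<^sub>1 \<Lambda>\<^sub>2 \<psi> \<mu>. (\<phi>, \<Lambda>) \<in> x \<and>
     cyclic_kernel \<phi> \<mm> \<Lambda>\<^sub>1 \<and> cyclic_kernel \<phi> \<mm>' \<Lambda>\<^sub>2 \<and> \<Lambda> = \<Lambda>\<^sub>1 + \<Lambda>\<^sub>2 \<and> \<Lambda>\<^sub>1 \<inter> \<Lambda>\<^sub>2 = {0} \<and>
     drinfeld \<iota> UNIV \<psi> \<and> isogeny \<mu> \<phi> \<psi> \<and> {z. skew_eval CARD('f) \<mu> z = 0} = \<Lambda>\<^sub>1 \<and>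
     ((\<psi>, skew_eval CARD('f) \<mu> ` (torsion \<phi> \<mm> + \<Lambda>\<^sub>2)), p) \<in> pair_iso \<iota> \<nn>}"

definition AL_group ::
  "('f::{finite,field} poly \<Rightarrow> 'k::field) \<Rightarrow> 'f poly set \<Rightarrow> (('f, 'k) pt set \<Rightarrow> ('f, 'k) pt set) set"
  where
  "AL_group \<iota> \<nn> = {atkin_lehner \<iota> \<nn> \<mm> \<mm>' | \<mm> \<mm>'. exact_factors \<nn> \<mm> \<mm>'}"

section \<open>The \<open>Q\<close>-structure on \<open>Y\<^sub>0(\<nn>)\<close> and the quotient \<open>Y\<^sub>*(\<nn>)\<close>\<close>

text \<open>The monic polynomial \<open>\<Prod>z\<in>S. (X - z)\<close> in the ordinary polynomial ring.\<close>

definition kernel_poly :: "'k::field set \<Rightarrow> 'k poly" where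
  "kernel_poly S = (\<Prod>z\<in>S. [:- z, 1:])"

text \<open>
  Pairs \<open>(\<phi>, \<Lambda>)\<close> over a \<open>Q\<close>-algebra, with trivialised line bundle, are parametrised by an affine
  \<open>Q\<close>-scheme \<open>Z\<close>.  The module is given by \<open>\<phi>\<^sub>T = T + g \<tau> + \<Delta> \<tau>^2\<close> with \<open>\<Delta>\<close> invertible, and the finite
  flat subgroup \<open>\<Lambda>\<close> of the additive group by its monic defining polynomial, so that \<open>Z\<close> is a closed
  subscheme of an affine space with coordinates \<open>g\<close>, \<open>\<Delta>\<close>, \<open>1/\<Delta>\<close> and the coefficients of this
  polynomial.  For \<open>\<mm>\<close> dividing \<open>\<nn>\<close>, the coefficients of the polynomial of the subgroup
  \<open>\<Lambda> \<inter> \<phi>[\<mm>]\<close> (again finite flat) are regular functions on \<open>Z\<close> as well.  As \<open>Z\<close> is finite etale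
  over the \<open>(g, \<Delta>)\<close>-space, it is reduced, and its coordinate ring is the following \<open>Q\<close>-algebra of
  functions on \<^const>\<open>pairs\<close>.
\<close>

inductive_set pair_functions ::
  "('f::{finite,field} poly \<Rightarrow> 'k::field) \<Rightarrow> 'f poly set \<Rightarrow> (('f, 'k) pt \<Rightarrow> 'k) set"
  for \<iota> :: "'f::{finite,field} poly \<Rightarrow> 'k::field" and \<nn> :: "'f poly set"
where
  const: "c \<in> Q_field \<iota> \<Longrightarrow> (\<lambda>_. c) \<in> pair_functions \<iota> \<nn>"
| coeff_T: "(\<lambda>(\<phi>, \<Lambda>). coeff (\<phi> T) i) \<in> pair_functions \<iota> \<nn>"
| inverse_Delta: "(\<lambda>(\<phi>, \<Lambda>). inverse (coeff (\<phi> T) 2)) \<in> pair_functions \<iota> \<nn>"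
| kernel: "is_ideal \<mm> \<Longrightarrow> \<nn> \<subseteq> \<mm> \<Longrightarrow>
    (\<lambda>(\<phi>, \<Lambda>). coeff (kernel_poly (\<Lambda> \<inter> torsion \<phi> \<mm>)) i) \<in> pair_functions \<iota> \<nn>"
| add: "f \<in> pair_functions \<iota> \<nn> \<Longrightarrow> g \<in> pair_functions \<iota> \<nn> \<Longrightarrow>
    (\<lambda>p. f p + g p) \<in> pair_functions \<iota> \<nn>"
| mult: "f \<in> pair_functions \<iota> \<nn> \<Longrightarrow> g \<in> pair_functions \<iota> \<nn> \<Longrightarrow>
    (\<lambda>p. f p * g p) \<in> pair_functions \<iota> \<nn>"

text \<open>
  The coarse moduli variety \<open>Y\<^sub>0(\<nn>)\<close> is the quotient of \<open>Z\<close> by the multiplicative group, which acts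
  through isomorphisms \<open>\<nu> = c\<close>.  So its coordinate ring over \<open>Q\<close> consists of the functions on
  isomorphism classes that come from \<^const>\<open>pair_functions\<close>.
\<close>

definition O_Y0 ::
  "('f::{finite,field} poly \<Rightarrow> 'k::field) \<Rightarrow> 'f poly set \<Rightarrow> (('f, 'k) pt set \<Rightarrow> 'k) set" where
  "O_Y0 \<iota> \<nn> = {F. \<exists>f\<in>pair_functions \<iota> \<nn>. \<forall>x\<in>Y0 \<iota> \<nn>. \<forall>p\<in>x. F x = f p}"

text \<open>The quotient curve \<open>Y\<^sub>*(\<nn>)\<close> is the spectrum of the ring of invariants.\<close>

definition O_Ystar ::
  "('f::{finite,field} poly \<Rightarrow> 'k::field) \<Rightarrow> 'f poly set \<Rightarrow> (('f, 'k) pt set \<Rightarrow> 'k) set" where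
  "O_Ystar \<iota> \<nn> = {F \<in> O_Y0 \<iota> \<nn>. \<forall>w\<in>AL_group \<iota> \<nn>. \<forall>x\<in>Y0 \<iota> \<nn>. F (w x) = F x}"

text \<open>On geometric points the quotient morphism \<open>\<gamma>\<close> sends a point to its orbit.\<close>

definition quot_map ::
  "('f::{finite,field} poly \<Rightarrow> 'k::field) \<Rightarrow> 'f poly set \<Rightarrow> ('f, 'k) pt set \<Rightarrow> ('f, 'k) pt set set"
  where
  "quot_map \<iota> \<nn> x = {w x | w. w \<in> AL_group \<iota> \<nn>}"

text \<open>The fibre of \<open>\<gamma>\<close> in the geometric points of \<open>Y\<^sub>0(\<nn>)\<close>.\<close>

definition fibre ::
  "('f::{finite,field} poly \<Rightarrow> 'k::field) \<Rightarrow> 'f poly set \<Rightarrow> ('f, 'k) pt set set \<Rightarrow> ('f, 'k) pt set set"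
  where
  "fibre \<iota> \<nn> y = {x \<in> Y0 \<iota> \<nn>. quot_map \<iota> \<nn> x = y}"

text \<open>The \<open>L\<close>-rational points of the affine \<open>Q\<close>-variety \<open>Y\<^sub>*(\<nn>)\<close>, i.e. the homomorphisms of
  \<open>Q\<close>-algebras from its coordinate ring to \<open>L\<close>: the geometric points at which all
  regular functions defined over \<open>Q\<close> have values in \<open>L\<close>.\<close>

definition Ystar_points ::
  "('f::{finite,field} poly \<Rightarrow> 'k::field) \<Rightarrow> 'f poly set \<Rightarrow> 'k set \<Rightarrow> ('f, 'k) pt set set set" where
  "Ystar_points \<iota> \<nn> L =
     {y \<in> quot_map \<iota> \<nn> ` Y0 \<iota> \<nn>. \<forall>F\<in>O_Ystar \<iota> \<nn>. \<forall>x\<in>fibre \<iota> \<nn> y. F x \<in> L}"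

end

theory Submission
  imports Defs "HOL-Computational_Algebra.Primes"
begin

text \<open>
  Only the values of the \<open>j\<close>-invariant on the orbit of \<open>x\<close> matter.  The Atkin-Lehner involutions are
  indexed by the idempotents \<open>e\<close> of \<open>A/\<nn>\<close>: exact factorisations of \<open>\<nn>\<close> correspond to idempotents,
  the part \<open>e \<Lambda>\<close> of \<open>\<Lambda>\<close> is the kernel of the isogeny, and composition of involutions is
  the addition \<open>d + e - 2 d e\<close> of the Boolean ring of idempotents.  On \<open>j\<close>-invariants this is
  \<open>j(w\<^sub>d w\<^sub>e x) = j(w\<^sub>f x)\<close> with \<open>f = d + e - 2 d e\<close> (\<open>J_AL_AL\<close>), because both sides come from isogenies
  with the same kernel.

  By \<open>J_AL_function\<close>, each \<open>x \<mapsto> j(w\<^sub>e x)\<close> is a regular function on \<open>Y\<^sub>0(\<nn>)\<close>: the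
  quotient module is \<open>\<psi>\<^sub>T = \<mu> \<phi>\<^sub>T \<mu>\<^sup>-\<^sup>1\<close> for the monic \<open>\<mu>\<close> with kernel \<open>e \<Lambda>\<close>, and the coefficients of \<open>\<mu>\<close>
  are among the coordinates.  So the polynomial whose roots are the values on the orbit of a linear
  form in the \<open>j(w\<^sub>d x)\<close> with coefficients in \<open>Q\<close> has coefficients that are regular
  functions on \<open>Y\<^sub>*(\<nn>)\<close>.  At a \<open>K\<close>-rational point this polynomial lies in \<open>K[X]\<close>, an embedding \<open>s\<close> over
  \<open>K\<close> permutes its roots, and a separating linear form gives one \<open>m\<close> with
  \<open>s(j(w\<^sub>d x)) = j(w\<^sub>m w\<^sub>d x)\<close> for all \<open>d\<close> (\<open>khom_permutes_orbit\<close>).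

  Two conclusions follow.  The field \<open>L\<close> generated over \<open>K\<close> by the \<open>j(w\<^sub>d x)\<close> is separable, since the points
  of the fibre are defined over the separable closure.  It is stable under all embeddings, so it is a finite Galois
  extension, and \<open>s\<^sup>2 = 1\<close> for all automorphisms \<open>s\<close>, since \<open>w\<^sub>m\<^sup>2 = 1\<close>.  A finite group of exponent
  two is a power of \<open>\<int>/2\<close>.  Moreover \<open>j(x) \<in> L\<close>, and a rank two Drinfeld module has a model over the
  field generated by its \<open>j\<close>-invariant (\<open>model_over_field_of_j\<close>).  Secondly, the conjugate of the
  module by \<open>s\<close> has the \<open>j\<close>-invariant of \<open>w\<^sub>m x\<close>, so it is isomorphic to a quotient
  of the module and in particular isogenous to it (\<open>virtually_rational_model\<close>).

  Separability is treated through the criterion that \<open>z\<close> is separable over \<open>K\<close> iff \<open>z \<in> K[z\<^sup>p]\<close>.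
  It shows that primitive elements are separable, and with Artin's argument it follows that the
  separable elements form a field and that separability is transitive.  Skew polynomials are handled
  through the additive functions that they induce, on which the multiplication is composition.
\<close>

section \<open>Subfields and polynomials over them\<close>

lemma subfieldD:
  assumes "subfield_of L"
  shows "0 \<in> L" "1 \<in> L" "x \<in> L \<Longrightarrow> y \<in> L \<Longrightarrow> x + y \<in> L" "x \<in> L \<Longrightarrow> y \<in> L \<Longrightarrow> x * y \<in> L"
    "x \<in> L \<Longrightarrow> - x \<in> L" "x \<in> L \<Longrightarrow> inverse x \<in> L" "x \<in> L \<Longrightarrow> y \<in> L \<Longrightarrow> x - y \<in> L"
    "x \<in> L \<Longrightarrow> y \<in> L \<Longrightarrow> x / y \<in> L" "x \<in> L \<Longrightarrow> x ^ n \<in> L"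
proof -
  note D = assms[unfolded subfield_of_def]
  show "0 \<in> L" "1 \<in> L" using D by auto
  show *: "x + y \<in> L" "x * y \<in> L" if "x \<in> L" "y \<in> L" for x y using D that by auto
  show m: "- x \<in> L" "inverse x \<in> L" if "x \<in> L" for x using D that by auto
  show "x - y \<in> L" if "x \<in> L" "y \<in> L" using *(1)[OF that(1) m(1)[OF that(2)]] by simp
  show "x / y \<in> L" if "x \<in> L" "y \<in> L"
    using *(2)[OF that(1) m(2)[OF that(2)]] by (simp add: divide_inverse)
  show "x ^ n \<in> L" if "x \<in> L" using that D by (induction n) auto
qed

lemma subfield_sum:
  assumes "subfield_of L" "\<And>i. i \<in> I \<Longrightarrow> f i \<in> L"
  shows "sum f I \<in> L"
  using assms(2) by (induction I rule: infinite_finite_induct) (auto intro: subfieldD(1-4)[OF assms(1)])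

lemma polys_over_coeff: "p \<in> polys_over L \<Longrightarrow> coeff p i \<in> L"
  by (simp add: polys_over_def)

lemma polys_over_mono: "K \<subseteq> L \<Longrightarrow> polys_over K \<subseteq> polys_over L"
  by (auto simp: polys_over_def)

lemma polys_over_closed:
  assumes L: "subfield_of L"
  shows "0 \<in> polys_over L" "1 \<in> polys_over L" "c \<in> L \<Longrightarrow> [:c:] \<in> polys_over L"
    "c \<in> L \<Longrightarrow> monom c n \<in> polys_over L"
    "p \<in> polys_over L \<Longrightarrow> r \<in> polys_over L \<Longrightarrow> p + r \<in> polys_over L"
    "p \<in> polys_over L \<Longrightarrow> r \<in> polys_over L \<Longrightarrow> p - r \<in> polys_over L"
    "p \<in> polys_over L \<Longrightarrow> - p \<in> polys_over L"
    "p \<in> polys_over L \<Longrightarrow> r \<in> polys_over L \<Longrightarrow> p * r \<in> polys_over L"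
    "c \<in> L \<Longrightarrow> p \<in> polys_over L \<Longrightarrow> smult c p \<in> polys_over L"
    "c \<in> L \<Longrightarrow> p \<in> polys_over L \<Longrightarrow> pCons c p \<in> polys_over L"
proof -
  note D = subfieldD[OF L]
  show "0 \<in> polys_over L" "1 \<in> polys_over L" "c \<in> L \<Longrightarrow> [:c:] \<in> polys_over L"
    "c \<in> L \<Longrightarrow> monom c n \<in> polys_over L"
    "p \<in> polys_over L \<Longrightarrow> r \<in> polys_over L \<Longrightarrow> p + r \<in> polys_over L"
    "p \<in> polys_over L \<Longrightarrow> r \<in> polys_over L \<Longrightarrow> p - r \<in> polys_over L"
    "p \<in> polys_over L \<Longrightarrow> - p \<in> polys_over L"
    "c \<in> L \<Longrightarrow> p \<in> polys_over L \<Longrightarrow> smult c p \<in> polys_over L"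
    "c \<in> L \<Longrightarrow> p \<in> polys_over L \<Longrightarrow> pCons c p \<in> polys_over L"
    by (auto simp: polys_over_def coeff_pCons intro: D(1-7) split: nat.splits)
  show "p * r \<in> polys_over L" if "p \<in> polys_over L" "r \<in> polys_over L"
    unfolding polys_over_def coeff_mult mem_Collect_eq
    using that by (intro allI subfield_sum[OF L] D(4)) (auto simp: polys_over_def)
qed

lemma polys_over_sum:
  assumes "subfield_of L" "\<And>i. i \<in> I \<Longrightarrow> f i \<in> polys_over L"
  shows "sum f I \<in> polys_over L"
  using assms(2)
  by (induction I rule: infinite_finite_induct) (auto intro: polys_over_closed(1,2,5,8)[OF assms(1)])

lemma polys_over_prod:
  assumes "subfield_of L" "\<And>i. i \<in> I \<Longrightarrow> f i \<in> polys_over L"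
  shows "prod f I \<in> polys_over L"
  using assms(2)
  by (induction I rule: infinite_finite_induct) (auto intro: polys_over_closed(1,2,5,8)[OF assms(1)])

lemma polys_over_pcompose:
  assumes L: "subfield_of L" and "p \<in> polys_over L" "r \<in> polys_over L"
  shows "pcompose p r \<in> polys_over L"
  using assms(2)
proof (induction p)
  case 0
  then show ?case using polys_over_closed(1)[OF L] by simp
next
  case (pCons a p)
  have "coeff (pCons a p) 0 \<in> L" "\<And>i. coeff (pCons a p) (Suc i) \<in> L"
    using pCons.prems unfolding polys_over_def by blast+
  then have "a \<in> L" "p \<in> polys_over L" by (auto simp: polys_over_def)
  then show ?case
    using pCons.IH assms(3) by (auto simp: pcompose_pCons intro!: polys_over_closed(3,5,8)[OF L])
qed

lemma polys_over_pderiv: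
  assumes L: "subfield_of L" and "p \<in> polys_over L"
  shows "pderiv p \<in> polys_over L"
proof -
  have "of_nat n \<in> L" for n by (induction n) (auto intro: subfieldD(1-3)[OF L])
  then show ?thesis using assms(2) subfieldD(4)[OF L]
    by (auto simp: polys_over_def coeff_pderiv simp del: of_nat_Suc)
qed

lemma poly_in_subfield:
  assumes "subfield_of L" "p \<in> polys_over L" "x \<in> L"
  shows "poly p x \<in> L"
  unfolding poly_altdef using assms
  by (intro subfield_sum) (auto intro!: subfieldD(4,9)[OF assms(1)] polys_over_coeff)

lemma polys_over_div:
  assumes K: "subfield_of K" and g: "g \<in> polys_over K" "g \<noteq> 0" and p: "p \<in> polys_over K"
  obtains a r where "a \<in> polys_over K" "r \<in> polys_over K" "p = a * g + r"
    "r = 0 \<or> degree r < degree g"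
proof -
  have "\<exists>a\<in>polys_over K. \<exists>r\<in>polys_over K. p = a * g + r \<and> (r = 0 \<or> degree r < degree g)"
    using p
  proof (induction "degree p" arbitrary: p rule: less_induct)
    case less
    show ?case
    proof (cases "p = 0 \<or> degree p < degree g")
      case True
      then show ?thesis using less.prems polys_over_closed(1)[OF K] by force
    next
      case False
      define m where "m = monom (lead_coeff p / lead_coeff g) (degree p - degree g)"
      have m: "m \<in> polys_over K"
        unfolding m_def using less.prems g
        by (intro polys_over_closed(4)[OF K] subfieldD(8)[OF K] polys_over_coeff)
      define p' where "p' = p - m * g"
      have p': "p' \<in> polys_over K"
        unfolding p'_def using m g less.prems by (intro polys_over_closed(6,8)[OF K])
      have "m \<noteq> 0" using False g by (simp add: m_def)
      have dm: "degree m = degree p - degree g" using False g by (simp add: m_def degree_monom_eq)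
      have "degree (m * g) = degree p" using False \<open>m \<noteq> 0\<close> g by (simp add: degree_mult_eq dm)
      moreover have "lead_coeff (m * g) = lead_coeff p"
        unfolding lead_coeff_mult using g False by (simp add: dm) (simp add: m_def)
      ultimately have "degree p' \<le> degree p" "coeff p' (degree p) = 0"
        unfolding p'_def by (auto simp: degree_diff_le)
      then have "p' = 0 \<or> degree p' < degree p" by (rule eq_zero_or_degree_less)
      then have "\<exists>a\<in>polys_over K. \<exists>r\<in>polys_over K. p' = a * g + r \<and> (r = 0 \<or> degree r < degree g)"
        using less.hyps[OF _ p'] polys_over_closed(1)[OF K] by force
      then obtain a r where ar: "a \<in> polys_over K" "r \<in> polys_over K" "p' = a * g + r"
        "r = 0 \<or> degree r < degree g" by blast
      have "p = (a + m) * g + r" using ar(3) by (simp add: p'_def algebra_simps)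
      then show ?thesis using ar m polys_over_closed(5)[OF K] by blast
    qed
  qed
  then show ?thesis using that by blast
qed

section \<open>Minimal polynomials and simple extensions\<close>

lemma is_minpoly_dvd:
  assumes K: "subfield_of K" and M: "is_minpoly K x M" and r: "r \<in> polys_over K" "poly r x = 0"
  obtains a where "a \<in> polys_over K" "r = a * M"
proof -
  have M': "M \<in> polys_over K" "M \<noteq> 0" using M by (auto simp: is_minpoly_def)
  obtain a b where ab: "a \<in> polys_over K" "b \<in> polys_over K" "r = a * M + b"
    "b = 0 \<or> degree b < degree M"
    using polys_over_div[OF K M' r(1)] by blast
  have "poly b x = 0" using ab(3) r(2) M by (simp add: is_minpoly_def)
  then have "b = 0" using ab M unfolding is_minpoly_def by (meson not_less)
  then show ?thesis using that ab by auto
qed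

lemma is_minpoly_exists:
  assumes K: "subfield_of K" and p: "p \<in> polys_over K" "p \<noteq> 0" "poly p x = 0"
  obtains M where "is_minpoly K x M"
proof -
  let ?P = "\<lambda>p. p \<in> polys_over K \<and> p \<noteq> 0 \<and> poly p x = 0"
  obtain m where m: "?P m" "\<And>r. ?P r \<Longrightarrow> degree m \<le> degree r"
    using ex_has_least_nat[of ?P p degree] p by blast
  have "is_minpoly K x (smult (inverse (lead_coeff m)) m)"
    using m by (auto simp: is_minpoly_def intro!: polys_over_closed(9)[OF K] subfieldD(6)[OF K] polys_over_coeff)
  then show ?thesis by (rule that)
qed

lemma is_minpoly_degree_pos: "is_minpoly K x M \<Longrightarrow> 0 < degree M"
  by (rule ccontr) (auto simp: is_minpoly_def elim!: degree_eq_zeroE)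

text \<open>This is the irreducibility of minimal polynomials, in the form in which it is used below.\<close>

lemma is_minpoly_conjugate:
  assumes K: "subfield_of K" and M: "is_minpoly K x M" and y: "poly M y = 0"
  shows "is_minpoly K y M"
proof -
  have M': "M \<in> polys_over K" "M \<noteq> 0" "poly M x = 0" using M by (auto simp: is_minpoly_def)
  obtain N where N: "is_minpoly K y N" using is_minpoly_exists[OF K M'(1,2) y] .
  obtain a where a: "a \<in> polys_over K" "M = a * N" using is_minpoly_dvd[OF K N M'(1) y] .
  have "a \<noteq> 0" "N \<noteq> 0" using a M' by auto
  have "degree M \<le> degree N"
  proof (cases "poly N x = 0")
    case True
    then show ?thesis using M N \<open>N \<noteq> 0\<close> by (simp add: is_minpoly_def)
  next
    case False
    then have "poly a x = 0" using M' a by simp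
    then have "degree M \<le> degree a" using M \<open>a \<noteq> 0\<close> a by (simp add: is_minpoly_def)
    then show ?thesis using a \<open>a \<noteq> 0\<close> \<open>N \<noteq> 0\<close> is_minpoly_degree_pos[OF N] by (simp add: degree_mult_eq)
  qed
  then show ?thesis using M y N by (auto simp: is_minpoly_def intro: le_trans)
qed

text \<open>The ring \<open>K[x]\<close>, which is the field \<open>K(x)\<close> if \<open>x\<close> is algebraic over \<open>K\<close>.\<close>

definition adj :: "'k::field set \<Rightarrow> 'k \<Rightarrow> 'k set" where
  "adj K x = (\<lambda>p. poly p x) ` polys_over K"

lemma adjI: "p \<in> polys_over K \<Longrightarrow> poly p x \<in> adj K x"
  by (auto simp: adj_def)

lemma adj_base: "subfield_of K \<Longrightarrow> K \<subseteq> adj K x"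
  using adjI[of "[:_:]" K x] polys_over_closed(3) by fastforce

lemma adj_gen: "subfield_of K \<Longrightarrow> x \<in> adj K x"
  using adjI[of "[:0,1:]" K x] polys_over_closed(2,10) subfieldD(1)[of K]
  by (metis mult.right_neutral one_pCons pCons_0_0 poly_0 poly_pCons add_0 add.right_neutral mult_zero_right)

lemma adj_least:
  assumes "subfield_of L" "K \<subseteq> L" "x \<in> L"
  shows "adj K x \<subseteq> L"
  using poly_in_subfield[OF assms(1) _ assms(3)] polys_over_mono[OF assms(2)] by (auto simp: adj_def)

lemma adj_subfield:
  assumes K: "subfield_of K" and p: "p \<in> polys_over K" "p \<noteq> 0" "poly p x = 0"
  shows "subfield_of (adj K x)"
proof -
  obtain M where M: "is_minpoly K x M" using is_minpoly_exists[OF K p] .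
  have M': "M \<in> polys_over K" "M \<noteq> 0" "poly M x = 0" using M by (auto simp: is_minpoly_def)
  have min: "degree M \<le> degree r" if "r \<in> polys_over K" "r \<noteq> 0" "poly r x = 0" for r
    using M that by (simp add: is_minpoly_def)
  (* dividing M by r leaves a multiple of r x of smaller degree *)
  have inv: "\<exists>b\<in>polys_over K. poly b x * poly r x = 1"
    if "r \<in> polys_over K" "poly r x \<noteq> 0" "degree r < degree M" for r
    using that
  proof (induction "degree r" arbitrary: r rule: less_induct)
    case less
    have r0: "r \<noteq> 0" using less by auto
    obtain a b where ab: "a \<in> polys_over K" "b \<in> polys_over K" "M = a * r + b"
      "b = 0 \<or> degree b < degree r"
      using polys_over_div[OF K less.prems(1) r0 M'(1)] .
    show ?case
    proof (cases "b = 0")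
      case True
      then have "poly a x = 0" "a \<noteq> 0" using ab(3) M' less.prems by auto
      then have "degree M \<le> degree a" using min ab by blast
      then have "degree r = 0" using ab(3) True \<open>a \<noteq> 0\<close> r0 by (simp add: degree_mult_eq)
      then obtain c where c: "r = [:c:]" by (auto elim: degree_eq_zeroE)
      then have "c \<in> K" "c \<noteq> 0" using less.prems polys_over_coeff[of r K 0] by auto
      then show ?thesis
        using c by (intro bexI[of _ "[:inverse c:]"]) (auto intro!: polys_over_closed(3)[OF K] subfieldD(6)[OF K])
    next
      case False
      then have "degree b < degree r" using ab by simp
      moreover have "poly b x \<noteq> 0" using min[OF ab(2) False] \<open>degree b < degree r\<close> less.prems by auto
      ultimately obtain b' where b': "b' \<in> polys_over K" "poly b' x * poly b x = 1"
        using less.hyps[of b] ab less.prems by auto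
      have "poly b x = - (poly a x * poly r x)" using ab(3) M'(3)
        by (simp add: eq_neg_iff_add_eq_0 add.commute)
      then have "poly (- (b' * a)) x * poly r x = 1" using b' by (simp add: algebra_simps)
      moreover have "- (b' * a) \<in> polys_over K" using b' ab by (intro polys_over_closed(7,8)[OF K])
      ultimately show ?thesis by blast
    qed
  qed
  have inverse: "inverse z \<in> adj K x" if z: "z \<in> adj K x" for z
  proof (cases "z = 0")
    case False
    obtain r where r: "r \<in> polys_over K" "z = poly r x" using z by (auto simp: adj_def)
    obtain a b where ab: "a \<in> polys_over K" "b \<in> polys_over K" "r = a * M + b"
      "b = 0 \<or> degree b < degree M"
      using polys_over_div[OF K M'(1,2) r(1)] .
    have zb: "z = poly b x" using r ab M' by simp
    then obtain c where "c \<in> polys_over K" "poly c x * poly b x = 1"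
      using inv[of b] ab False by auto
    then show ?thesis using zb adjI[of c K x] inverse_unique[of z "poly c x"] by (simp add: mult.commute)
  qed (use z in auto)
  show ?thesis
    unfolding subfield_of_def
  proof (intro conjI ballI)
    show "0 \<in> adj K x" "1 \<in> adj K x" using adj_base[OF K] subfieldD[OF K] by auto
    fix u v assume "u \<in> adj K x" "v \<in> adj K x"
    then obtain a b where "a \<in> polys_over K" "b \<in> polys_over K" "u = poly a x" "v = poly b x"
      by (auto simp: adj_def)
    then show "u + v \<in> adj K x" "u * v \<in> adj K x" "- u \<in> adj K x"
      using adjI[of "a + b" K x] adjI[of "a * b" K x] adjI[of "- a" K x]
      by (auto simp: polys_over_closed[OF K])
  qed (rule inverse)
qed

text \<open>The minimal polynomial of \<open>x\<close> over \<open>F\<close> divides \<open>r\<^sub>1\<close> and \<open>r\<^sub>2\<close>, so it has no root but the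
  simple root \<open>x\<close>: this is the gcd argument of the primitive element theorem.\<close>

lemma unique_common_root_in_subfield:
  fixes x :: "'k::alg_closed_field"
  assumes F: "subfield_of F" and r1: "r1 \<in> polys_over F" "r1 \<noteq> 0" "poly r1 x = 0" "Polynomial.order x r1 \<le> 1"
    and r2: "r2 \<in> polys_over F" "poly r2 x = 0"
    and uniq: "\<And>z. poly r1 z = 0 \<Longrightarrow> poly r2 z = 0 \<Longrightarrow> z = x"
  shows "x \<in> F"
proof -
  obtain N where N: "is_minpoly F x N" using is_minpoly_exists[OF F r1(1-3)] .
  obtain a1 where a1: "r1 = a1 * N" using is_minpoly_dvd[OF F N r1(1,3)] .
  obtain a2 where a2: "r2 = a2 * N" using is_minpoly_dvd[OF F N r2] .
  have N0: "poly N x = 0" "N \<noteq> 0" "lead_coeff N = 1" "N \<in> polys_over F"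
    using N by (auto simp: is_minpoly_def)
  obtain N1 where N1: "N = [:- x, 1:] * N1" using N0 by (metis dvdE poly_eq_0_iff_dvd)
  have "degree N1 = 0"
  proof (rule ccontr)
    assume "degree N1 \<noteq> 0"
    then obtain z where z: "poly N1 z = 0" using alg_closed_imp_poly_has_root by blast
    then have "poly N z = 0" using N1 by simp
    then have "z = x" using uniq a1 a2 by simp
    then have "[:- x, 1:] dvd N1" using z poly_eq_0_iff_dvd by blast
    then have "[:- x, 1:] ^ 2 dvd r1" unfolding a1 N1 power2_eq_square
      by (rule dvd_mult[OF mult_dvd_mono[OF dvd_refl]])
    then have "2 \<le> Polynomial.order x r1" using order_divides r1(2) by blast
    then show False using r1(4) by simp
  qed
  then obtain c where "N1 = [:c:]" by (auto elim: degree_eq_zeroE)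
  then have "N = [:- x * c, c:]" using N1 by simp
  then have "N = [:- x, 1:]" using N0 by (simp split: if_splits)
  then show ?thesis using polys_over_coeff[OF N0(4), of 0] subfieldD(5)[OF F, of "- x"] by simp
qed

section \<open>Roots of squarefree polynomials\<close>

lemma order_prod_mset_linear:
  "Polynomial.order a (\<Prod>x\<in>#A. [:- x, 1:]) = count A (a :: 'k::field)"
proof (induction A)
  case empty
  then show ?case by simp
next
  case (add x A)
  have "[:- x, 1:] * (\<Prod>x\<in>#A. [:- x, 1:]) \<noteq> 0" by (auto simp: prod_mset_zero_iff simp del: mult_pCons_left)
  moreover have "Polynomial.order a [:- x, 1:] = (if a = x then 1 else 0)"
    using order_power_n_n[of a 1] by (auto intro: order_0I)
  ultimately show ?case using add.IH by (simp add: order_mult del: mult_pCons_left)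
qed

lemma rsquarefree_prod_linear:
  assumes "finite W"
  shows "rsquarefree (\<Prod>x\<in>W. [:- x, 1::'k::field:])"
  unfolding rsquarefree_def
proof
  show "(\<Prod>x\<in>W. [:- x, 1::'k:]) \<noteq> 0" using assms by simp
  have "Polynomial.order a (\<Prod>x\<in>W. [:- x, 1:]) = count (mset_set W) a" for a :: 'k
    unfolding order_prod_mset_linear[symmetric] prod_unfold_prod_mset by simp
  then show "\<forall>a. Polynomial.order a (\<Prod>x\<in>W. [:- x, 1:]) = 0 \<or>
      Polynomial.order a (\<Prod>x\<in>W. [:- x, 1:]) = (1::nat)"
    by (simp add: count_mset_set')
qed

lemma rsquarefree_dvd: "rsquarefree p \<Longrightarrow> r dvd p \<Longrightarrow> rsquarefree r"
  unfolding rsquarefree_def by (metis One_nat_def dvd_0_left_iff dvd_imp_order_le le_Suc_eq le_zero_eq)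

text \<open>Over an algebraically closed field the number of roots with multiplicity is the degree.\<close>

lemma rsquarefree_card_roots:
  fixes p :: "'k::alg_closed_field poly"
  assumes "rsquarefree p"
  shows "card {x. poly p x = 0} = degree p"
proof -
  have p: "p \<noteq> 0" using assms by (simp add: rsquarefree_def)
  obtain A where A: "size A = degree p" "p = smult (lead_coeff p) (\<Prod>x\<in>#A. [:- x, 1:])"
    using alg_closed_imp_factorization[OF p] by blast
  have ord: "Polynomial.order a p = count A a" for a
    using order_smult[of "lead_coeff p" a "\<Prod>x\<in>#A. [:- x, 1:]"] A(2) p
    by (simp add: order_prod_mset_linear)
  have "count A a \<le> 1" for a
    using assms ord[of a] unfolding rsquarefree_def by (metis le_numeral_extra(4) zero_le_one)
  then have "count A a = 1" if "a \<in># A" for a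
    using that by (simp add: le_antisym Suc_leI)
  then have "mset_set (set_mset A) = A" by (intro multiset_eqI) (simp add: count_mset_set' not_in_iff)
  moreover have "{x. poly p x = 0} = set_mset A"
    using p ord by (auto simp: order_root count_greater_zero_iff[symmetric] simp del: count_greater_zero_iff)
  ultimately show ?thesis using A(1) by (metis size_mset_set)
qed

lemma multiple_root:
  assumes "p \<noteq> 0" "\<not> rsquarefree p"
  obtains a where "poly p a = 0" "poly (pderiv p) (a :: 'k::field) = 0"
proof -
  obtain a where "Polynomial.order a p \<noteq> 0" "Polynomial.order a p \<noteq> 1"
    using assms unfolding rsquarefree_def by blast
  then have "[:- a, 1:] ^ 2 dvd p" using order_divides[of a 2 p] by simp
  then obtain h where "p = [:- a, 1:] ^ 2 * h" by (elim dvdE)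
  then have "p = [:- a, 1:] * ([:- a, 1:] * h)" by (simp only: power2_eq_square mult.assoc)
  then have "poly p a = 0" "poly (pderiv p) a = 0"
    by (simp_all only: pderiv_mult poly_add poly_mult) (simp_all add: pderiv_pCons)
  then show ?thesis by (rule that)
qed

lemma order_le_1_rsquarefree: "rsquarefree p \<Longrightarrow> Polynomial.order a p \<le> 1"
  unfolding rsquarefree_def by (metis le_numeral_extra(4) zero_le_one)

section \<open>Homomorphisms over a subfield\<close>

text \<open>A homomorphism \<open>E \<rightarrow> 'k\<close> over \<open>K\<close>; the values outside \<open>E\<close> are arbitrary.\<close>

definition khom :: "'k::field set \<Rightarrow> 'k set \<Rightarrow> ('k \<Rightarrow> 'k) \<Rightarrow> bool" where
  "khom K E s \<longleftrightarrow> (\<forall>x\<in>K. s x = x) \<and>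
     (\<forall>x\<in>E. \<forall>y\<in>E. s (x + y) = s x + s y \<and> s (x * y) = s x * s y)"

context
  fixes K E :: "'k::field set" and s
  assumes K: "subfield_of K" and E: "subfield_of E" and KE: "K \<subseteq> E" and s: "khom K E s"
begin

lemma khom_simps:
  shows "x \<in> K \<Longrightarrow> s x = x" "s 0 = 0" "s 1 = 1"
    "x \<in> E \<Longrightarrow> y \<in> E \<Longrightarrow> s (x + y) = s x + s y"
    "x \<in> E \<Longrightarrow> y \<in> E \<Longrightarrow> s (x * y) = s x * s y"
    "x \<in> E \<Longrightarrow> s (- x) = - s x"
    "x \<in> E \<Longrightarrow> y \<in> E \<Longrightarrow> s (x - y) = s x - s y"
    "x \<in> E \<Longrightarrow> s (x ^ n) = s x ^ n"
    "x \<in> E \<Longrightarrow> s (inverse x) = inverse (s x)"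
    "x \<in> E \<Longrightarrow> y \<in> E \<Longrightarrow> s (x / y) = s x / s y"
proof -
  note D = subfieldD[OF E]
  show base: "s x = x" if "x \<in> K" for x using s that by (simp add: khom_def)
  show z: "s 0 = 0" and o: "s 1 = 1" using base subfieldD(1,2)[OF K] by auto
  show add: "s (x + y) = s x + s y" and mult: "s (x * y) = s x * s y" if "x \<in> E" "y \<in> E" for x y
    using s that by (simp_all add: khom_def)
  show minus: "s (- x) = - s x" if "x \<in> E" for x
    using add[OF that D(5)[OF that]] z by (simp add: eq_neg_iff_add_eq_0 add.commute)
  show "s (x - y) = s x - s y" if "x \<in> E" "y \<in> E"
    using add[OF that(1) D(5)[OF that(2)]] minus[OF that(2)] by simp
  show "s (x ^ n) = s x ^ n" if "x \<in> E"
    by (induction n) (simp_all add: o mult that D)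
  show inv: "s (inverse x) = inverse (s x)" if "x \<in> E" for x
  proof (cases "x = 0")
    case False
    then have "s x * s (inverse x) = 1" using mult[OF that D(6)[OF that]] o by simp
    then show ?thesis using inverse_unique by metis
  qed (simp add: z)
  show "s (x / y) = s x / s y" if "x \<in> E" "y \<in> E"
    using mult[OF that(1) D(6)[OF that(2)]] inv[OF that(2)] by (simp add: divide_inverse)
qed

lemma khom_sum: "(\<And>i. i \<in> I \<Longrightarrow> f i \<in> E) \<Longrightarrow> s (sum f I) = (\<Sum>i\<in>I. s (f i))"
proof (induction I rule: infinite_finite_induct)
  case (insert i I)
  then show ?case using khom_simps(4)[of "f i" "sum f I"] subfield_sum[OF E, of I f] by simp
qed (simp_all add: khom_simps(2))

lemma khom_inj: "x \<in> E \<Longrightarrow> y \<in> E \<Longrightarrow> s x = s y \<Longrightarrow> x = y"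
proof -
  assume xy: "x \<in> E" "y \<in> E" "s x = s y"
  show "x = y"
  proof (rule ccontr)
    assume "x \<noteq> y"
    then have "s ((x - y) * inverse (x - y)) = 1" by (simp add: khom_simps)
    moreover have "s ((x - y) * inverse (x - y)) = s (x - y) * s (inverse (x - y))"
      using xy by (intro khom_simps subfieldD[OF E])
    ultimately show False using xy by (simp add: khom_simps)
  qed
qed

lemma khom_poly:
  assumes "p \<in> polys_over E" "x \<in> E"
  shows "s (poly p x) = poly (map_poly s p) (s x)"
proof -
  have "s (poly p x) = (\<Sum>i\<le>degree p. s (coeff p i) * s x ^ i)"
    unfolding poly_altdef using assms
    by (subst khom_sum) (auto simp: khom_simps(5,8) subfieldD(4,9)[OF E] polys_over_coeff)
  also have "\<dots> = (\<Sum>i\<le>degree p. coeff (map_poly s p) i * s x ^ i)"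
    by (simp add: coeff_map_poly khom_simps)
  also have "\<dots> = (\<Sum>i\<le>degree (map_poly s p). coeff (map_poly s p) i * s x ^ i)"
    by (intro sum.mono_neutral_right) (auto simp: coeff_eq_0 map_poly_degree_leq)
  finally show ?thesis by (simp add: poly_altdef)
qed

lemma khom_map_poly_id: "p \<in> polys_over K \<Longrightarrow> map_poly s p = p"
  by (intro poly_eqI) (simp add: coeff_map_poly khom_simps polys_over_coeff)

lemma khom_poly_base: "p \<in> polys_over K \<Longrightarrow> x \<in> E \<Longrightarrow> s (poly p x) = poly p (s x)"
  using khom_poly khom_map_poly_id polys_over_mono[OF KE] by auto

lemma khom_map_poly_mult:
  "p \<in> polys_over E \<Longrightarrow> r \<in> polys_over E \<Longrightarrow> map_poly s (p * r) = map_poly s p * map_poly s r"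
  by (intro poly_eqI)
     (auto simp: coeff_map_poly khom_simps(2,5) coeff_mult khom_sum polys_over_coeff subfieldD(4)[OF E])

lemma khom_map_poly_prod_linear:
  "(\<And>i. i \<in> I \<Longrightarrow> f i \<in> E) \<Longrightarrow>
     map_poly s (\<Prod>i\<in>I. [:- f i, 1:]) = (\<Prod>i\<in>I. [:- s (f i), 1:])"
proof (induction I rule: infinite_finite_induct)
  case (insert i I)
  have "(\<Prod>i\<in>I. [:- f i, 1:]) \<in> polys_over E" "[:- f i, 1:] \<in> polys_over E"
    using insert.prems by (auto intro!: polys_over_prod[OF E] polys_over_closed(3,10)[OF E] subfieldD(2,5)[OF E])
  moreover have "map_poly s [:- f i, 1:] = [:- s (f i), 1:]"
    using insert.prems by (simp add: map_poly_pCons khom_simps)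
  ultimately show ?case using insert by (simp add: khom_map_poly_mult del: mult_pCons_left)
qed (simp_all add: khom_simps)

end

text \<open>The map \<open>K(x) \<rightarrow> K(y)\<close> is well defined, because the minimal polynomial of \<open>x\<close> divides every
  polynomial over \<open>K\<close> that vanishes at \<open>x\<close>.\<close>

lemma khom_adj:
  assumes K: "subfield_of K" and M: "is_minpoly K x M" and y: "poly M y = 0"
  shows "\<exists>s. khom K (adj K x) s \<and> (\<forall>p\<in>polys_over K. s (poly p x) = poly p y)"
proof -
  define s where "s = (\<lambda>z. poly (SOME p. p \<in> polys_over K \<and> poly p x = z) y)"
  have s: "s (poly p x) = poly p y" if p: "p \<in> polys_over K" for p
  proof -
    define r where "r = (SOME r. r \<in> polys_over K \<and> poly r x = poly p x)"
    have r: "r \<in> polys_over K \<and> poly r x = poly p x" unfolding r_def by (rule someI) (use p in simp)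
    then have "r - p \<in> polys_over K" "poly (r - p) x = 0" using p by (auto intro: polys_over_closed(6)[OF K])
    then obtain a where "r - p = a * M" using is_minpoly_dvd[OF K M] by metis
    then have "poly (r - p) y = 0" using y by simp
    then show ?thesis unfolding s_def r_def[symmetric] by simp
  qed
  have "khom K (adj K x) s"
    unfolding khom_def
  proof (intro conjI ballI)
    fix c assume "c \<in> K"
    then show "s c = c" using s[of "[:c:]"] polys_over_closed(3)[OF K] by simp
  next
    fix u v assume "u \<in> adj K x" "v \<in> adj K x"
    then obtain a b where "a \<in> polys_over K" "b \<in> polys_over K" "u = poly a x" "v = poly b x"
      by (auto simp: adj_def)
    then show "s (u + v) = s u + s v" "s (u * v) = s u * s v"
      using s[of "a + b"] s[of "a * b"] s[of a] s[of b] polys_over_closed(5,8)[OF K] by auto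
  qed
  then show ?thesis using s by blast
qed

section \<open>Separability\<close>

locale sep_base =
  fixes K :: "'k::alg_closed_field set"
  assumes K: "subfield_of K" and alg: "algebraic_closure_of K"
    and inf: "infinite K" and char_pos: "CHAR('k) > 0"
begin

lemma char_prime: "prime CHAR('k)"
  using char_pos prime_CHAR_semidom by blast

lemma frob_add: "(x + y :: 'k) ^ CHAR('k) = x ^ CHAR('k) + y ^ CHAR('k)"
  using char_prime by (rule freshmans_dream) simp

lemma frob_inj: "(x :: 'k) ^ CHAR('k) = y ^ CHAR('k) \<Longrightarrow> x = y"
  using frob_add[of "x - y" y] char_pos by simp

lemma minpoly_ex: obtains M where "is_minpoly K x M"
  using alg is_minpoly_exists[OF K] unfolding algebraic_closure_of_def by blast

lemma adj_field: "subfield_of (adj K x)"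
  using alg adj_subfield[OF K] unfolding algebraic_closure_of_def by blast

lemma extension:
  assumes "subfield_of F" "K \<subseteq> F"
  shows "sep_base F"
proof
  show "algebraic_closure_of F"
    using alg polys_over_mono[OF assms(2)] unfolding algebraic_closure_of_def by blast
  show "infinite F" using inf assms(2) finite_subset by blast
qed (use assms char_pos in auto)

lemma sep_closureI:
  assumes "r \<in> polys_over K" "rsquarefree r" "poly r x = 0"
  shows "x \<in> sep_closure K"
proof -
  obtain M where M: "is_minpoly K x M" using minpoly_ex .
  then show ?thesis using is_minpoly_dvd[OF K M assms(1,3)] rsquarefree_dvd[OF assms(2)]
    unfolding sep_closure_def by (metis (mono_tags, lifting) dvd_triv_right mem_Collect_eq)
qed

lemma base_subset_sep_closure: "K \<subseteq> sep_closure K"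
proof
  fix c assume "c \<in> K"
  then show "c \<in> sep_closure K"
    using rsquarefree_prod_linear[of "{c}"]
    by (intro sep_closureI[of "[:- c, 1:]"])
       (auto intro!: polys_over_closed(3,10)[OF K] subfieldD(2,5)[OF K])
qed

text \<open>The element \<open>x\<close> is the only common root of its minimal polynomial over \<open>K\<close>, where it is a simple
  root, and of \<open>X\<^sup>p - x\<^sup>p = (X - x)\<^sup>p\<close>.\<close>

lemma separable_in_adj_frob:
  assumes x: "x \<in> sep_closure K"
  shows "x \<in> adj K (x ^ CHAR('k))"
proof -
  let ?p = "CHAR('k)" and ?F = "adj K (x ^ CHAR('k))"
  obtain M where M: "is_minpoly K x M" "rsquarefree M" using x by (auto simp: sep_closure_def)
  have F: "subfield_of ?F" by (rule adj_field)
  have "M \<in> polys_over ?F" using M polys_over_mono[OF adj_base[OF K]] by (auto simp: is_minpoly_def)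
  moreover have "monom 1 ?p - [:x ^ ?p:] \<in> polys_over ?F"
    using adj_gen[OF K] by (intro polys_over_closed(3,4,6)[OF F] subfieldD(2)[OF F])
  ultimately show ?thesis
    using M order_le_1_rsquarefree[OF M(2)]
    by (intro unique_common_root_in_subfield[OF F, of M x "monom 1 ?p - [:x ^ ?p:]"])
       (auto simp: is_minpoly_def poly_monom rsquarefree_def intro: frob_inj)
qed

text \<open>If the minimal polynomial \<open>M\<close> of \<open>x\<close> has a multiple root, then \<open>M = g(X\<^sup>p)\<close>, and
  \<open>x \<in> K[x\<^sup>p]\<close> would give an equation for \<open>x\<close> of degree smaller than \<open>p \<cdot> degree g\<close>.\<close>

lemma adj_frob_imp_separable:
  assumes x: "x \<in> adj K (x ^ CHAR('k))"
  shows "x \<in> sep_closure K"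
proof (rule ccontr)
  let ?p = "CHAR('k)"
  assume nsep: "x \<notin> sep_closure K"
  obtain M where M: "is_minpoly K x M" using minpoly_ex .
  then have M0: "M \<noteq> 0" "M \<in> polys_over K" "poly M x = 0" by (auto simp: is_minpoly_def)
  have "\<not> rsquarefree M" using nsep M by (auto simp: sep_closure_def)
  then obtain a where a: "poly M a = 0" "poly (pderiv M) a = 0" using multiple_root M0 by metis
  have Ma: "is_minpoly K a M" by (rule is_minpoly_conjugate[OF K M a(1)])
  have "degree (pderiv M) < degree M"
    using is_minpoly_degree_pos[OF M] degree_le[of "degree M - 1" "pderiv M"]
    by (force simp: coeff_pderiv coeff_eq_0)
  then have "pderiv M = 0"
    using Ma polys_over_pderiv[OF K M0(2)] a(2) unfolding is_minpoly_def by (meson not_less)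
  then have "of_nat (Suc i) * coeff M (Suc i) = 0" for i by (metis coeff_pderiv coeff_0)
  then have dvd: "?p dvd i" if "coeff M i \<noteq> 0" for i
    using that by (cases i) (auto simp: of_nat_eq_0_iff_char_dvd simp del: of_nat_Suc)
  define g where "g = (\<Sum>j\<le>degree M. monom (coeff M (?p * j)) j)"
  have g: "g \<in> polys_over K"
    unfolding g_def using M0 by (intro polys_over_sum polys_over_closed(4) K polys_over_coeff)
  have cg: "coeff g j = coeff M (?p * j)" for j
  proof -
    have "coeff g j = (if j \<le> degree M then coeff M (?p * j) else 0)" by (simp add: g_def coeff_sum)
    moreover have "j \<le> ?p * j" using char_pos by simp
    then have "coeff M (?p * j) = 0" if "\<not> j \<le> degree M" using that by (intro coeff_eq_0) linarith
    ultimately show ?thesis by auto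
  qed
  have "M = (\<Sum>j\<le>degree M. monom (coeff M (?p * j)) (?p * j))"
  proof (rule poly_eqI)
    fix i
    have "coeff (\<Sum>j\<le>degree M. monom (coeff M (?p * j)) (?p * j)) i
      = (\<Sum>j\<le>degree M. if ?p * j = i then coeff M i else 0)"
      by (auto simp: coeff_sum intro!: sum.cong)
    also have "\<dots> = coeff M i"
    proof (cases "coeff M i = 0")
      case False
      then obtain j where j: "i = ?p * j" using dvd[OF False] by (elim dvdE) auto
      have "i \<le> degree M" using False le_degree by blast
      moreover have "j \<le> i" using char_pos by (simp add: j)
      ultimately have "j \<le> degree M" by simp
      moreover have "(?p * j' = i) = (j' = j)" for j' using char_pos by (auto simp: j)
      ultimately show ?thesis by simp
    qed (simp add: sum.neutral)
    finally show "coeff M i = coeff (\<Sum>j\<le>degree M. monom (coeff M (?p * j)) (?p * j)) i" by simp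
  qed
  then have "poly M x = poly g (x ^ ?p)"
    unfolding g_def by (metis (no_types, lifting) poly_monom poly_sum power_mult sum.cong)
  then have gx: "poly g (x ^ ?p) = 0" using M0 by simp
  obtain k where k: "degree M = ?p * k"
    using dvd[of "degree M"] M0 by auto
  then have "coeff g k \<noteq> 0" using cg[of k] M0(1) by (metis leading_coeff_neq_0)
  then have g0: "g \<noteq> 0" by auto
  have "coeff M (?p * degree g) \<noteq> 0" using cg[of "degree g"] g0 by (metis leading_coeff_neq_0)
  then have dg: "?p * degree g \<le> degree M" by (rule le_degree)
  have "degree g \<noteq> 0"
  proof
    assume "degree g = 0"
    then obtain c where "g = [:c:]" by (rule degree_eq_zeroE)
    then show False using gx g0 by simp
  qed
  obtain P where P: "P \<in> polys_over K" "x = poly P (x ^ ?p)" using x by (auto simp: adj_def)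
  obtain c r where cr: "c \<in> polys_over K" "r \<in> polys_over K" "P = c * g + r"
    "r = 0 \<or> degree r < degree g" using polys_over_div[OF K g g0 P(1)] .
  have xr: "x = poly r (x ^ ?p)" using P(2) cr(3) gx by simp
  define R where "R = monom 1 1 - pcompose r (monom 1 ?p)"
  have "R \<in> polys_over K"
    unfolding R_def using cr
    by (intro polys_over_closed(4,6)[OF K] polys_over_pcompose[OF K] subfieldD(2)[OF K])
  moreover have "poly R x = 0"
    using xr by (simp add: R_def poly_pcompose poly_monom)
  moreover have "pderiv R = 1"
    by (simp add: R_def pderiv_diff pderiv_pcompose pderiv_monom)
  then have "R \<noteq> 0" by auto
  ultimately have "degree M \<le> degree R" using M by (simp add: is_minpoly_def)
  have "degree r < degree g" using cr(4) \<open>degree g \<noteq> 0\<close> by auto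
  have "degree R \<le> max (degree (monom (1::'k) 1)) (degree (pcompose r (monom 1 ?p)))"
    unfolding R_def by (rule degree_diff_le_max)
  also have "\<dots> \<le> max 1 (degree r * ?p)"
    using degree_pcompose_le[of r "monom 1 ?p"] by (intro max.mono) (auto simp: degree_monom_eq)
  also have "\<dots> < ?p * degree g"
  proof -
    have "?p * 1 \<le> ?p * degree g" using \<open>degree g \<noteq> 0\<close> by (intro mult_le_mono2) simp
    then have "1 < ?p * degree g" using prime_gt_1_nat[OF char_prime] by linarith
    moreover have "degree r * ?p < ?p * degree g" using \<open>degree r < degree g\<close> char_pos by simp
    ultimately show ?thesis by simp
  qed
  finally show False using \<open>degree M \<le> degree R\<close> dg by simp
qed

lemma frob_adj: "z \<in> adj K x \<Longrightarrow> z ^ CHAR('k) \<in> adj K (x ^ CHAR('k))"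
proof -
  let ?p = "CHAR('k)"
  assume "z \<in> adj K x"
  then obtain b where b: "b \<in> polys_over K" "z = poly b x" by (auto simp: adj_def)
  have "z ^ ?p = (\<Sum>i\<le>degree b. (coeff b i * x ^ i) ^ ?p)"
    unfolding b(2) poly_altdef by (rule freshmans_dream_sum[OF char_prime refl])
  also have "\<dots> = (\<Sum>i\<le>degree b. coeff b i ^ ?p * (x ^ ?p) ^ i)"
    by (simp add: power_mult_distrib flip: power_mult) (simp add: mult.commute)
  also have "\<dots> \<in> adj K (x ^ ?p)"
    using polys_over_coeff[OF b(1)] adj_base[OF K, of "x ^ ?p"]
    by (intro subfield_sum[OF adj_field] subfieldD(4)[OF adj_field]
        subfieldD(9)[OF adj_field adj_gen[OF K]] subfieldD(9)[OF adj_field]) blast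
  finally show ?thesis .
qed

lemma adj_subset_field: "subfield_of L \<Longrightarrow> K \<subseteq> L \<Longrightarrow> x \<in> L \<Longrightarrow> z \<in> adj K x \<Longrightarrow> z \<in> L"
  using adj_least by blast

text \<open>The element \<open>b\<close> is the only common root of its minimal polynomial and of \<open>M\<^sub>a(c - t X)\<close>, for
  \<open>c = a + t b\<close> and the minimal polynomial \<open>M\<^sub>a\<close> of \<open>a\<close>, unless \<open>t\<close> is one of finitely many quotients
  of differences of conjugates.\<close>

lemma primitive_element:
  assumes b: "b \<in> sep_closure K"
  obtains t where "t \<in> K" "b \<in> adj K (a + t * b)" "a \<in> adj K (a + t * b)"
proof -
  obtain Mb where Mb: "is_minpoly K b Mb" "rsquarefree Mb" using b by (auto simp: sep_closure_def)
  obtain Ma where Ma: "is_minpoly K a Ma" using minpoly_ex .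
  have nz: "Ma \<noteq> 0" "Mb \<noteq> 0" using Ma Mb by (auto simp: is_minpoly_def)
  define bad where "bad = (\<lambda>(u, v). (u - a) / (b - v)) ` ({u. poly Ma u = 0} \<times> {v. poly Mb v = 0})"
  have "finite bad" unfolding bad_def using poly_roots_finite nz by blast
  then obtain t where t: "t \<in> K" "t \<notin> bad" using inf by (meson finite_subset subsetI)
  let ?F = "adj K (a + t * b)"
  have F: "subfield_of ?F" by (rule adj_field)
  have g: "a + t * b \<in> ?F" by (rule adj_gen[OF K])
  have KF: "K \<subseteq> ?F" by (rule adj_base[OF K])
  let ?r = "pcompose Ma [:a + t * b, - t:]"
  have "Mb \<in> polys_over ?F" "Ma \<in> polys_over ?F"
    using Ma Mb polys_over_mono[OF KF] by (auto simp: is_minpoly_def)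
  moreover from this have "?r \<in> polys_over ?F"
    using t KF
    by (intro polys_over_pcompose[OF F] polys_over_closed(10)[OF F] polys_over_closed(1)[OF F]
        subfieldD(5)[OF F] g) blast+
  moreover have "z = b" if "poly Mb z = 0" "poly ?r z = 0" for z
  proof (rule ccontr)
    assume "z \<noteq> b"
    have "poly Ma (a + t * b - t * z) = 0" using that(2) by (simp add: poly_pcompose algebra_simps)
    moreover have "t = ((a + t * b - t * z) - a) / (b - z)"
    proof -
      have "t * (b - z) = (a + t * b - t * z) - a" by (simp add: algebra_simps)
      then show ?thesis using \<open>z \<noteq> b\<close> by (simp add: eq_divide_eq)
    qed
    ultimately have "t \<in> bad" unfolding bad_def
      using that(1) by (intro image_eqI[of _ _ "(a + t * b - t * z, z)"]) simp_all
    then show False using t by simp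
  qed
  moreover have "poly ?r b = 0" using Ma by (simp add: poly_pcompose is_minpoly_def algebra_simps)
  moreover have "poly Mb b = 0" using Mb by (simp add: is_minpoly_def)
  ultimately have bF: "b \<in> ?F"
    using nz(2) order_le_1_rsquarefree[OF Mb(2)]
    by (intro unique_common_root_in_subfield[OF F, of Mb b ?r])
  have "t \<in> ?F" using t KF by blast
  then have "(a + t * b) - t * b \<in> ?F" by (intro subfieldD(7)[OF F g] subfieldD(4)[OF F _ bF])
  then have "a \<in> ?F" by simp
  then show ?thesis using that t bF by blast
qed

text \<open>A primitive element of \<open>K(a, b)\<close> is separable as soon as \<open>K(a, b) = K(a\<^sup>p, b\<^sup>p)\<close>.\<close>

lemma primitive_element_separable:
  assumes b: "b \<in> sep_closure K"
    and a: "\<And>G. subfield_of G \<Longrightarrow> K \<subseteq> G \<Longrightarrow> a ^ CHAR('k) \<in> G \<Longrightarrow> b \<in> G \<Longrightarrow> a \<in> G"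
  shows "\<exists>c\<in>sep_closure K. a \<in> adj K c \<and> b \<in> adj K c \<and>
    (\<forall>L. subfield_of L \<longrightarrow> K \<subseteq> L \<longrightarrow> a \<in> L \<longrightarrow> b \<in> L \<longrightarrow> c \<in> L)"
proof -
  obtain t where t: "t \<in> K" "b \<in> adj K (a + t * b)" "a \<in> adj K (a + t * b)"
    using primitive_element[OF b] .
  let ?c = "a + t * b" and ?G = "adj K ((a + t * b) ^ CHAR('k))"
  have G: "subfield_of ?G" "K \<subseteq> ?G" using adj_field adj_base[OF K] by auto
  have ap: "a ^ CHAR('k) \<in> ?G" and bp: "b ^ CHAR('k) \<in> ?G" using frob_adj t(2,3) by blast+
  have bG: "b \<in> ?G" by (rule adj_subset_field[OF G bp separable_in_adj_frob[OF b]])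
  have aG: "a \<in> ?G" by (rule a[OF G ap bG])
  have tG: "t \<in> ?G" using t(1) G(2) by blast
  have "?c \<in> ?G" by (rule subfieldD(3)[OF G(1) aG subfieldD(4)[OF G(1) tG bG]])
  then have "?c \<in> sep_closure K" by (rule adj_frob_imp_separable)
  moreover have "?c \<in> L" if L: "subfield_of L" "K \<subseteq> L" "a \<in> L" "b \<in> L" for L
  proof -
    have "t \<in> L" using t(1) L(2) by blast
    then show ?thesis by (intro subfieldD(3,4)[OF L(1)] L(3,4))
  qed
  ultimately show ?thesis using t(2,3) by blast
qed

lemma primitive_element_finite:
  assumes "finite Z" "Z \<subseteq> sep_closure K"
  obtains c where "c \<in> sep_closure K" "Z \<subseteq> adj K c"
    "\<And>L. subfield_of L \<Longrightarrow> K \<subseteq> L \<Longrightarrow> Z \<subseteq> L \<Longrightarrow> c \<in> L"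
proof -
  have "\<exists>c\<in>sep_closure K. Z \<subseteq> adj K c \<and> (\<forall>L. subfield_of L \<longrightarrow> K \<subseteq> L \<longrightarrow> Z \<subseteq> L \<longrightarrow> c \<in> L)"
    using assms
  proof (induction Z)
    case empty
    have "0 \<in> sep_closure K" using base_subset_sep_closure subfieldD(1)[OF K] by blast
    then show ?case using subfieldD(1) by blast
  next
    case (insert z Z)
    then obtain c where c: "c \<in> sep_closure K" "Z \<subseteq> adj K c"
      "\<And>L. subfield_of L \<Longrightarrow> K \<subseteq> L \<Longrightarrow> Z \<subseteq> L \<Longrightarrow> c \<in> L" by auto
    have "z \<in> G" if "subfield_of G" "K \<subseteq> G" "z ^ CHAR('k) \<in> G" for G
      using adj_subset_field[OF that] separable_in_adj_frob[of z] insert.prems by auto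
    then obtain d where d: "d \<in> sep_closure K" "z \<in> adj K d" "c \<in> adj K d"
      "\<And>L. subfield_of L \<Longrightarrow> K \<subseteq> L \<Longrightarrow> z \<in> L \<Longrightarrow> c \<in> L \<Longrightarrow> d \<in> L"
      using primitive_element_separable[OF c(1), of z] by blast
    have "Z \<subseteq> adj K d" using c(2) adj_least[OF adj_field adj_base[OF K] d(3)] by blast
    moreover have "d \<in> L" if "subfield_of L" "K \<subseteq> L" "insert z Z \<subseteq> L" for L
      using d(4)[OF that(1,2)] c(3)[OF that(1,2)] that(3) by blast
    ultimately show ?case using d(1,2) by blast
  qed
  then show ?thesis using that by blast
qed

text \<open>Artin's argument.  If all conjugates of the separable element \<open>x\<close> lie in \<open>L = K(x)\<close>, an
  element \<open>poly r x\<close> of \<open>L\<close> with \<open>degree r\<close> less than the number of conjugates is fixed by all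
  embeddings only if \<open>r\<close> is constant.  So the conjugates of any \<open>w \<in> L\<close> are the roots of a squarefree
  polynomial over \<open>K\<close>.\<close>

lemma normal_simple_extension:
  assumes x: "is_minpoly K x M" "rsquarefree M" and norm: "\<And>y. poly M y = 0 \<Longrightarrow> y \<in> adj K x"
    and w: "w \<in> adj K x"
  shows "\<exists>C\<in>polys_over K. rsquarefree C \<and> poly C w = 0 \<and> (\<forall>u. poly C u = 0 \<longrightarrow> u \<in> adj K x)"
proof -
  let ?L = "adj K x"
  define \<Theta> where "\<Theta> = {y. poly M y = 0}"
  have M: "M \<in> polys_over K" "M \<noteq> 0" "poly M x = 0" using x by (auto simp: is_minpoly_def)
  have L: "subfield_of ?L" "K \<subseteq> ?L" using adj_field adj_base[OF K] by auto
  have fin: "finite \<Theta>" unfolding \<Theta>_def using M(2) by (rule poly_roots_finite)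
  have "\<exists>s. khom K ?L s \<and> (\<forall>p\<in>polys_over K. s (poly p x) = poly p y)" if "y \<in> \<Theta>" for y
    using khom_adj[OF K x(1), of y] that by (simp add: \<Theta>_def)
  then obtain s where s: "\<And>y. y \<in> \<Theta> \<Longrightarrow> khom K ?L (s y)"
    "\<And>y p. y \<in> \<Theta> \<Longrightarrow> p \<in> polys_over K \<Longrightarrow> s y (poly p x) = poly p y" by metis
  note hom = khom_simps[OF K L s(1)] khom_poly_base[OF K L s(1)]
  have sL: "s y z \<in> ?L" if y: "y \<in> \<Theta>" and z: "z \<in> ?L" for y z
  proof -
    obtain p where p: "p \<in> polys_over K" "z = poly p x" using z by (auto simp: adj_def)
    have "y \<in> ?L" using norm y by (simp add: \<Theta>_def)
    then show ?thesis
      using p s(2)[OF y p(1)] poly_in_subfield[OF L(1), of p y] polys_over_mono[OF L(2)] by auto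
  qed
  have s\<Theta>: "s y z \<in> \<Theta>" if "y \<in> \<Theta>" "z \<in> \<Theta>" for y z
    using hom(11)[OF that(1) M(1), of z] that norm hom(2)[OF that(1)] by (auto simp: \<Theta>_def)
  define W where "W = (\<lambda>y. s y w) ` \<Theta>"
  have W: "finite W" "W \<subseteq> ?L" unfolding W_def using fin sL w by auto
  have sW: "s y ` W = W" if y: "y \<in> \<Theta>" for y
  proof (rule card_subset_eq[OF W(1)])
    obtain p where p: "p \<in> polys_over K" "w = poly p x" using w by (auto simp: adj_def)
    show "s y ` W \<subseteq> W"
    proof
      fix v assume "v \<in> s y ` W"
      then obtain z where z: "z \<in> \<Theta>" "v = s y (s z w)" by (auto simp: W_def)
      have "v = s y (poly p z)" using z p s(2) by simp
      also have "\<dots> = poly p (s y z)" using hom(11)[OF y p(1)] z norm by (simp add: \<Theta>_def)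
      also have "\<dots> = s (s y z) w" using s(2)[OF s\<Theta>[OF y z(1)] p(1)] p(2) by simp
      finally show "v \<in> W" using s\<Theta>[OF y z(1)] by (auto simp: W_def)
    qed
    show "card (s y ` W) = card W"
      using khom_inj[OF K L s(1)[OF y]] W(2) by (intro card_image inj_onI) blast
  qed
  have fixed: "c \<in> K" if c: "c \<in> ?L" "\<And>y. y \<in> \<Theta> \<Longrightarrow> s y c = c" for c
  proof -
    obtain p where p: "p \<in> polys_over K" "c = poly p x" using c by (auto simp: adj_def)
    obtain a r where ar: "a \<in> polys_over K" "r \<in> polys_over K" "p = a * M + r"
      "r = 0 \<or> degree r < degree M" using polys_over_div[OF K M(1,2) p(1)] .
    have cr: "c = poly r x" using p ar M by simp
    have "r = [:c:]"
    proof (rule ccontr)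
      assume "r \<noteq> [:c:]"
      have "\<Theta> \<subseteq> {y. poly (r - [:c:]) y = 0}"
        using s(2)[OF _ ar(2)] c(2) cr by auto
      then have "card \<Theta> \<le> card {y. poly (r - [:c:]) y = 0}"
        using \<open>r \<noteq> [:c:]\<close> by (intro card_mono poly_roots_finite) auto
      also have "\<dots> \<le> degree (r - [:c:])" using \<open>r \<noteq> [:c:]\<close> by (intro card_poly_roots_bound) auto
      also have "\<dots> < degree M"
        using ar(4) is_minpoly_degree_pos[OF x(1)] by (auto intro!: degree_diff_less)
      finally show False using rsquarefree_card_roots[OF x(2)] by (simp add: \<Theta>_def)
    qed
    then show ?thesis using polys_over_coeff[OF ar(2), of 0] by simp
  qed
  define C where "C = (\<Prod>u\<in>W. [:- u, 1:])"
  have CL: "C \<in> polys_over ?L"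
    unfolding C_def using W(2)
    by (auto intro!: polys_over_prod[OF L(1)] polys_over_closed(3,10)[OF L(1)] subfieldD(2,5)[OF L(1)])
  have "map_poly (s y) C = C" if y: "y \<in> \<Theta>" for y
  proof -
    have "inj_on (s y) W" using khom_inj[OF K L s(1)[OF y]] W(2) by (intro inj_onI) blast
    then have "C = (\<Prod>u\<in>W. [:- s y u, 1:])"
      unfolding C_def using prod.reindex[of "s y" W "\<lambda>u. [:- u, 1:]"] sW[OF y] by simp
    also have "\<dots> = map_poly (s y) C"
      unfolding C_def using W(2) by (subst khom_map_poly_prod_linear[OF K L s(1)[OF y]]) auto
    finally show ?thesis by simp
  qed
  then have "s y (coeff C i) = coeff C i" if "y \<in> \<Theta>" for y i
    using that coeff_map_poly[of "s y" C i] hom(2)[OF that] by simp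
  then have CK: "C \<in> polys_over K"
    unfolding polys_over_def using fixed[OF polys_over_coeff[OF CL]] by simp
  have roots: "poly C u = 0 \<longleftrightarrow> u \<in> W" for u
    unfolding C_def using W(1) by (auto simp: poly_prod)
  have "x \<in> \<Theta>" using M by (simp add: \<Theta>_def)
  moreover have "s x w = w" using s(2)[OF \<open>x \<in> \<Theta>\<close>] w by (auto simp: adj_def)
  ultimately have "w \<in> W" unfolding W_def by force
  then show ?thesis
    using CK rsquarefree_prod_linear[OF W(1)] roots W(2) unfolding C_def by blast
qed

lemma adj_subset_sep_closure_normal:
  assumes x: "is_minpoly K x M" "rsquarefree M" and norm: "\<And>y. poly M y = 0 \<Longrightarrow> y \<in> adj K x"
  shows "adj K x \<subseteq> sep_closure K"
  using normal_simple_extension[OF assms] sep_closureI by blast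

text \<open>The normal closure of \<open>K(x)\<close> is generated by one separable element, all of whose conjugates it
  contains.\<close>

lemma adj_subset_sep_closure:
  assumes x: "x \<in> sep_closure K"
  shows "adj K x \<subseteq> sep_closure K"
proof -
  obtain M where M: "is_minpoly K x M" "rsquarefree M" using x by (auto simp: sep_closure_def)
  define Z where "Z = {y. poly M y = 0}"
  have "finite Z" unfolding Z_def using M(2) by (intro poly_roots_finite) (simp add: rsquarefree_def)
  moreover have "Z \<subseteq> sep_closure K"
    using is_minpoly_conjugate[OF K M(1)] M(2) by (auto simp: Z_def sep_closure_def)
  ultimately obtain c where c: "c \<in> sep_closure K" "Z \<subseteq> adj K c"
    "\<And>L. subfield_of L \<Longrightarrow> K \<subseteq> L \<Longrightarrow> Z \<subseteq> L \<Longrightarrow> c \<in> L" by (rule primitive_element_finite) blast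
  obtain N where N: "is_minpoly K c N" "rsquarefree N" using c(1) by (auto simp: sep_closure_def)
  let ?L = "adj K c"
  have L: "subfield_of ?L" "K \<subseteq> ?L" using adj_field adj_base[OF K] by auto
  have "y \<in> ?L" if y: "poly N y = 0" for y
  proof -
    obtain s where s: "khom K ?L s" "\<And>p. p \<in> polys_over K \<Longrightarrow> s (poly p c) = poly p y"
      using khom_adj[OF K N(1) y] by blast
    note hom = khom_simps[OF K L s(1)]
    define E where "E = {z \<in> ?L. s z \<in> ?L}"
    have "subfield_of E"
      unfolding subfield_of_def E_def
      by (auto simp: hom(2,3) hom(4-6,9) intro: subfieldD(1-6)[OF L(1)])
    moreover have "K \<subseteq> E" using L(2) by (auto simp: E_def hom)
    moreover have "Z \<subseteq> E"
    proof
      fix z assume z: "z \<in> Z"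
      have "poly M (s z) = s (poly M z)"
        using khom_poly_base[OF K L s(1)] M(1) z c(2) by (auto simp: is_minpoly_def)
      then have "s z \<in> Z" using z hom(2) by (simp add: Z_def)
      then show "z \<in> E" using z c(2) by (auto simp: E_def)
    qed
    ultimately have "c \<in> E" by (rule c(3))
    moreover have "s c = y" using s(2)[of "[:0,1:]"] polys_over_closed(3,10)[OF K] subfieldD(1,2)[OF K] by simp
    ultimately show ?thesis by (simp add: E_def)
  qed
  then have "?L \<subseteq> sep_closure K" by (rule adj_subset_sep_closure_normal[OF N])
  moreover have "x \<in> ?L" using c(2) M(1) by (auto simp: Z_def is_minpoly_def)
  ultimately show ?thesis using adj_least[OF L] by blast
qed

lemma sep_closure_subfield: "subfield_of (sep_closure K)"
  unfolding subfield_of_def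
proof (intro conjI ballI)
  show "0 \<in> sep_closure K" "1 \<in> sep_closure K"
    using base_subset_sep_closure subfieldD(1,2)[OF K] by auto
  fix u assume u: "u \<in> sep_closure K"
  show "- u \<in> sep_closure K" "inverse u \<in> sep_closure K"
    using adj_subset_sep_closure[OF u] subfieldD(5,6)[OF adj_field adj_gen[OF K]] by auto
  fix v assume v: "v \<in> sep_closure K"
  obtain c where c: "c \<in> sep_closure K" "{u, v} \<subseteq> adj K c"
    by (rule primitive_element_finite[of "{u, v}"]) (use u v in auto)
  then show "u + v \<in> sep_closure K" "u * v \<in> sep_closure K"
    using adj_subset_sep_closure[OF c(1)] subfieldD(3,4)[OF adj_field] by auto
qed

text \<open>The coefficients of the minimal polynomial of \<open>z\<close> lie in \<open>K(b)\<close> for some separable \<open>b\<close>, so \<open>z\<close> is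
  separable over \<open>K(b)\<close>.  Then \<open>K(b, z) = K(b\<^sup>p, z\<^sup>p)\<close>, and a primitive element of this field is separable.\<close>

lemma sep_closure_sep_closure: "sep_closure (sep_closure K) \<subseteq> sep_closure K"
proof
  fix z assume "z \<in> sep_closure (sep_closure K)"
  then obtain p where p: "is_minpoly (sep_closure K) z p" "rsquarefree p"
    by (auto simp: sep_closure_def)
  have "finite (set (coeffs p))" "set (coeffs p) \<subseteq> sep_closure K"
    using p(1) subfieldD(2)[OF sep_closure_subfield]
    by (auto simp: is_minpoly_def polys_over_def coeffs_def)
  then obtain b where b: "b \<in> sep_closure K" "set (coeffs p) \<subseteq> adj K b"
    by (rule primitive_element_finite)
  interpret F: sep_base "adj K b" by (rule extension[OF adj_field adj_base[OF K]])
  have "p \<in> polys_over (adj K b)"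
    unfolding polys_over_def
  proof (intro CollectI allI)
    fix i
    show "coeff p i \<in> adj K b"
    proof (cases "p \<noteq> 0 \<and> i \<le> degree p")
      case True
      then show ?thesis using coeff_in_coeffs b(2) by blast
    next
      case False
      then have "coeff p i = 0" by (auto intro: coeff_eq_0)
      then show ?thesis using subfieldD(1)[OF adj_field] by simp
    qed
  qed
  then have "z \<in> sep_closure (adj K b)" using p by (intro F.sep_closureI) (auto simp: is_minpoly_def)
  then have z: "z \<in> adj (adj K b) (z ^ CHAR('k))" by (rule F.separable_in_adj_frob)
  have "z \<in> G" if G: "subfield_of G" "K \<subseteq> G" "z ^ CHAR('k) \<in> G" "b \<in> G" for G
    using F.adj_subset_field[OF G(1) adj_least[OF G(1,2,4)] G(3) z] .
  then obtain c where "c \<in> sep_closure K" "z \<in> adj K c"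
    using primitive_element_separable[OF b(1), of z] by blast
  then show "z \<in> sep_closure K" using adj_subset_sep_closure by blast
qed

text \<open>The powers of \<open>x\<close> below the degree of its minimal polynomial span \<open>K(x)\<close>.\<close>

lemma adj_finite_extension: "finite_extension K (adj K x)"
proof -
  obtain M where M: "is_minpoly K x M" using minpoly_ex .
  then have M0: "M \<in> polys_over K" "M \<noteq> 0" "poly M x = 0" by (auto simp: is_minpoly_def)
  define B where "B = (\<lambda>i. x ^ i) ` {..<degree M}"
  have "\<exists>c. (\<forall>b\<in>B. c b \<in> K) \<and> z = (\<Sum>b\<in>B. c b * b)" if "z \<in> adj K x" for z
  proof -
    obtain p where p: "p \<in> polys_over K" "z = poly p x" using \<open>z \<in> adj K x\<close> by (auto simp: adj_def)
    obtain a r where ar: "a \<in> polys_over K" "r \<in> polys_over K" "p = a * M + r"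
      "r = 0 \<or> degree r < degree M" using polys_over_div[OF K M0(1,2) p(1)] .
    have "z = poly r x" using p ar M0 by simp
    also have "\<dots> = (\<Sum>i\<le>degree r. coeff r i * x ^ i)" by (rule poly_altdef)
    also have "\<dots> = (\<Sum>i<degree M. coeff r i * x ^ i)"
      using ar(4) is_minpoly_degree_pos[OF M]
      by (intro sum.mono_neutral_left) (auto simp: coeff_eq_0)
    also have "\<dots> = (\<Sum>b\<in>B. \<Sum>i\<in>{i\<in>{..<degree M}. x ^ i = b}. coeff r i * x ^ i)"
      unfolding B_def by (rule sum.image_gen) simp
    also have "\<dots> = (\<Sum>b\<in>B. (\<Sum>i\<in>{i\<in>{..<degree M}. x ^ i = b}. coeff r i) * b)"
      by (auto simp: sum_distrib_right intro!: sum.cong)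
    finally show ?thesis
      using polys_over_coeff[OF ar(2)]
      by (intro exI[of _ "\<lambda>b. \<Sum>i\<in>{i\<in>{..<degree M}. x ^ i = b}. coeff r i"])
         (auto intro!: subfield_sum[OF K])
  qed
  moreover have "B \<subseteq> adj K x" unfolding B_def using adj_gen[OF K] by (auto intro: subfieldD(9)[OF adj_field])
  moreover have "finite B" by (simp add: B_def)
  ultimately show ?thesis unfolding finite_extension_def using adj_field adj_base[OF K] by blast
qed

lemma adj_finite_galois:
  assumes x: "is_minpoly K x M" "rsquarefree M" and norm: "\<And>y. poly M y = 0 \<Longrightarrow> y \<in> adj K x"
  shows "finite_galois K (adj K x)"
  unfolding finite_galois_def
proof (intro conjI ballI allI impI)
  show "finite_extension K (adj K x)" by (rule adj_finite_extension)
  show "adj K x \<subseteq> sep_closure K" by (rule adj_subset_sep_closure_normal[OF assms])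
  fix w p y assume w: "w \<in> adj K x" "is_minpoly K w p" "poly p y = 0"
  obtain C where C: "C \<in> polys_over K" "rsquarefree C" "poly C w = 0"
    "\<And>u. poly C u = 0 \<Longrightarrow> u \<in> adj K x"
    using normal_simple_extension[OF x norm w(1)] by blast
  obtain a where "C = a * p" using is_minpoly_dvd[OF K w(2) C(1,3)] by metis
  then show "y \<in> adj K x" using C(4) w(3) by simp
qed

end

section \<open>Groups of exponent two and polyquadratic extensions\<close>

text \<open>A homomorphism \<open>(\<int>/2)\<^sup>m \<rightarrow> G\<close> that is injective with \<open>m\<close> maximal is surjective, since an
  element \<open>g\<close> outside the image extends it to \<open>(\<int>/2)\<^sup>m\<^sup>+\<^sup>1\<close>.\<close>

lemma exponent_two_group_iso:
  fixes G (structure)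
  assumes G: "group G" and fin: "finite (carrier G)"
    and sq: "\<And>x. x \<in> carrier G \<Longrightarrow> x \<otimes> x = \<one>"
  shows "\<exists>m::nat. G \<cong> product_group {..<m} (\<lambda>_. integer_mod_group 2)"
proof -
  interpret group G by (rule G)
  define P where "P = (\<lambda>m::nat. product_group {..<m} (\<lambda>_. integer_mod_group 2))"
  have Pg: "group (P m)" for m unfolding P_def by (rule product_group) simp
  have Pc: "carrier (P m) = (\<Pi>\<^sub>E i\<in>{..<m}. {0..<2})" for m
    by (simp add: P_def carrier_integer_mod_group)
  have Pm: "f \<otimes>\<^bsub>P m\<^esub> f' = (\<lambda>i\<in>{..<m}. (f i + f' i) mod 2)" for m f f'
    by (simp add: P_def)
  have inv_self: "inv x = x" if "x \<in> carrier G" for x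
    using inv_equality[OF sq[OF that] that that] .
  have comm: "x \<otimes> y = y \<otimes> x" if "x \<in> carrier G" "y \<in> carrier G" for x y
    using inv_mult_group[OF that] inv_self that by simp
  define good where "good = (\<lambda>m. \<exists>h. h \<in> hom (P m) G \<and> inj_on h (carrier (P m)))"
  have "good 0"
    unfolding good_def
    by (intro exI[of _ "\<lambda>_. \<one>"]) (auto simp: hom_def Pc inj_on_def)
  moreover have "m \<le> card (carrier G)" if "good m" for m
  proof -
    obtain h where h: "h \<in> hom (P m) G" "inj_on h (carrier (P m))" using \<open>good m\<close> by (auto simp: good_def)
    have "card (carrier (P m)) \<le> card (carrier G)"
      using h fin by (intro card_inj_on_le) (auto simp: hom_def)
    moreover have "card (carrier (P m)) = 2 ^ m" by (simp add: Pc card_PiE)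
    moreover have "m < 2 ^ m" by (rule less_exp)
    ultimately show ?thesis by linarith
  qed
  ultimately obtain m where m: "good m" "\<And>n. good n \<Longrightarrow> n \<le> m"
    using Nat.ex_has_greatest_nat[of good 0 "card (carrier G)"] by blast
  then obtain h where h: "h \<in> hom (P m) G" "inj_on h (carrier (P m))" by (auto simp: good_def)
  have hc: "h f \<in> carrier G" if "f \<in> carrier (P m)" for f using h that by (auto simp: hom_def)
  have hm: "h (f \<otimes>\<^bsub>P m\<^esub> f') = h f \<otimes> h f'" if "f \<in> carrier (P m)" "f' \<in> carrier (P m)" for f f'
    using h that by (auto simp: hom_def)
  have "h ` carrier (P m) = carrier G"
  proof (rule ccontr)
    assume "h ` carrier (P m) \<noteq> carrier G"
    then obtain g where g: "g \<in> carrier G" "g \<notin> h ` carrier (P m)" using hc by blast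
    define e where "e = (\<lambda>k::int. if k = 0 then \<one> else g)"
    define h' where "h' = (\<lambda>f. h (restrict f {..<m}) \<otimes> e (f m))"
    have ec: "e k \<in> carrier G" for k using g by (simp add: e_def)
    have em: "e ((k + l) mod 2) = e k \<otimes> e l" if "k \<in> {0..<2}" "l \<in> {0..<2}" for k l
    proof -
      have "k = 0 \<or> k = 1" "l = 0 \<or> l = 1" using that by auto
      then show ?thesis using g sq by (auto simp: e_def)
    qed
    have rc: "restrict f {..<m} \<in> carrier (P m)" and fm: "f m \<in> {0..<2}"
      if "f \<in> carrier (P (Suc m))" for f
      using that by (auto simp: Pc PiE_iff)
    have hom: "h' (f \<otimes>\<^bsub>P (Suc m)\<^esub> f') = h' f \<otimes> h' f'"
      if f: "f \<in> carrier (P (Suc m))" "f' \<in> carrier (P (Suc m))" for f f'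
    proof -
      have "restrict (f \<otimes>\<^bsub>P (Suc m)\<^esub> f') {..<m} = restrict f {..<m} \<otimes>\<^bsub>P m\<^esub> restrict f' {..<m}"
        by (auto simp: Pm restrict_def)
      then have "h' (f \<otimes>\<^bsub>P (Suc m)\<^esub> f')
        = (h (restrict f {..<m}) \<otimes> h (restrict f' {..<m})) \<otimes> (e (f m) \<otimes> e (f' m))"
        unfolding h'_def using em[OF fm fm, OF f] hm[OF rc rc, OF f] by (simp add: Pm)
      also have "\<dots> = h' f \<otimes> h' f'"
        unfolding h'_def using hc[OF rc[OF f(1)]] hc[OF rc[OF f(2)]] ec comm
        by (metis m_assoc m_closed)
      finally show ?thesis .
    qed
    have cl: "h' f \<in> carrier G" if "f \<in> carrier (P (Suc m))" for f
      unfolding h'_def using hc[OF rc[OF that]] ec by simp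
    have hom': "h' \<in> hom (P (Suc m)) G" using hom cl by (auto simp: hom_def)
    have inj: "inj_on h' (carrier (P (Suc m)))"
    proof (rule inj_onI)
      fix f f' assume f: "f \<in> carrier (P (Suc m))" "f' \<in> carrier (P (Suc m))" and eq: "h' f = h' f'"
      let ?r = "restrict f {..<m}" and ?r' = "restrict f' {..<m}"
      have "f m = f' m"
      proof (rule ccontr)
        assume ne: "f m \<noteq> f' m"
        have "f m = 0 \<or> f m = 1" "f' m = 0 \<or> f' m = 1" using fm f by force+
        then have "e (f m) \<otimes> e (f' m) = g" using ne g by (auto simp: e_def)
        moreover have "h ?r \<otimes> h ?r' = e (f m) \<otimes> e (f' m)"
        proof -
          have a: "h ?r \<in> carrier G" "h ?r' \<in> carrier G" "e (f m) \<in> carrier G" "e (f' m) \<in> carrier G"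
            using hc rc f ec by auto
          have "h ?r' \<otimes> (h ?r \<otimes> e (f m)) \<otimes> e (f m) = h ?r' \<otimes> (h ?r' \<otimes> e (f' m)) \<otimes> e (f m)"
            using eq by (simp add: h'_def)
          moreover have "h ?r' \<otimes> (h ?r \<otimes> e (f m)) \<otimes> e (f m) = h ?r \<otimes> h ?r'"
            using a sq comm by (metis m_assoc m_closed r_one)
          moreover have "h ?r' \<otimes> (h ?r' \<otimes> e (f' m)) \<otimes> e (f m) = e (f m) \<otimes> e (f' m)"
            using a sq comm by (metis m_assoc m_closed l_one)
          ultimately show ?thesis by simp
        qed
        ultimately have "g = h (?r \<otimes>\<^bsub>P m\<^esub> ?r')" using hm[OF rc rc, OF f] by simp
        moreover have "?r \<otimes>\<^bsub>P m\<^esub> ?r' \<in> carrier (P m)"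
          using rc f by (intro monoid.m_closed group.is_monoid Pg)
        ultimately show False using g by blast
      qed
      moreover from this have "h ?r = h ?r'"
        using eq hc rc f ec by (simp add: h'_def)
      then have "?r = ?r'" using h(2) rc f by (auto dest: inj_onD)
      ultimately show "f = f'"
        using f by (intro ext) (metis Pc PiE_arb lessThan_iff less_Suc_eq restrict_apply')
    qed
    have "good (Suc m)" unfolding good_def using hom' inj by blast
    then show False using m(2) by fastforce
  qed
  then have "h \<in> iso (P m) G" using h by (auto simp: iso_def bij_betw_def)
  then have "P m \<cong> G" by (auto simp: is_iso_def)
  then have "G \<cong> P m" using Pg group.iso_sym by blast
  then show ?thesis unfolding P_def by blast
qed

context sep_base
begin

lemma gal_groupD:
  assumes "s \<in> carrier (gal_group L K)"
  shows "s \<in> Bij L" "khom K L s" "\<And>z. z \<in> L \<Longrightarrow> s z \<in> L"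
  using assms by (auto simp: gal_group_def khom_def dest: Bij_imp_funcset)

lemma polyquadratic_adjI:
  assumes x: "is_minpoly K x M" "rsquarefree M" and norm: "\<And>y. poly M y = 0 \<Longrightarrow> y \<in> adj K x"
    and invol: "\<And>s. s \<in> carrier (gal_group (adj K x) K) \<Longrightarrow> s (s x) = x"
  shows "polyquadratic K (adj K x)"
proof -
  let ?L = "adj K x" and ?G = "gal_group (adj K x) K"
  have L: "subfield_of ?L" "K \<subseteq> ?L" "x \<in> ?L" using adj_field adj_base[OF K] adj_gen[OF K] by auto
  have M: "M \<in> polys_over K" "M \<noteq> 0" "poly M x = 0" using x by (auto simp: is_minpoly_def)
  note G = gal_groupD[of _ ?L]
  have mult: "s \<otimes>\<^bsub>?G\<^esub> t = compose ?L s t" if "s \<in> carrier ?G" "t \<in> carrier ?G" for s t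
    using G(1)[OF that(1)] G(1)[OF that(2)] by (simp add: gal_group_def BijGroup_def)
  have one: "\<one>\<^bsub>?G\<^esub> = (\<lambda>z\<in>?L. z)" by (simp add: gal_group_def BijGroup_def)
  have eval: "s (poly p x) = poly p (s x)" if "s \<in> carrier ?G" "p \<in> polys_over K" for s p
    using khom_poly_base[OF K L(1,2) G(2)[OF that(1)] that(2) L(3)] .
  have sq: "s \<otimes>\<^bsub>?G\<^esub> s = \<one>\<^bsub>?G\<^esub>" if s: "s \<in> carrier ?G" for s
    unfolding mult[OF s s] one
  proof (rule extensionalityI[of _ ?L])
    fix z assume z: "z \<in> ?L"
    then obtain p where p: "p \<in> polys_over K" "z = poly p x" by (auto simp: adj_def)
    have "s (s z) = poly p (s (s x))"
      using p eval[OF s p(1)] khom_poly_base[OF K L(1,2) G(2)[OF s] p(1) G(3)[OF s L(3)]] by simp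
    then show "compose ?L s s z = (\<lambda>z\<in>?L. z) z"
      using z p(2) invol[OF s] by (simp add: compose_def)
  qed auto
  have closed: "compose ?L s t \<in> carrier ?G" if "s \<in> carrier ?G" "t \<in> carrier ?G" for s t
    using compose_Bij[OF G(1)[OF that(1)] G(1)[OF that(2)]] G(2,3)[OF that(1)] G(2,3)[OF that(2)]
      subfieldD(3,4)[OF L(1)] L(2)
    by (auto simp: gal_group_def khom_def compose_def subset_iff)
  have "group ?G"
  proof (rule groupI)
    show "s \<otimes>\<^bsub>?G\<^esub> t \<in> carrier ?G" if "s \<in> carrier ?G" "t \<in> carrier ?G" for s t
      using closed mult that by simp
    show one_in: "\<one>\<^bsub>?G\<^esub> \<in> carrier ?G"
      using id_Bij[of ?L] subfieldD(3,4)[OF L(1)] L(2) by (auto simp: gal_group_def BijGroup_def)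
    show "s \<otimes>\<^bsub>?G\<^esub> t \<otimes>\<^bsub>?G\<^esub> u = s \<otimes>\<^bsub>?G\<^esub> (t \<otimes>\<^bsub>?G\<^esub> u)"
      if "s \<in> carrier ?G" "t \<in> carrier ?G" "u \<in> carrier ?G" for s t u
      using that closed by (simp add: mult compose_assoc[OF Bij_imp_funcset[OF G(1)[OF that(3)]]])
    show "\<one>\<^bsub>?G\<^esub> \<otimes>\<^bsub>?G\<^esub> s = s" if "s \<in> carrier ?G" for s
      using that one_in Bij_imp_extensional[OF G(1)[OF that]] Bij_imp_funcset[OF G(1)[OF that]]
      by (simp add: mult) (simp add: one)
    show "\<exists>t\<in>carrier ?G. t \<otimes>\<^bsub>?G\<^esub> s = \<one>\<^bsub>?G\<^esub>" if "s \<in> carrier ?G" for s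
      using that sq by blast
  qed
  moreover have "finite (carrier ?G)"
  proof (rule inj_on_finite)
    show "inj_on (\<lambda>s. s x) (carrier ?G)"
    proof (rule inj_onI)
      fix s t assume st: "s \<in> carrier ?G" "t \<in> carrier ?G" "s x = t x"
      show "s = t"
      proof (rule extensionalityI[of _ ?L])
        fix z assume "z \<in> ?L"
        then obtain p where "p \<in> polys_over K" "z = poly p x" by (auto simp: adj_def)
        then show "s z = t z" using eval[OF st(1)] eval[OF st(2)] st(3) by simp
      qed (use st G(1) Bij_imp_extensional in blast)+
    qed
    show "(\<lambda>s. s x) ` carrier ?G \<subseteq> {y. poly M y = 0}"
      using eval[OF _ M(1)] M(3) khom_simps(2)[OF K L(1,2) G(2)] by auto
    show "finite {y. poly M y = 0}" using M(2) by (rule poly_roots_finite)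
  qed
  ultimately show ?thesis
    unfolding polyquadratic_def
    using exponent_two_group_iso[of ?G] sq adj_finite_galois[OF x norm] by blast
qed

end

section \<open>Additive polynomials and the skew polynomial ring\<close>

lemma finite_field_fermat: "(x :: 'f::{finite,field}) ^ CARD('f) = x"
proof (cases "x = 0")
  case False
  have "bij_betw ((*) x) (UNIV - {0}) (UNIV - {0})"
    by (rule bij_betwI[of _ _ _ "(*) (inverse x)"]) (use False in auto)
  then have "(\<Prod>y\<in>UNIV - {0}. x * y) = (\<Prod>y\<in>UNIV - {0}. y)"
    by (rule prod.reindex_bij_betw)
  then have "x ^ card (UNIV - {0 :: 'f}) * (\<Prod>y\<in>UNIV - {0}. y) = (\<Prod>y\<in>UNIV - {0 :: 'f}. y)"
    by (simp add: prod.distrib)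
  then have "x ^ card (UNIV - {0 :: 'f}) = 1" by (simp add: prod_zero_iff)
  then have "x ^ (CARD('f) - 1) = 1" by (simp add: card_Diff_singleton)
  then have "x * x ^ (CARD('f) - 1) = x" by simp
  then show ?thesis by (simp flip: power_Suc add: Suc_diff_1)
qed (simp add: power_0_left)

lemma card_finite_field_gt_1: "1 < CARD('f::{finite,field})"
proof -
  have "card {0, 1 :: 'f} \<le> CARD('f)" by (rule card_mono) auto
  then show ?thesis by simp
qed

text \<open>The polynomial \<open>(X + 1)\<^sup>q - X\<^sup>q - 1\<close> has degree less than \<open>q\<close> and vanishes on the whole field.\<close>

lemma binomial_card_finite_field:
  assumes "0 < i" "i < CARD('f)"
  shows "of_nat (CARD('f) choose i) = (0 :: 'f::{finite,field})"
proof -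
  let ?q = "CARD('f)"
  define p :: "'f poly" where "p = [:1, 1:] ^ ?q - monom 1 ?q - 1"
  have "coeff ([:1, 1 :: 'f:] ^ ?q) j = of_nat (?q choose j)" for j
  proof (cases "j \<le> ?q")
    case False
    have "degree ([:1, 1 :: 'f:] ^ ?q) \<le> ?q" using degree_power_le[of "[:1, 1 :: 'f:]" ?q] by simp
    then show ?thesis using False by (simp add: coeff_eq_0 binomial_eq_0)
  qed (simp add: coeff_linear_poly_power)
  then have c: "coeff p j = of_nat (?q choose j) - (if j = ?q then 1 else 0) - (if j = 0 then 1 else 0)" for j
    by (simp add: p_def)
  have "p = 0"
  proof (rule ccontr)
    assume "p \<noteq> 0"
    have "coeff p j = 0" if "?q \<le> j" for j
      using that card_finite_field_gt_1[where 'f = 'f] by (cases "j = ?q") (auto simp: c binomial_eq_0)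
    then have "degree p < ?q" using \<open>p \<noteq> 0\<close> by (metis leading_coeff_neq_0 not_less)
    moreover have "poly p x = 0" for x
      using finite_field_fermat[of "x + 1"] finite_field_fermat[of x]
      by (simp add: p_def poly_monom add.commute)
    then have "{x. poly p x = 0} = UNIV" by auto
    ultimately show False using card_poly_roots_bound[OF \<open>p \<noteq> 0\<close>] by simp
  qed
  then show ?thesis using c[of i] assms by simp
qed

text \<open>The order \<open>q\<close> of the finite field is a parameter, so that it does not depend on the type variable
  \<open>'f\<close> in abbreviations for operations on \<open>'k\<close>.\<close>

locale A_base =
  fixes \<iota> :: "'f::{finite,field} poly \<Rightarrow> 'k::alg_closed_field" and q :: nat
  assumes emb: "A_embedding \<iota>" and q_card: "q = CARD('f)"
begin

abbreviation ev :: "'k poly \<Rightarrow> 'k \<Rightarrow> 'k" where "ev \<equiv> skew_eval q"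

abbreviation skew :: "'k poly \<Rightarrow> 'k poly \<Rightarrow> 'k poly"  (infixl "\<star>" 70) where
  "f \<star> g \<equiv> skew_mult q f g"

abbreviation \<kappa> :: "'f \<Rightarrow> 'k" where "\<kappa> c \<equiv> \<iota> [:c:]"

lemma emb_add: "\<iota> (a + b) = \<iota> a + \<iota> b" and emb_mult: "\<iota> (a * b) = \<iota> a * \<iota> b"
  and emb_1 [simp]: "\<iota> 1 = 1" and emb_inj: "\<iota> a = \<iota> b \<longleftrightarrow> a = b"
  using emb by (auto simp: A_embedding_def inj_def)

lemma emb_0 [simp]: "\<iota> 0 = 0"
  by (metis add.right_neutral add_left_cancel emb_add)

lemma emb_eq_0_iff [simp]: "\<iota> a = 0 \<longleftrightarrow> a = 0"
  using emb_inj[of a 0] by simp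

lemma emb_minus: "\<iota> (- a) = - \<iota> a"
  using emb_add[of a "- a"] by (simp add: eq_neg_iff_add_eq_0 add.commute)

lemma emb_of_nat: "\<iota> (of_nat n) = of_nat n"
  by (induction n) (simp_all add: emb_add)

lemma emb_power: "\<iota> (a ^ n) = \<iota> a ^ n"
  by (induction n) (simp_all add: emb_mult)

lemma q_gt_1: "1 < q" unfolding q_card by (rule card_finite_field_gt_1)

lemma binomial_q: "0 < i \<Longrightarrow> i < q \<Longrightarrow> of_nat (q choose i) = (0 :: 'k)"
  using emb_of_nat[of "q choose i"] binomial_card_finite_field[of i, where 'f = 'f]
  by (simp add: of_nat_poly q_card)

lemma of_nat_q: "of_nat q = (0 :: 'k)"
  using binomial_q[of 1] q_gt_1 by simp

lemma q_pow_pos: "0 < q ^ i" using q_gt_1 by simp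

lemma q_pow_inj: "q ^ i = q ^ j \<longleftrightarrow> i = j" using q_gt_1 by simp

lemma infinite_range_emb: "infinite (range \<iota>)"
proof -
  have "inj (\<lambda>n. \<iota> (monom 1 n))" by (intro injI) (simp add: emb_inj monom_eq_iff')
  then have "infinite (range (\<lambda>n. \<iota> (monom 1 n)))" by (rule range_inj_infinite)
  moreover have "range (\<lambda>n. \<iota> (monom 1 n)) \<subseteq> range \<iota>" by (rule image_subsetI) (rule rangeI)
  ultimately show ?thesis by (rule infinite_super[rotated])
qed

lemma infinite_UNIV_k: "infinite (UNIV :: 'k set)"
  using infinite_range_emb by (rule infinite_super[OF subset_UNIV])

lemma char_k_pos: "CHAR('k) > 0"
  unfolding CHAR_pos_iff using of_nat_q q_gt_1 by (intro exI[of _ q]) simp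

lemma frobenius_add: "(x + y :: 'k) ^ q = x ^ q + y ^ q"
proof -
  have "(x + y) ^ q = (\<Sum>i\<le>q. of_nat (q choose i) * x ^ i * y ^ (q - i))" by (rule binomial_ring)
  also have "\<dots> = (\<Sum>i\<in>{0, q}. of_nat (q choose i) * x ^ i * y ^ (q - i))"
    by (rule sum.mono_neutral_right) (auto simp: binomial_q)
  also have "\<dots> = x ^ q + y ^ q" using q_gt_1 by simp
  finally show ?thesis .
qed

lemma frob_pow_add: "(x + y :: 'k) ^ (q ^ i) = x ^ (q ^ i) + y ^ (q ^ i)"
  by (induction i) (simp_all add: power_Suc2 power_mult frobenius_add del: power_Suc)

lemma frob_pow_sum: "(\<Sum>j\<in>J. f j :: 'k) ^ (q ^ i) = (\<Sum>j\<in>J. f j ^ (q ^ i))"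
  using q_pow_pos[of i]
  by (induction J rule: infinite_finite_induct) (simp_all add: frob_pow_add power_0_left)

lemma const_frob: "\<kappa> c ^ q = \<kappa> c"
proof -
  have "[:c:] ^ n = [:c ^ n:]" for n by (induction n) (simp_all add: one_pCons)
  then show ?thesis by (simp flip: emb_power add: finite_field_fermat q_card)
qed

lemma const_frob_pow: "\<kappa> c ^ (q ^ i) = \<kappa> c"
  by (induction i) (simp_all add: power_mult const_frob)

lemma frob_fixed_imp_const:
  assumes "(z :: 'k) ^ q = z"
  obtains c where "z = \<kappa> c"
proof -
  let ?p = "monom 1 q - [:0, 1:] :: 'k poly"
  have "coeff ?p q = 1" using q_gt_1 by (simp add: coeff_pCons split: nat.splits)
  then have "?p \<noteq> 0" by (metis coeff_0 zero_neq_one)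
  have d: "degree ?p \<le> q" using q_gt_1 by (intro degree_diff_le) (simp_all add: degree_monom_le)
  have "range \<kappa> \<subseteq> {z. poly ?p z = 0}" using const_frob by (auto simp: poly_monom)
  moreover have "card (range \<kappa>) = q" unfolding q_card by (intro card_image) (simp add: inj_def emb_inj)
  moreover have "card {z. poly ?p z = 0} \<le> q"
    using card_poly_roots_bound[OF \<open>?p \<noteq> 0\<close>] d by linarith
  moreover have "finite {z. poly ?p z = 0}" using \<open>?p \<noteq> 0\<close> by (rule poly_roots_finite)
  ultimately have "range \<kappa> = {z. poly ?p z = 0}" by (metis card_seteq)
  moreover have "z \<in> {z. poly ?p z = 0}" using assms by (simp add: poly_monom)
  ultimately show ?thesis using that by blast
qed

subsection \<open>Evaluation\<close>

lemma ev_eq_sum: "degree f \<le> n \<Longrightarrow> ev f x = (\<Sum>i\<le>n. coeff f i * x ^ (q ^ i))"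
  unfolding skew_eval_def by (intro sum.mono_neutral_left) (auto simp: coeff_eq_0)

lemma ev_poly_add: "ev (f + g) x = ev f x + ev g x"
proof -
  have "degree (f + g) \<le> max (degree f) (degree g)" by (rule degree_add_le_max)
  then show ?thesis
    by (simp add: ev_eq_sum[of _ "max (degree f) (degree g)"] sum.distrib algebra_simps)
qed

lemma ev_0 [simp]: "ev 0 x = 0" and ev_1 [simp]: "ev 1 x = x" and ev_const [simp]: "ev [:c:] x = c * x"
  by (simp_all add: skew_eval_def)

lemma ev_monom: "ev (monom c i) x = c * x ^ (q ^ i)"
proof -
  have "ev (monom c i) x = (\<Sum>j\<le>i. if j = i then c * x ^ (q ^ i) else 0)"
    unfolding ev_eq_sum[OF degree_monom_le] by (intro sum.cong) auto
  then show ?thesis by simp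
qed

lemma ev_poly_sum: "ev (\<Sum>i\<in>I. f i) x = (\<Sum>i\<in>I. ev (f i) x)"
  by (induction I rule: infinite_finite_induct) (simp_all add: ev_poly_add)

lemma ev_poly_minus: "ev (- f) x = - ev f x"
  using ev_poly_add[of f "- f" x] by (simp add: eq_neg_iff_add_eq_0 add.commute)

lemma ev_poly_diff: "ev (f - g) x = ev f x - ev g x"
  using ev_poly_add[of f "- g" x] by (simp add: ev_poly_minus)

lemma ev_add: "ev f (x + y) = ev f x + ev f y"
  by (simp add: skew_eval_def frob_pow_add sum.distrib algebra_simps)

lemma ev_zero [simp]: "ev f 0 = 0"
  by (metis add.right_neutral add_left_cancel ev_add)

lemma ev_minus: "ev f (- x) = - ev f x"
  using ev_add[of f x "- x"] by (simp add: eq_neg_iff_add_eq_0 add.commute)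

lemma ev_diff: "ev f (x - y) = ev f x - ev f y"
  using ev_add[of f x "- y"] by (simp add: ev_minus)

lemma ev_linear: "ev f (\<kappa> c * x) = \<kappa> c * ev f x"
  by (simp add: skew_eval_def power_mult_distrib const_frob_pow sum_distrib_left algebra_simps)

lemma ev_mult: "ev (f \<star> g) x = ev f (ev g x)"
proof -
  have pw: "x ^ (q ^ (i + j)) = (x ^ (q ^ j)) ^ (q ^ i)" for i j
    unfolding power_add power_mult[symmetric] by (simp only: mult.commute)
  have "ev (f \<star> g) x
    = (\<Sum>i\<le>degree f. \<Sum>j\<le>degree g. coeff f i * coeff g j ^ (q ^ i) * x ^ (q ^ (i + j)))"
    by (simp add: skew_mult_def ev_poly_sum ev_monom)
  also have "\<dots> = (\<Sum>i\<le>degree f. coeff f i * (ev g x) ^ (q ^ i))"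
    by (simp add: skew_eval_def[of q g] frob_pow_sum sum_distrib_left power_mult_distrib pw mult.assoc)
  finally show ?thesis by (simp add: skew_eval_def[of q f])
qed

text \<open>The zeros of a skew polynomial are counted as roots of this ordinary polynomial.\<close>

definition lin :: "'k poly \<Rightarrow> 'k poly" where
  "lin f = (\<Sum>i\<le>degree f. monom (coeff f i) (q ^ i))"

lemma poly_lin: "poly (lin f) x = ev f x"
  by (simp add: lin_def poly_sum poly_monom skew_eval_def)

lemma coeff_lin: "coeff (lin f) (q ^ i) = coeff f i"
proof -
  have "coeff (lin f) (q ^ i) = (\<Sum>j\<le>degree f. if j = i then coeff f i else 0)"
    unfolding lin_def coeff_sum by (intro sum.cong) (auto simp: q_pow_inj)
  then show ?thesis by (auto simp: coeff_eq_0)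
qed

lemma coeff_lin_eq_0: "q ^ degree f < n \<Longrightarrow> coeff (lin f) n = 0"
proof -
  assume n: "q ^ degree f < n"
  have "coeff (monom (coeff f i) (q ^ i)) n = 0" if "i \<le> degree f" for i
  proof -
    have "q ^ i \<le> q ^ degree f" using that q_gt_1 by (intro power_increasing) auto
    then show ?thesis using n by simp
  qed
  then show ?thesis unfolding lin_def coeff_sum by (intro sum.neutral) simp
qed

lemma degree_lin:
  assumes "f \<noteq> 0"
  shows "degree (lin f) = q ^ degree f"
proof (rule antisym)
  show "degree (lin f) \<le> q ^ degree f" by (rule degree_le) (simp add: coeff_lin_eq_0)
  show "q ^ degree f \<le> degree (lin f)" using assms by (intro le_degree) (simp add: coeff_lin)
qed

lemma lin_eq_0_iff [simp]: "lin f = 0 \<longleftrightarrow> f = 0"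
  using coeff_lin[of f "degree f"] by (auto simp: lin_def)

lemma pderiv_sum: "pderiv (sum f I) = (\<Sum>i\<in>I. pderiv (f i))"
  by (induction I rule: infinite_finite_induct) (simp_all add: pderiv_add)

lemma pderiv_lin: "pderiv (lin f) = [:coeff f 0:]"
proof -
  have z: "of_nat (q ^ i) = (0 :: 'k)" if "i \<noteq> 0" for i
    using that by (simp add: of_nat_q power_0_left)
  have "pderiv (lin f) = (\<Sum>i\<le>degree f. pderiv (monom (coeff f i) (q ^ i)))"
    unfolding lin_def by (rule pderiv_sum)
  also have "\<dots> = (\<Sum>i\<in>{0}. pderiv (monom (coeff f i) (q ^ i)))"
  proof (rule sum.mono_neutral_right)
    show "\<forall>i\<in>{..degree f} - {0}. pderiv (monom (coeff f i) (q ^ i)) = 0"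
      by (simp add: pderiv_monom z del: of_nat_power)
  qed auto
  also have "\<dots> = [:coeff f 0:]" by (simp add: pderiv_monom monom_0)
  finally show ?thesis .
qed

abbreviation zeros :: "'k poly \<Rightarrow> 'k set" where "zeros f \<equiv> {z. ev f z = 0}"

lemma zeros_lin: "zeros f = {z. poly (lin f) z = 0}"
  by (simp add: poly_lin)

lemma finite_zeros: "f \<noteq> 0 \<Longrightarrow> finite (zeros f)"
  unfolding zeros_lin by (intro poly_roots_finite) simp

lemma card_zeros_le: "f \<noteq> 0 \<Longrightarrow> card (zeros f) \<le> q ^ degree f"
  unfolding zeros_lin using card_poly_roots_bound[of "lin f"] by (simp add: degree_lin)

lemma card_zeros:
  assumes "coeff f 0 \<noteq> 0"
  shows "card (zeros f) = q ^ degree f"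
proof -
  have f: "f \<noteq> 0" using assms by auto
  have "rsquarefree (lin f)"
  proof (rule ccontr)
    assume "\<not> rsquarefree (lin f)"
    then obtain a where "poly (pderiv (lin f)) a = 0"
      using f multiple_root[of "lin f" thesis] by simp
    then show False using assms by (simp add: pderiv_lin)
  qed
  then show ?thesis unfolding zeros_lin by (simp add: rsquarefree_card_roots degree_lin f)
qed

lemma ev_inject: "(\<And>x. ev f x = ev g x) \<Longrightarrow> f = g"
proof (rule ccontr)
  assume ev: "\<And>x. ev f x = ev g x" and "f \<noteq> g"
  then have "finite (zeros (f - g))" by (intro finite_zeros) simp
  moreover have "ev (f - g) x = 0" for x using ev[of x] by (simp only: ev_poly_diff diff_self)
  ultimately show False using infinite_UNIV_k by simp
qed

subsection \<open>Ring structure\<close>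

lemma skew_assoc: "(f \<star> g) \<star> h = f \<star> (g \<star> h)"
  by (rule ev_inject) (simp only: ev_mult)

lemma skew_add_left: "(f + g) \<star> h = f \<star> h + g \<star> h"
  by (rule ev_inject) (simp only: ev_mult ev_poly_add)

lemma skew_diff_left: "(f - g) \<star> h = f \<star> h - g \<star> h"
  by (rule ev_inject) (simp only: ev_mult ev_poly_diff)

lemma skew_add_right: "f \<star> (g + h) = f \<star> g + f \<star> h"
  by (rule ev_inject) (simp only: ev_mult ev_poly_add ev_add)

lemma skew_1_left [simp]: "1 \<star> f = f" and skew_1_right [simp]: "f \<star> 1 = f"
  by (rule ev_inject, simp only: ev_mult ev_1)+

lemma skew_0 [simp]: "0 \<star> f = 0" "f \<star> 0 = 0"
  by (rule ev_inject, simp only: ev_mult ev_0 ev_zero)+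

lemma coeff_skew: "coeff (f \<star> g) n = (\<Sum>i\<le>n. coeff f i * coeff g (n - i) ^ (q ^ i))"
proof -
  have "coeff (f \<star> g) n
    = (\<Sum>i\<le>degree f. \<Sum>j\<le>degree g. if i + j = n then coeff f i * coeff g j ^ (q ^ i) else 0)"
    by (simp add: skew_mult_def coeff_sum)
  also have "\<dots> = (\<Sum>i\<le>degree f. if i \<le> n then coeff f i * coeff g (n - i) ^ (q ^ i) else 0)"
  proof (intro sum.cong refl)
    fix i
    have "(\<Sum>j\<le>degree g. if i + j = n then coeff f i * coeff g j ^ (q ^ i) else 0)
      = (\<Sum>j\<le>degree g. if j = n - i then (if i \<le> n then coeff f i * coeff g (n - i) ^ (q ^ i) else 0) else 0)"
      by (intro sum.cong) auto
    also have "\<dots> = (if i \<le> n then coeff f i * coeff g (n - i) ^ (q ^ i) else 0)"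
      using q_pow_pos[of i] by (auto simp: coeff_eq_0 power_0_left not_le)
    finally show "(\<Sum>j\<le>degree g. if i + j = n then coeff f i * coeff g j ^ (q ^ i) else 0) = \<dots>" .
  qed
  also have "\<dots> = (\<Sum>i\<le>max n (degree f). if i \<le> n then coeff f i * coeff g (n - i) ^ (q ^ i) else 0)"
    by (intro sum.mono_neutral_left) (auto simp: coeff_eq_0)
  also have "\<dots> = (\<Sum>i\<le>n. coeff f i * coeff g (n - i) ^ (q ^ i))"
    by (intro sum.mono_neutral_cong_right) auto
  finally show ?thesis .
qed

lemma coeff_skew_lead:
  assumes "degree f \<le> m" "degree g \<le> n"
  shows "coeff (f \<star> g) (m + n) = coeff f m * coeff g n ^ (q ^ m)"
proof -
  have "coeff (f \<star> g) (m + n) = (\<Sum>i\<in>{m}. coeff f i * coeff g (m + n - i) ^ (q ^ i))"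
    unfolding coeff_skew
  proof (rule sum.mono_neutral_right)
    show "\<forall>i\<in>{..m + n} - {m}. coeff f i * coeff g (m + n - i) ^ (q ^ i) = 0"
    proof
      fix i assume i: "i \<in> {..m + n} - {m}"
      have "m < i \<or> n < m + n - i" using i by auto
      then have "coeff f i = 0 \<or> coeff g (m + n - i) = 0" using assms by (auto intro: coeff_eq_0)
      then show "coeff f i * coeff g (m + n - i) ^ (q ^ i) = 0" using q_pow_pos[of i] by (auto simp: power_0_left)
    qed
  qed auto
  then show ?thesis by simp
qed

lemma degree_skew_le: "degree (f \<star> g) \<le> degree f + degree g"
proof (rule degree_le, intro allI impI)
  fix n assume n: "degree f + degree g < n"
  show "coeff (f \<star> g) n = 0"
    unfolding coeff_skew
  proof (rule sum.neutral, intro ballI)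
    fix i assume "i \<in> {..n}"
    then have "degree f < i \<or> degree g < n - i" using n by auto
    then have "coeff f i = 0 \<or> coeff g (n - i) = 0" by (auto intro: coeff_eq_0)
    then show "coeff f i * coeff g (n - i) ^ (q ^ i) = 0" using q_pow_pos[of i] by (auto simp: power_0_left)
  qed
qed

lemma lead_coeff_skew: "coeff (f \<star> g) (degree f + degree g) = lead_coeff f * lead_coeff g ^ (q ^ degree f)"
  by (rule coeff_skew_lead) auto

lemma skew_eq_0_iff [simp]: "f \<star> g = 0 \<longleftrightarrow> f = 0 \<or> g = 0"
  using lead_coeff_skew[of f g] by auto

lemma degree_skew: "f \<noteq> 0 \<Longrightarrow> g \<noteq> 0 \<Longrightarrow> degree (f \<star> g) = degree f + degree g"
  using lead_coeff_skew[of f g] degree_skew_le[of f g] by (intro antisym le_degree) auto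

lemma coeff_skew_0: "coeff (f \<star> g) 0 = coeff f 0 * coeff g 0"
  by (simp add: coeff_skew)

lemma skew_right_cancel: "h \<noteq> 0 \<Longrightarrow> f \<star> h = g \<star> h \<Longrightarrow> f = g"
  using skew_diff_left[of f g h] by simp

lemma skew_division:
  assumes m: "\<mu> \<noteq> 0"
  shows "\<exists>g r. f = g \<star> \<mu> + r \<and> (r = 0 \<or> degree r < degree \<mu>)"
proof (induction "degree f" arbitrary: f rule: less_induct)
  case less
  show ?case
  proof (cases "f = 0 \<or> degree f < degree \<mu>")
    case True
    then show ?thesis by (intro exI[of _ 0] exI[of _ f]) auto
  next
    case False
    define d where "d = degree f - degree \<mu>"
    define c where "c = monom (lead_coeff f / lead_coeff \<mu> ^ (q ^ d)) d"
    have df: "degree f = d + degree \<mu>" using False by (simp add: d_def)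
    have dc: "degree c \<le> d" unfolding c_def by (rule degree_monom_le)
    have "coeff (c \<star> \<mu>) (d + degree \<mu>) = lead_coeff f"
      using m by (subst coeff_skew_lead[OF dc]) (auto simp: c_def)
    moreover have "degree (c \<star> \<mu>) \<le> d + degree \<mu>"
      using degree_skew_le[of c \<mu>] dc by linarith
    ultimately have "f - c \<star> \<mu> = 0 \<or> degree (f - c \<star> \<mu>) < degree f"
      unfolding df[symmetric] by (intro eq_zero_or_degree_less degree_diff_le) auto
    then have "\<exists>g r. f - c \<star> \<mu> = g \<star> \<mu> + r \<and> (r = 0 \<or> degree r < degree \<mu>)"
      using less by (metis add.right_neutral skew_0(1))
    then obtain g r where "f - c \<star> \<mu> = g \<star> \<mu> + r" "r = 0 \<or> degree r < degree \<mu>" by blast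
    then show ?thesis
      by (intro exI[of _ "g + c"] exI[of _ r]) (simp add: skew_add_left algebra_simps diff_eq_eq)
  qed
qed

text \<open>The remainder vanishes on \<open>zeros \<mu>\<close>, which has too many elements for its degree.\<close>

lemma skew_factor:
  assumes m: "\<mu> \<noteq> 0" "card (zeros \<mu>) = q ^ degree \<mu>" and z: "zeros \<mu> \<subseteq> zeros f"
  obtains g where "f = g \<star> \<mu>"
proof -
  obtain g r where gr: "f = g \<star> \<mu> + r" "r = 0 \<or> degree r < degree \<mu>"
    using skew_division[OF m(1)] by blast
  have "r = 0"
  proof (rule ccontr)
    assume "r \<noteq> 0"
    have "zeros \<mu> \<subseteq> zeros r" using z gr(1) by (auto simp: ev_poly_add ev_mult)
    then have "q ^ degree \<mu> \<le> card (zeros r)"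
      using m(2) finite_zeros[OF \<open>r \<noteq> 0\<close>] card_mono by metis
    also have "\<dots> \<le> q ^ degree r" using \<open>r \<noteq> 0\<close> by (rule card_zeros_le)
    finally have "degree \<mu> \<le> degree r" using q_gt_1 by (metis power_le_imp_le_exp)
    then show False using gr(2) \<open>r \<noteq> 0\<close> by simp
  qed
  then show ?thesis using gr(1) that by simp
qed

subsection \<open>Finite subspaces are zero sets\<close>

definition subspace_q :: "'k set \<Rightarrow> bool" where
  "subspace_q V \<longleftrightarrow> 0 \<in> V \<and> (\<forall>x\<in>V. \<forall>y\<in>V. x + y \<in> V) \<and> (\<forall>c. \<forall>x\<in>V. \<kappa> c * x \<in> V)"

text \<open>A subspace \<open>W\<close> with additive polynomial \<open>\<mu>\<close> is enlarged by \<open>v\<close> on composing \<open>\<mu>\<close> with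
  \<open>\<tau> - u\<^sup>q\<^sup>-\<^sup>1\<close>, whose zeros are the \<open>\<F>\<^sub>q\<close>-multiples of \<open>u = \<mu>(v)\<close>.\<close>

lemma subspace_extend:
  assumes \<mu>: "lead_coeff \<mu> = 1" "coeff \<mu> 0 \<noteq> 0" "zeros \<mu> \<subseteq> V" and V: "finite V" "subspace_q V"
  shows "\<exists>\<mu>. lead_coeff \<mu> = 1 \<and> coeff \<mu> 0 \<noteq> 0 \<and> zeros \<mu> = V"
  using \<mu>
proof (induction "card (V - zeros \<mu>)" arbitrary: \<mu> rule: less_induct)
  case less
  show ?case
  proof (cases "zeros \<mu> = V")
    case False
    then obtain v where v: "v \<in> V" "ev \<mu> v \<noteq> 0" using less.prems(3) by auto
    define u where "u = ev \<mu> v"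
    define \<nu> where "\<nu> = [:- (u ^ (q - 1)), 1:] \<star> \<mu>"
    have u: "u \<noteq> 0" "u ^ q = u ^ (q - 1) * u"
      using v q_gt_1 by (auto simp: u_def simp flip: power_Suc2)
    have ev\<nu>: "ev \<nu> z = ev \<mu> z ^ q - u ^ (q - 1) * ev \<mu> z" for z
      by (simp add: \<nu>_def ev_mult) (simp add: skew_eval_def)
    have "zeros \<nu> \<subseteq> V"
    proof
      fix z assume "z \<in> zeros \<nu>"
      then have "ev \<mu> z ^ q = u ^ (q - 1) * ev \<mu> z" by (simp add: ev\<nu>)
      then have "(ev \<mu> z / u) ^ q = ev \<mu> z / u"
        using u by (simp add: power_divide)
      then obtain c where "ev \<mu> z / u = \<kappa> c" by (rule frob_fixed_imp_const)
      then have "ev \<mu> z = \<kappa> c * u" using u(1) by (simp add: divide_eq_eq)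
      then have "ev \<mu> (z + - (\<kappa> c * v)) = 0"
        by (simp add: ev_diff ev_linear u_def[symmetric])
      then have "z + - (\<kappa> c * v) \<in> V" using less.prems(3) by blast
      moreover have "\<kappa> c * v \<in> V" using V(2) v(1) by (simp add: subspace_q_def)
      ultimately have "(z + - (\<kappa> c * v)) + \<kappa> c * v \<in> V" using V(2) unfolding subspace_q_def by blast
      then show "z \<in> V" by simp
    qed
    moreover have "zeros \<mu> \<subseteq> zeros \<nu>" using q_gt_1 by (auto simp: ev\<nu> power_0_left)
    moreover have "v \<in> zeros \<nu>" using u by (simp add: ev\<nu> flip: u_def)
    ultimately have "V - zeros \<nu> \<subset> V - zeros \<mu>" using v by auto
    then have "card (V - zeros \<nu>) < card (V - zeros \<mu>)" using V(1) by (intro psubset_card_mono) auto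
    moreover have "degree \<nu> = 1 + degree \<mu>"
      unfolding \<nu>_def using less.prems(1) by (subst degree_skew) auto
    then have "lead_coeff \<nu> = 1"
      using lead_coeff_skew[of "[:- (u ^ (q - 1)), 1:]" \<mu>] less.prems(1) by (simp add: \<nu>_def)
    moreover have "coeff \<nu> 0 \<noteq> 0" unfolding \<nu>_def using u(1) less.prems(2) by (simp add: coeff_skew_0)
    ultimately show ?thesis using less.hyps \<open>zeros \<nu> \<subseteq> V\<close> by blast
  qed (use less.prems in blast)
qed

lemma subspace_is_zeros:
  assumes "finite V" "subspace_q V"
  obtains \<mu> where "lead_coeff \<mu> = 1" "coeff \<mu> 0 \<noteq> 0" "zeros \<mu> = V"
  using subspace_extend[of 1 V] assms by (force simp: subspace_q_def)

text \<open>Both sides are monic of the same degree, and their difference vanishes at as many points.\<close>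

lemma kernel_poly_zeros:
  assumes \<mu>: "lead_coeff \<mu> = 1" "coeff \<mu> 0 \<noteq> 0"
  shows "kernel_poly (zeros \<mu>) = lin \<mu>"
proof (rule ccontr)
  assume ne: "kernel_poly (zeros \<mu>) \<noteq> lin \<mu>"
  have m0: "\<mu> \<noteq> 0" using \<mu> by auto
  let ?k = "kernel_poly (zeros \<mu>)"
  have fin: "finite (zeros \<mu>)" using m0 by (rule finite_zeros)
  have k: "degree ?k = card (zeros \<mu>)" "lead_coeff ?k = 1"
    unfolding kernel_poly_def by (subst degree_prod_eq_sum_degree, auto simp: lead_coeff_prod)
  have "lead_coeff (lin \<mu>) = 1" using \<mu>(1) coeff_lin[of \<mu> "degree \<mu>"] by (simp add: degree_lin m0)
  then have "degree (?k - lin \<mu>) \<le> card (zeros \<mu>)" "coeff (?k - lin \<mu>) (card (zeros \<mu>)) = 0"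
    using k by (auto intro!: degree_diff_le simp: degree_lin m0 card_zeros[OF \<mu>(2)])
  then have "degree (?k - lin \<mu>) < card (zeros \<mu>)" using eq_zero_or_degree_less ne by fastforce
  moreover have "zeros \<mu> \<subseteq> {z. poly (?k - lin \<mu>) z = 0}"
    using fin by (auto simp: kernel_poly_def poly_prod poly_lin)
  then have "card (zeros \<mu>) \<le> card {z. poly (?k - lin \<mu>) z = 0}"
    using ne by (intro card_mono poly_roots_finite) auto
  ultimately show False using card_poly_roots_bound[of "?k - lin \<mu>"] ne by simp
qed

end

section \<open>Ideals of the polynomial ring\<close>

lemma is_idealD:
  assumes "is_ideal I"
  shows "0 \<in> I" "x \<in> I \<Longrightarrow> y \<in> I \<Longrightarrow> x + y \<in> I" "x \<in> I \<Longrightarrow> a * x \<in> I" "x \<in> I \<Longrightarrow> x * a \<in> I"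
    "x \<in> I \<Longrightarrow> - x \<in> I" "x \<in> I \<Longrightarrow> y \<in> I \<Longrightarrow> x - y \<in> I"
proof -
  note D = assms[unfolded is_ideal_def]
  show "0 \<in> I" using D by blast
  show a: "x + y \<in> I" if "x \<in> I" "y \<in> I" for x y using D that by blast
  show m: "a * x \<in> I" if "x \<in> I" for a x using D that by blast
  show "x * a \<in> I" if "x \<in> I" using m[OF that, of a] by (simp add: mult.commute)
  show n: "- x \<in> I" if "x \<in> I" for x using m[OF that, of "- 1"] by simp
  show "x - y \<in> I" if "x \<in> I" "y \<in> I" using a[OF that(1) n[OF that(2)]] by simp
qed

lemma ideal_principal:
  fixes I :: "'f::field poly set"
  assumes "is_ideal I"
  obtains g where "I = {a. g dvd a}"
proof (cases "I = {0}")
  case True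
  then show ?thesis by (intro that[of 0]) auto
next
  case False
  note D = is_idealD[OF assms]
  obtain b where "b \<in> I \<and> b \<noteq> 0" using False D(1) by blast
  then obtain g where g: "g \<in> I" "g \<noteq> 0" "\<And>a. a \<in> I \<Longrightarrow> a \<noteq> 0 \<Longrightarrow> degree g \<le> degree a"
    using ex_has_least_nat[of "\<lambda>b. b \<in> I \<and> b \<noteq> 0" b degree] by blast
  have "g dvd a" if "a \<in> I" for a
  proof -
    have "a mod g = a - (a div g) * g" by (simp add: minus_div_mult_eq_mod)
    then have "a mod g \<in> I" using D(6)[OF that D(3)[OF g(1)]] by simp
    moreover have "a mod g = 0 \<or> degree (a mod g) < degree g" using g(2) by (rule degree_mod_less)
    ultimately have "a mod g = 0" using g(3)[of "a mod g"] by linarith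
    then show ?thesis by (simp add: dvd_eq_mod_eq_0)
  qed
  moreover have "a \<in> I" if "g dvd a" for a using that D(4)[OF g(1)] by (auto elim!: dvdE)
  ultimately have "I = {a. g dvd a}" by blast
  then show ?thesis by (rule that)
qed

lemma poly_bezout:
  fixes a b :: "'f::field poly"
  obtains g u v where "g dvd a" "g dvd b" "g = u * a + v * b"
proof -
  define I where "I = {r * a + s * b | r s. True}"
  have "is_ideal I"
    unfolding is_ideal_def
  proof (intro conjI ballI allI)
    show "0 \<in> I" unfolding I_def by (rule CollectI, rule exI[of _ 0], rule exI[of _ 0]) simp
    fix x assume "x \<in> I"
    then obtain r s where x: "x = r * a + s * b" by (auto simp: I_def)
    show "c * x \<in> I" for c
      unfolding I_def x by (rule CollectI, rule exI[of _ "c * r"], rule exI[of _ "c * s"]) (simp add: algebra_simps)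
    fix y assume "y \<in> I"
    then obtain r' s' where y: "y = r' * a + s' * b" by (auto simp: I_def)
    show "x + y \<in> I"
      unfolding I_def x y by (rule CollectI, rule exI[of _ "r + r'"], rule exI[of _ "s + s'"]) (simp add: algebra_simps)
  qed
  then obtain g where g: "I = {a. g dvd a}" by (rule ideal_principal)
  have "a \<in> I" unfolding I_def by (rule CollectI, rule exI[of _ 1], rule exI[of _ 0]) simp
  moreover have "b \<in> I" unfolding I_def by (rule CollectI, rule exI[of _ 0], rule exI[of _ 1]) simp
  moreover have "g \<in> I" using g by simp
  then obtain u v where "g = u * a + v * b" by (auto simp: I_def)
  ultimately show ?thesis using that g by simp
qed

lemma card_degree_less:
  "finite {p :: 'f::{finite,field} poly. p = 0 \<or> degree p < n} \<and>
   card {p :: 'f poly. p = 0 \<or> degree p < n} = CARD('f) ^ n"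
proof (induction n)
  case 0
  then show ?case by simp
next
  case (Suc n)
  let ?S = "\<lambda>n. {p :: 'f poly. p = 0 \<or> degree p < n}"
  have eq: "?S (Suc n) = (\<lambda>(c, p). pCons c p) ` (UNIV \<times> ?S n)"
  proof (intro equalityI subsetI)
    fix p :: "'f poly" assume p: "p \<in> ?S (Suc n)"
    obtain c r where "p = pCons c r" by (rule pCons_cases)
    then show "p \<in> (\<lambda>(c, p). pCons c p) ` (UNIV \<times> ?S n)" using p by (auto split: if_splits)
  qed (auto split: if_splits)
  moreover have "inj_on (\<lambda>(c, p). pCons c p) (UNIV \<times> ?S n)" by (auto simp: inj_on_def)
  ultimately show ?case using Suc by (simp add: card_image card_cartesian_product)
qed

section \<open>Drinfeld modules and their torsion\<close>

lemma card_image_kernel: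
  fixes f :: "'a::ab_group_add \<Rightarrow> 'b::ab_group_add"
  assumes M: "finite M" "\<And>x y. x \<in> M \<Longrightarrow> y \<in> M \<Longrightarrow> x + y \<in> M" "\<And>x y. x \<in> M \<Longrightarrow> y \<in> M \<Longrightarrow> x - y \<in> M"
    and f: "\<And>x y. f (x - y) = f x - f y"
  shows "card M = card (f ` M) * card {x \<in> M. f x = 0}"
proof -
  have "card M = (\<Sum>y\<in>f ` M. card {x \<in> M. f x = y})"
    using sum.image_gen[OF M(1), of "\<lambda>_. 1 :: nat" f] by simp
  also have "\<dots> = (\<Sum>y\<in>f ` M. card {x \<in> M. f x = 0})"
  proof (intro sum.cong refl)
    fix y assume "y \<in> f ` M"
    then obtain w where w: "w \<in> M" "y = f w" by blast
    have "bij_betw (\<lambda>x. x - w) {x \<in> M. f x = y} {x \<in> M. f x = 0}"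
    proof (rule bij_betwI[of _ _ _ "\<lambda>x. x + w"])
      have "f (x + w) = y" if "f x = 0" for x using f[of "x + w" w] that w by simp
      then show "(\<lambda>x. x + w) \<in> {x \<in> M. f x = 0} \<rightarrow> {x \<in> M. f x = y}" using w M(2) by auto
    qed (use w M(3) f in auto)
    then show "card {x \<in> M. f x = y} = card {x \<in> M. f x = 0}" by (rule bij_betw_same_card)
  qed
  finally show ?thesis by simp
qed

context A_base
begin

lemma drinfeldD:
  assumes "drinfeld \<iota> L \<phi>"
  shows "\<phi> a \<in> polys_over L" "\<phi> [:c:] = [:\<kappa> c:]" "\<phi> (a + b) = \<phi> a + \<phi> b" "\<phi> (a * b) = \<phi> a \<star> \<phi> b"
    "coeff (\<phi> a) 0 = \<iota> a" "degree (\<phi> T) = 2"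
  using assms by (simp_all add: drinfeld_def q_card)

lemma drinfeld_UNIV: "drinfeld \<iota> L \<phi> \<Longrightarrow> drinfeld \<iota> UNIV \<phi>"
  by (simp add: drinfeld_def polys_over_def)

lemma torsion_ev: "torsion (\<phi> :: ('f, 'k) amodule) I = {z. \<forall>a\<in>I. ev (\<phi> a) z = 0}"
  by (simp add: torsion_def q_card)

definition ann :: "('f, 'k) amodule \<Rightarrow> 'k \<Rightarrow> 'f poly set" where
  "ann \<phi> z = {a. ev (\<phi> a) z = 0}"

definition span1 :: "('f, 'k) amodule \<Rightarrow> 'k \<Rightarrow> 'k set" where
  "span1 \<phi> z = range (\<lambda>a. ev (\<phi> a) z)"

definition fin_submodule :: "('f, 'k) amodule \<Rightarrow> 'k set \<Rightarrow> bool" where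
  "fin_submodule \<phi> M \<longleftrightarrow> finite M \<and> 0 \<in> M \<and> (\<forall>x\<in>M. \<forall>y\<in>M. x + y \<in> M) \<and> (\<forall>a. \<forall>x\<in>M. ev (\<phi> a) x \<in> M)"

lemma fin_submodule_iff: "fin_submodule (\<phi> :: ('f, 'k) amodule) M \<longleftrightarrow> finite M \<and> submodule \<phi> M"
  unfolding fin_submodule_def submodule_def q_card[symmetric] by (rule refl)

context
  fixes \<phi> :: "('f, 'k) amodule"
  assumes dr: "drinfeld \<iota> UNIV \<phi>"
begin

lemma act_add: "ev (\<phi> (a + b)) z = ev (\<phi> a) z + ev (\<phi> b) z"
  by (simp add: drinfeldD(3)[OF dr] ev_poly_add)

lemma act_mult: "ev (\<phi> (a * b)) z = ev (\<phi> a) (ev (\<phi> b) z)"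
  by (simp add: drinfeldD(4)[OF dr] ev_mult)

lemma act_const: "ev (\<phi> [:c:]) z = \<kappa> c * z"
  by (simp add: drinfeldD(2)[OF dr])

lemma act_1: "ev (\<phi> 1) z = z"
  using act_const[of 1] by (simp flip: one_pCons)

lemma act_0: "ev (\<phi> 0) z = 0"
  using act_const[of 0 z] by simp

lemma act_minus: "ev (\<phi> (- a)) z = - ev (\<phi> a) z"
  using act_add[of a "- a" z] by (simp add: act_0 eq_neg_iff_add_eq_0 add.commute)

lemma act_diff: "ev (\<phi> (a - b)) z = ev (\<phi> a) z - ev (\<phi> b) z"
  using act_add[of a "- b" z] by (simp add: act_minus)

lemma act_commute: "ev (\<phi> a) (ev (\<phi> b) z) = ev (\<phi> b) (ev (\<phi> a) z)"
  by (simp add: mult.commute flip: act_mult)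

lemma act_dvd: "b dvd a \<Longrightarrow> ev (\<phi> b) z = 0 \<Longrightarrow> ev (\<phi> a) z = 0"
  by (elim dvdE) (simp add: mult.commute[of b] act_mult)

lemma module_coeff_0: "a \<noteq> 0 \<Longrightarrow> coeff (\<phi> a) 0 \<noteq> 0"
  by (simp add: drinfeldD(5)[OF dr])

lemma module_eq_0_iff: "\<phi> a = 0 \<longleftrightarrow> a = 0"
proof (cases "a = 0")
  case False
  then show ?thesis using module_coeff_0[OF False] by auto
qed (use drinfeldD(2)[OF dr, of 0] in simp)

lemma degree_module: "degree (\<phi> a) = 2 * degree a"
proof (induction a)
  case 0
  then show ?case using drinfeldD(2)[OF dr, of 0] by simp
next
  case (pCons c a)
  have e: "pCons c a = [:c:] + T * a" by (simp add: monom_altdef)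
  have \<phi>: "\<phi> (pCons c a) = [:\<kappa> c:] + \<phi> T \<star> \<phi> a"
    unfolding e drinfeldD(3)[OF dr] drinfeldD(4)[OF dr] drinfeldD(2)[OF dr] by simp
  show ?case
  proof (cases "a = 0")
    case True
    then show ?thesis using drinfeldD(2)[OF dr, of c] by simp
  next
    case False
    then have "\<phi> a \<noteq> 0" "\<phi> T \<noteq> 0" by (simp_all add: module_eq_0_iff)
    then have "degree (\<phi> T \<star> \<phi> a) = 2 + 2 * degree a"
      by (simp add: degree_skew drinfeldD(6)[OF dr] pCons.IH del: One_nat_def)
    then show ?thesis unfolding \<phi> using False by (subst degree_add_eq_right) auto
  qed
qed

lemma card_zeros_module: "a \<noteq> 0 \<Longrightarrow> card (zeros (\<phi> a)) = q ^ (2 * degree a)"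
  using card_zeros[OF module_coeff_0] by (simp add: degree_module)

lemma finite_zeros_module: "a \<noteq> 0 \<Longrightarrow> finite (zeros (\<phi> a))"
  by (intro finite_zeros) (simp add: module_eq_0_iff)

lemma torsion_principal: "torsion \<phi> {a. g dvd a} = zeros (\<phi> g)"
  unfolding torsion_ev using act_dvd by fastforce

lemma is_ideal_ann: "is_ideal (ann \<phi> z)"
  by (simp add: is_ideal_def ann_def act_0 act_add act_mult)

lemma fin_submoduleD:
  assumes "fin_submodule \<phi> M"
  shows "finite M" "0 \<in> M" "x \<in> M \<Longrightarrow> y \<in> M \<Longrightarrow> x + y \<in> M" "x \<in> M \<Longrightarrow> ev (\<phi> a) x \<in> M"
    "x \<in> M \<Longrightarrow> - x \<in> M" "x \<in> M \<Longrightarrow> y \<in> M \<Longrightarrow> x - y \<in> M"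
proof -
  show "finite M" "0 \<in> M" and a: "x \<in> M \<Longrightarrow> y \<in> M \<Longrightarrow> x + y \<in> M"
    and m: "x \<in> M \<Longrightarrow> ev (\<phi> a) x \<in> M" for x y a
    using assms by (simp_all add: fin_submodule_def)
  show n: "- x \<in> M" if "x \<in> M" for x using m[OF that, of "- 1"] by (simp add: act_minus act_1)
  show "x - y \<in> M" if "x \<in> M" "y \<in> M" using a[OF that(1) n[OF that(2)]] by simp
qed

lemma span1_subset: "fin_submodule \<phi> M \<Longrightarrow> z \<in> M \<Longrightarrow> span1 \<phi> z \<subseteq> M"
  by (auto simp: span1_def intro: fin_submoduleD(4))

lemma span1_gen: "z \<in> span1 \<phi> z"
  unfolding span1_def by (rule range_eqI[of _ _ 1]) (simp add: act_1)

lemma fin_submodule_span1: "finite (span1 \<phi> z) \<Longrightarrow> fin_submodule \<phi> (span1 \<phi> z)"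
  unfolding fin_submodule_def
proof (intro conjI ballI allI)
  show "0 \<in> span1 \<phi> z" unfolding span1_def by (rule range_eqI[of _ _ 0]) (simp add: act_0)
  fix x assume "x \<in> span1 \<phi> z"
  then obtain a where x: "x = ev (\<phi> a) z" by (auto simp: span1_def)
  show "ev (\<phi> b) x \<in> span1 \<phi> z" for b
    unfolding span1_def x by (rule range_eqI[of _ _ "b * a"]) (simp add: act_mult)
  fix y assume "y \<in> span1 \<phi> z"
  then obtain b where y: "y = ev (\<phi> b) z" by (auto simp: span1_def)
  show "x + y \<in> span1 \<phi> z"
    unfolding span1_def x y by (rule range_eqI[of _ _ "a + b"]) (simp add: act_add)
qed

lemma card_span1:
  assumes "ann \<phi> z = {a. g dvd a}" "g \<noteq> 0"
  shows "finite (span1 \<phi> z)" "card (span1 \<phi> z) = q ^ degree g"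
proof -
  let ?R = "{p :: 'f poly. p = 0 \<or> degree p < degree g}"
  have R: "finite ?R" "card ?R = q ^ degree g"
    by (rule conjunct1[OF card_degree_less])
      (unfold q_card, rule conjunct2[OF card_degree_less])
  have eq: "span1 \<phi> z = (\<lambda>a. ev (\<phi> a) z) ` ?R"
  proof (intro equalityI subsetI)
    fix x assume "x \<in> span1 \<phi> z"
    then obtain a where x: "x = ev (\<phi> a) z" by (auto simp: span1_def)
    have "ev (\<phi> (a - a mod g)) z = 0" 
    proof -
      have "a - a mod g \<in> ann \<phi> z" unfolding assms(1) by (simp add: dvd_minus_mod)
      then show ?thesis by (simp add: ann_def)
    qed
    then have "x = ev (\<phi> (a mod g)) z" by (simp add: x act_diff)
    moreover have "a mod g \<in> ?R" using degree_mod_less[OF assms(2)] by simp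
    ultimately show "x \<in> (\<lambda>a. ev (\<phi> a) z) ` ?R" by (rule image_eqI)
  next
    fix x assume "x \<in> (\<lambda>a. ev (\<phi> a) z) ` ?R"
    then obtain a where "x = ev (\<phi> a) z" by (rule imageE)
    then show "x \<in> span1 \<phi> z" unfolding span1_def by (rule range_eqI)
  qed
  have inj: "inj_on (\<lambda>a. ev (\<phi> a) z) ?R"
  proof (rule inj_onI)
    fix a b assume ab: "a \<in> ?R" "b \<in> ?R" "ev (\<phi> a) z = ev (\<phi> b) z"
    then have "a - b \<in> ann \<phi> z" by (simp add: ann_def act_diff)
    then have "g dvd a - b" using assms(1) by simp
    moreover have "a - b = 0 \<or> degree (a - b) < degree g"
      using ab(1,2) by (cases "a = 0"; cases "b = 0") (simp_all add: degree_diff_less)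
    ultimately have "a - b = 0" using dvd_imp_degree_le[of g "a - b"] by linarith
    then show "a = b" by simp
  qed
  show "finite (span1 \<phi> z)" unfolding eq using R(1) by (rule finite_imageI)
  show "card (span1 \<phi> z) = q ^ degree g" unfolding eq card_image[OF inj] by (rule R(2))
qed

text \<open>An isomorphism from \<open>A/I\<close> is given by the image of \<open>1\<close>.\<close>

lemma cyclic_kernel_iff:
  assumes I: "is_ideal I"
  shows "cyclic_kernel \<phi> I \<Lambda> \<longleftrightarrow> finite \<Lambda> \<and> (\<exists>l. \<Lambda> = span1 \<phi> l \<and> ann \<phi> l = I)"
proof -
  note D = is_idealD[OF I]
  have coset: "a +o I = b +o I \<longleftrightarrow> a - b \<in> I" for a b
  proof
    assume "a +o I = b +o I"
    moreover have "a \<in> a +o I" using D(1) by (auto simp: elt_set_plus_def)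
    ultimately have "a \<in> b +o I" by simp
    then obtain i where "i \<in> I" "a = b + i" by (auto simp: elt_set_plus_def)
    then show "a - b \<in> I" by simp
  next
    have sub: "a +o I \<subseteq> b +o I" if "a - b \<in> I" for a b
    proof
      fix x assume "x \<in> a +o I"
      then obtain i where i: "i \<in> I" "x = a + i" by (auto simp: elt_set_plus_def)
      then have "(a - b) + i \<in> I" using that D(2) by blast
      moreover have "x = b + ((a - b) + i)" using i by simp
      ultimately show "x \<in> b +o I" unfolding elt_set_plus_def by blast
    qed
    assume "a - b \<in> I"
    moreover from this have "b - a \<in> I" using D(5)[of "a - b"] by simp
    ultimately show "a +o I = b +o I" using sub by blast
  qed
  show ?thesis
  proof
    assume "cyclic_kernel \<phi> I \<Lambda>"
    then obtain h where fin: "finite \<Lambda>" and h: "bij_betw h (range (\<lambda>a. a +o I)) \<Lambda>"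
      "\<And>a b. h ((a * b) +o I) = ev (\<phi> a) (h (b +o I))"
      unfolding cyclic_kernel_def q_card by blast
    define l where "l = h (1 +o I)"
    have hl: "h (a +o I) = ev (\<phi> a) l" for a using h(2)[of a 1] by (simp add: l_def)
    have "\<Lambda> = span1 \<phi> l"
      using h(1) by (auto simp: bij_betw_def span1_def hl image_image)
    moreover have "a \<in> ann \<phi> l \<longleftrightarrow> a \<in> I" for a
    proof -
      have "a \<in> ann \<phi> l \<longleftrightarrow> h (a +o I) = h (0 +o I)"
        unfolding ann_def hl act_0 by simp
      also have "\<dots> \<longleftrightarrow> a +o I = 0 +o I"
        using inj_on_eq_iff[OF bij_betw_imp_inj_on[OF h(1)], of "a +o I" "0 +o I"] by blast
      also have "\<dots> \<longleftrightarrow> a \<in> I" unfolding coset by simp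
      finally show ?thesis .
    qed
    ultimately show "finite \<Lambda> \<and> (\<exists>l. \<Lambda> = span1 \<phi> l \<and> ann \<phi> l = I)" using fin by blast
  next
    assume "finite \<Lambda> \<and> (\<exists>l. \<Lambda> = span1 \<phi> l \<and> ann \<phi> l = I)"
    then obtain l where fin: "finite \<Lambda>" and l: "\<Lambda> = span1 \<phi> l" "ann \<phi> l = I" by blast
    define h where "h = (\<lambda>C. ev (\<phi> (SOME a. C = a +o I)) l)"
    have hl: "h (a +o I) = ev (\<phi> a) l" for a
    proof -
      have "a +o I = (SOME b. a +o I = b +o I) +o I" by (rule someI[of _ a]) simp
      then have "a - (SOME b. a +o I = b +o I) \<in> ann \<phi> l" by (simp add: coset l)
      then show ?thesis by (simp add: h_def ann_def act_diff)
    qed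
    have "bij_betw h (range (\<lambda>a. a +o I)) \<Lambda>"
    proof (rule bij_betw_imageI)
      show "inj_on h (range (\<lambda>a. a +o I))"
      proof (rule inj_onI)
        fix C C' assume "C \<in> range (\<lambda>a. a +o I)" "C' \<in> range (\<lambda>a. a +o I)" "h C = h C'"
        then obtain a b where ab: "C = a +o I" "C' = b +o I" "ev (\<phi> a) l = ev (\<phi> b) l"
          by (auto simp: hl)
        then have "a - b \<in> ann \<phi> l" by (simp add: ann_def act_diff)
        then show "C = C'" using ab(1,2) by (simp add: coset l(2))
      qed
      show "h ` range (\<lambda>a. a +o I) = \<Lambda>" by (simp add: image_image hl l(1) span1_def)
    qed
    moreover have "h ((a + b) +o I) = h (a +o I) + h (b +o I)"
      "h ((a * b) +o I) = ev (\<phi> a) (h (b +o I))" for a b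
      by (simp_all add: hl act_add act_mult)
    ultimately show "cyclic_kernel \<phi> I \<Lambda>"
      unfolding cyclic_kernel_def q_card[symmetric]
      using fin fin_submodule_span1 l(1) fin_submodule_iff by blast
  qed
qed

lemma ann_finite:
  assumes M: "fin_submodule \<phi> M" and z: "z \<in> M"
  obtains g where "g \<noteq> 0" "ann \<phi> z = {a. g dvd a}"
proof -
  obtain g where g: "ann \<phi> z = {a. g dvd a}" using ideal_principal[OF is_ideal_ann] .
  have "g \<noteq> 0"
  proof
    assume "g = 0"
    have "inj (\<lambda>a. ev (\<phi> a) z)"
    proof (rule injI)
      fix a b assume "ev (\<phi> a) z = ev (\<phi> b) z"
      then have "a - b \<in> ann \<phi> z" by (simp add: ann_def act_diff)
      then show "a = b" using g \<open>g = 0\<close> by simp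
    qed
    moreover have "finite (range (\<lambda>a. ev (\<phi> a) z))"
      using finite_subset[OF span1_subset[OF M z] fin_submoduleD(1)[OF M]] by (simp add: span1_def)
    ultimately have "finite (UNIV :: 'f poly set)" by (rule finite_imageD[rotated])
    moreover have "infinite (UNIV :: 'f poly set)"
      using infinite_range_emb finite_imageI by metis
    ultimately show False by simp
  qed
  then show ?thesis using that g by blast
qed

end

end

section \<open>Exponents of finite modules\<close>

lemma coprime_mult_dvd:
  fixes a b e :: "'r::comm_ring_1"
  assumes "u * a + v * b = 1" "a dvd e" "b dvd e"
  shows "a * b dvd e"
proof -
  have "e = e * (u * a + v * b)" using assms(1) by simp
  also have "\<dots> = u * (a * e) + v * (e * b)" by (simp add: algebra_simps)
  finally have "e = u * (a * e) + v * (e * b)" .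
  moreover have "a * b dvd u * (a * e) + v * (e * b)"
    using assms(2,3) by (intro dvd_add dvd_mult mult_dvd_mono dvd_refl)
  ultimately show ?thesis by simp
qed

lemma coprime_dvd_cancel:
  fixes a b e :: "'r::comm_ring_1"
  assumes "u * a + v * b = 1" "a dvd e * b"
  shows "a dvd e"
proof -
  have "e = e * (u * a + v * b)" using assms(1) by simp
  also have "\<dots> = (e * u) * a + v * (e * b)" by (simp add: algebra_simps)
  finally have e: "e = (e * u) * a + v * (e * b)" .
  have "a dvd (e * u) * a + v * (e * b)"
    using dvd_mult[OF assms(2), of v] by (intro dvd_add) simp_all
  then show ?thesis using e by simp
qed

text \<open>A non-constant polynomial has a prime factor: a non-constant divisor of least degree.\<close>

lemma prime_factor:
  fixes d :: "'f::field poly"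
  assumes "0 < degree d"
  shows "\<exists>p. p dvd d \<and> 0 < degree p \<and> (\<forall>f k. \<not> p dvd f \<longrightarrow> (\<exists>u v. u * p ^ k + v * f = 1))"
proof -
  obtain p where p: "p dvd d" "0 < degree p"
    "\<And>g. g dvd d \<Longrightarrow> 0 < degree g \<Longrightarrow> degree p \<le> degree g"
    using ex_has_least_nat[of "\<lambda>p. p dvd d \<and> 0 < degree p" d degree] assms by auto
  have p0: "p \<noteq> 0" using p(2) by auto
  have one: "\<exists>u v. u * p + v * f = 1" if f: "\<not> p dvd f" for f
  proof -
    obtain g u v where g: "g dvd p" "g dvd f" "g = u * p + v * f" using poly_bezout[of p f] by metis
    obtain h where h: "p = g * h" using g(1) by (elim dvdE)
    have nz: "g \<noteq> 0" "h \<noteq> 0" using p0 h by auto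
    have "degree g = 0"
    proof (rule ccontr)
      assume "degree g \<noteq> 0"
      then have "degree p \<le> degree g" using p(3) dvd_trans[OF g(1) p(1)] by blast
      then have "degree h = 0" using degree_mult_eq[OF nz] h by simp
      then have "h dvd 1" using nz(2) by (simp add: is_unit_iff_degree)
      then have "p dvd g" unfolding h by (metis dvd_refl mult.right_neutral mult_dvd_mono)
      then show False using f g(2) dvd_trans by blast
    qed
    then have "g dvd 1" using nz(1) by (simp add: is_unit_iff_degree)
    then obtain w where w: "1 = g * w" by (elim dvdE)
    have "(w * u) * p + (w * v) * f = 1" unfolding w g(3) by (simp add: algebra_simps)
    then show ?thesis by blast
  qed
  have "\<exists>u v. u * p ^ k + v * f = 1" if f: "\<not> p dvd f" for f k
  proof (induction k)
    case 0
    show ?case by (intro exI[of _ 1] exI[of _ 0]) simp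
  next
    case (Suc k)
    obtain u v u' v' where "u * p ^ k + v * f = 1" "u' * p + v' * f = 1" using Suc one[OF f] by metis
    then have "(u * p ^ k + v * f) * (u' * p + v' * f) = 1" by simp
    then have "(u * u') * p ^ Suc k + (u * p ^ k * v' + v * u' * p + v * f * v') * f = 1"
      by (simp add: algebra_simps)
    then show ?case by blast
  qed
  then show ?thesis using p(1,2) by blast
qed

lemma extract_prime_power:
  fixes d p :: "'f::field poly"
  assumes "d \<noteq> 0" "0 < degree p"
  obtains k r where "d = p ^ k * r" "\<not> p dvd r"
proof -
  have "\<exists>k r. d = p ^ k * r \<and> \<not> p dvd r"
    using assms(1)
  proof (induction "degree d" arbitrary: d rule: less_induct)
    case less
    show ?case
    proof (cases "p dvd d")
      case True
      then obtain e where e: "d = p * e" by (elim dvdE)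
      then have "e \<noteq> 0" "p \<noteq> 0" using less.prems by auto
      then have "degree e < degree d" using e assms(2) by (simp add: degree_mult_eq)
      then obtain k r where "e = p ^ k * r" "\<not> p dvd r" using less.hyps \<open>e \<noteq> 0\<close> by blast
      then show ?thesis using e by (intro exI[of _ "Suc k"] exI[of _ r]) (simp add: mult.assoc)
    next
      case False
      then show ?thesis by (intro exI[of _ 0] exI[of _ d]) simp
    qed
  qed
  then show ?thesis using that by blast
qed

context A_base
begin

text \<open>As for finite abelian groups.  If the annihilator of \<open>y\<close> does not contain the annihilator of
  an element \<open>z\<close> with the smallest possible annihilator, then one reduces to the case that the former
  is generated by a prime power \<open>p\<^sup>k\<close>; splitting off the \<open>p\<close>-part of \<open>z\<close> and adding \<open>y\<close> gives an
  element with a smaller annihilator.\<close>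

lemma exponent_element:
  assumes dr: "drinfeld \<iota> UNIV \<phi>" and M: "fin_submodule \<phi> M"
  shows "\<exists>z\<in>M. \<exists>g. g \<noteq> 0 \<and> ann \<phi> z = {a. g dvd a} \<and> (\<forall>y\<in>M. ev (\<phi> g) y = 0)"
proof -
  note D = fin_submoduleD[OF dr M]
  have "\<forall>z\<in>M. \<exists>g. g \<noteq> 0 \<and> ann \<phi> z = {a. g dvd a}" using ann_finite[OF dr M] by metis
  then obtain c where c: "\<And>z. z \<in> M \<Longrightarrow> c z \<noteq> 0 \<and> ann \<phi> z = {a. c z dvd a}" by metis
  have c0: "c z \<noteq> 0" if "z \<in> M" for z using c[OF that] by blast
  have ci: "ev (\<phi> a) z = 0 \<longleftrightarrow> c z dvd a" if "z \<in> M" for a z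
    using c[OF that] unfolding ann_def by blast
  let ?N = "(\<lambda>z. degree (c z)) ` M"
  have "Max ?N \<in> ?N" using D(1,2) by (intro Max_in) auto
  then obtain z where z: "z \<in> M" "degree (c z) = Max ?N" by auto
  have max: "degree (c y) \<le> degree (c z)" if "y \<in> M" for y
    unfolding z(2) using that D(1) by (intro Max_ge) auto
  have "c y dvd c z" if "y \<in> M" for y
  proof (rule ccontr)
    assume "\<not> c y dvd c z"
    then obtain y where y: "y \<in> M" "\<not> c y dvd c z"
      "\<And>w. w \<in> M \<Longrightarrow> \<not> c w dvd c z \<Longrightarrow> degree (c y) \<le> degree (c w)"
      using ex_has_least_nat[of "\<lambda>y. y \<in> M \<and> \<not> c y dvd c z" y "\<lambda>y. degree (c y)"] \<open>y \<in> M\<close> by auto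
    define d where "d = c y"
    have d0: "d \<noteq> 0" and nd: "\<not> d dvd c z" using c0[OF y(1)] y(2) by (auto simp: d_def)
    have dy: "ev (\<phi> a) y = 0 \<longleftrightarrow> d dvd a" for a using ci[OF y(1)] by (simp add: d_def)
    (* a proper divisor e of d generates the annihilator of a multiple of y, and d was minimal *)
    have red: "e dvd c z" if e: "d = f * e" "degree e < degree d" for e f
    proof -
      have w: "ev (\<phi> f) y \<in> M" by (rule D(4)[OF y(1)])
      have we: "ev (\<phi> a) (ev (\<phi> f) y) = 0 \<longleftrightarrow> e dvd a" for a
      proof -
        have "ev (\<phi> a) (ev (\<phi> f) y) = 0 \<longleftrightarrow> f * e dvd a * f"
          unfolding act_mult[OF dr, symmetric] dy e(1) ..
        also have "\<dots> \<longleftrightarrow> e dvd a" using d0 e(1) by (simp add: mult.commute[of a])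
        finally show ?thesis .
      qed
      have "c (ev (\<phi> f) y) dvd e" using we[of e] ci[OF w] by simp
      then have "degree (c (ev (\<phi> f) y)) \<le> degree e" using e(1) d0 by (intro dvd_imp_degree_le) auto
      then have "c (ev (\<phi> f) y) dvd c z" using y(3)[OF w] e(2) unfolding d_def by linarith
      moreover have "e dvd c (ev (\<phi> f) y)"
        using we[of "c (ev (\<phi> f) y)"] ci[OF w, of "c (ev (\<phi> f) y)"] dvd_refl by blast
      ultimately show ?thesis by (rule dvd_trans[rotated])
    qed
    have "0 < degree d"
    proof (rule ccontr)
      assume "\<not> 0 < degree d"
      then have "d dvd 1" using d0 by (simp add: is_unit_iff_degree)
      then have "d dvd c z" using one_dvd by (rule dvd_trans)
      then show False using nd by blast
    qed
    then obtain p where p: "p dvd d" "0 < degree p"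
      "\<And>f k. \<not> p dvd f \<Longrightarrow> \<exists>u v. u * p ^ k + v * f = 1" using prime_factor[of d] by blast
    obtain k r where kr: "d = p ^ k * r" "\<not> p dvd r" by (rule extract_prime_power[OF d0 p(2)])
    have nz: "r \<noteq> 0" "p \<noteq> 0" using d0 kr p(2) by auto
    have k: "k \<noteq> 0" using kr p(1) by (cases k) auto
    have dk: "degree (p ^ k) = k * degree p" using nz by (simp add: degree_power_eq)
    have dd: "degree d = degree (p ^ k) + degree r" using nz kr(1) by (simp add: degree_mult_eq)
    have "degree r = 0"
    proof (rule ccontr)
      assume r: "degree r \<noteq> 0"
      have "r dvd c z" using red[of "p ^ k" r] kr(1) k p(2) dd dk by simp
      moreover have "p ^ k dvd c z" using red[of r "p ^ k"] kr(1) r dd by (simp add: mult.commute)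
      moreover obtain u v where "u * p ^ k + v * r = 1" using p(3)[OF kr(2)] by metis
      ultimately have "p ^ k * r dvd c z" by (intro coprime_mult_dvd)
      then show False using nd kr(1) by simp
    qed
    then have unit: "r dvd 1" using nz(1) by (simp add: is_unit_iff_degree)
    obtain d' where d': "d = p * d'" using p(1) by (elim dvdE)
    then have "d' \<noteq> 0" using d0 by auto
    then have degd: "degree d = degree p + degree d'" using d' nz(2) by (simp add: degree_mult_eq)
    then have "d' dvd c z" using red[OF d'] p(2) by simp
    then obtain e where e: "c z = d' * e" by (elim dvdE)
    have "e \<noteq> 0" using e c0[OF z(1)] by auto
    have "\<not> p dvd e"
    proof
      assume "p dvd e"
      then have "p * d' dvd e * d'" by (intro mult_dvd_mono) auto
      then show False using nd d' e by (simp add: mult.commute)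
    qed
    then obtain u v where uv: "u * p ^ k + v * e = 1" using p(3) by metis
    define w where "w = ev (\<phi> d') z + y"
    have w: "w \<in> M" unfolding w_def using D(3)[OF D(4)[OF z(1)] y(1)] .
    define a where "a = c w"
    have "ev (\<phi> a) w = 0" using ci[OF w] by (simp add: a_def)
    then have aw: "ev (\<phi> (a * d')) z + ev (\<phi> a) y = 0" by (simp add: w_def ev_add act_mult[OF dr])
    have mult: "ev (\<phi> (b * (a * d'))) z + ev (\<phi> (b * a)) y = 0" for b
      using arg_cong[OF aw, of "ev (\<phi> b)"] by (simp add: ev_add act_mult[OF dr])
    have "p ^ k * e dvd a"
    proof (rule coprime_mult_dvd[OF uv])
      have "ev (\<phi> (e * (a * d'))) z = 0" using ci[OF z(1)] e by (simp add: algebra_simps)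
      then have "d dvd a * e" using mult[of e] dy by (simp add: mult.commute)
      then have "p ^ k dvd a * e" using kr(1) dvd_trans dvd_triv_left by metis
      then show "p ^ k dvd a" by (rule coprime_dvd_cancel[OF uv])
      have "ev (\<phi> (d * a)) y = 0" using dy by simp
      then have "d' * e dvd d * (a * d')" using mult[of d] ci[OF z(1)] e by simp
      then have "d' * e dvd d' * (d * a)" by (simp add: mult_ac)
      then have "e dvd d * a" using \<open>d' \<noteq> 0\<close> by simp
      then have "e dvd (a * p ^ k) * r" by (simp add: kr(1) mult_ac)
      then have "e dvd a * p ^ k" using unit by (simp add: dvd_mult_unit_iff)
      moreover have "v * e + u * p ^ k = 1" using uv by (simp add: add.commute)
      ultimately show "e dvd a" by (rule coprime_dvd_cancel[rotated])
    qed
    then have "degree (p ^ k * e) \<le> degree a"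
      using c0[OF w] by (intro dvd_imp_degree_le) (auto simp: a_def)
    also have "\<dots> \<le> degree (c z)" unfolding a_def by (rule max[OF w])
    finally have "degree (p ^ k) + degree e \<le> degree d' + degree e"
      using e \<open>e \<noteq> 0\<close> \<open>d' \<noteq> 0\<close> nz by (simp add: degree_mult_eq)
    then show False using dd degd \<open>degree r = 0\<close> p(2) by simp
  qed
  then have e: "ev (\<phi> (c z)) y = 0" if "y \<in> M" for y using ci[OF that] that by simp
  have "ann \<phi> z = {a. c z dvd a}" using c[OF z(1)] by simp
  then show ?thesis using c0[OF z(1)] e by (intro bexI[OF _ z(1)] exI[of _ "c z"]) simp
qed

section \<open>Isogenies\<close>

lemma isogeny_iff:
  "isogeny \<mu> (\<phi> :: ('f, 'k) amodule) \<psi> \<longleftrightarrow> \<mu> \<noteq> 0 \<and> (\<forall>a. \<mu> \<star> \<phi> a = \<psi> a \<star> \<mu>)"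
  unfolding isogeny_def q_card[symmetric] by (rule refl)

lemma isogeny_ev: "isogeny \<mu> (\<phi> :: ('f, 'k) amodule) \<psi> \<Longrightarrow> ev \<mu> (ev (\<phi> a) z) = ev (\<psi> a) (ev \<mu> z)"
  unfolding isogeny_iff ev_mult[symmetric] by simp

lemma isogeny_comp:
  "isogeny \<mu> (\<phi> :: ('f, 'k) amodule) \<psi> \<Longrightarrow> isogeny \<nu> \<psi> \<chi> \<Longrightarrow> isogeny (\<nu> \<star> \<mu>) \<phi> \<chi>"
proof -
  assume \<mu>: "isogeny \<mu> \<phi> \<psi>" and \<nu>: "isogeny \<nu> \<psi> \<chi>"
  have "\<nu> \<star> \<mu> \<star> \<phi> a = \<chi> a \<star> (\<nu> \<star> \<mu>)" for a
  proof -
    have "\<nu> \<star> \<mu> \<star> \<phi> a = \<nu> \<star> \<psi> a \<star> \<mu>" using \<mu> by (simp only: isogeny_iff skew_assoc)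
    also have "\<dots> = \<chi> a \<star> (\<nu> \<star> \<mu>)" using \<nu> by (simp only: isogeny_iff skew_assoc)
    finally show ?thesis .
  qed
  then show ?thesis using \<mu> \<nu> by (simp only: isogeny_iff skew_eq_0_iff) blast
qed

lemma isogeny_self: "drinfeld \<iota> UNIV \<phi> \<Longrightarrow> a \<noteq> 0 \<Longrightarrow> isogeny (\<phi> a) \<phi> \<phi>"
  unfolding isogeny_iff using module_eq_0_iff[of \<phi> a] drinfeldD(4)[of UNIV \<phi>]
  by (metis mult.commute)

text \<open>The lowest coefficient \<open>c \<tau>\<^sup>i\<close> of an isogeny gives \<open>\<iota>(T)^(q^i) = \<iota>(T)\<close>, so \<open>i = 0\<close>: isogenies
  are separable.\<close>

lemma isogeny_coeff_0:
  assumes "drinfeld \<iota> UNIV \<phi>" "drinfeld \<iota> UNIV \<psi>" and \<mu>: "isogeny \<mu> \<phi> \<psi>"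
  shows "coeff \<mu> 0 \<noteq> 0"
proof -
  have m: "\<mu> \<noteq> 0" "\<mu> \<star> \<phi> T = \<psi> T \<star> \<mu>" using \<mu> by (auto simp: isogeny_iff)
  define i where "i = (LEAST i. coeff \<mu> i \<noteq> 0)"
  have "coeff \<mu> (degree \<mu>) \<noteq> 0" using m(1) by simp
  then have i: "coeff \<mu> i \<noteq> 0" unfolding i_def by (rule LeastI)
  have low: "coeff \<mu> j = 0" if "j < i" for j using not_less_Least[OF that[unfolded i_def]] by simp
  have "coeff (\<mu> \<star> \<phi> T) i = (\<Sum>j\<in>{i}. coeff \<mu> j * coeff (\<phi> T) (i - j) ^ (q ^ j))"
    unfolding coeff_skew by (rule sum.mono_neutral_right) (auto simp: low)
  moreover have "coeff (\<psi> T \<star> \<mu>) i = (\<Sum>j\<in>{0}. coeff (\<psi> T) j * coeff \<mu> (i - j) ^ (q ^ j))"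
    unfolding coeff_skew
  proof (rule sum.mono_neutral_right)
    show "\<forall>j\<in>{..i} - {0}. coeff (\<psi> T) j * coeff \<mu> (i - j) ^ (q ^ j) = 0"
      using low q_pow_pos by (auto simp: power_0_left)
  qed auto
  ultimately have "\<iota> T ^ (q ^ i) = \<iota> T"
    using m(2) i drinfeldD(5)[OF assms(1), of T] drinfeldD(5)[OF assms(2), of T] by simp
  then have "(T :: 'f poly) ^ (q ^ i) = T" by (simp only: flip: emb_power) (simp only: emb_inj)
  then have "degree ((T :: 'f poly) ^ (q ^ i)) = degree (T :: 'f poly)" by (rule arg_cong)
  then have "q ^ i = 1" by (simp add: degree_power_eq degree_monom_eq)
  then have "i = 0" using q_gt_1 by simp
  then show ?thesis using i by simp
qed

lemma isogeny_card_zeros: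
  assumes "drinfeld \<iota> UNIV \<phi>" "drinfeld \<iota> UNIV \<psi>" "isogeny \<mu> \<phi> \<psi>"
  shows "card (zeros \<mu>) = q ^ degree \<mu>" "finite (zeros \<mu>)"
  using card_zeros[OF isogeny_coeff_0[OF assms]] finite_zeros[of \<mu>] assms(3) by (auto simp: isogeny_iff)

text \<open>By separability \<open>\<mu>\<close> divides \<open>\<mu>'\<close> on the right, and the quotient is constant by comparison of
  degrees.\<close>

lemma isogeny_same_zeros:
  assumes dr: "drinfeld \<iota> UNIV \<phi>" "drinfeld \<iota> UNIV \<psi>" "drinfeld \<iota> UNIV \<psi>'"
    and \<mu>: "isogeny \<mu> \<phi> \<psi>" "isogeny \<mu>' \<phi> \<psi>'" and z: "zeros \<mu> = zeros \<mu>'"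
  obtains c where "c \<noteq> 0" "\<mu>' = [:c:] \<star> \<mu>" "isogeny [:c:] \<psi> \<psi>'"
proof -
  note card = isogeny_card_zeros(1)[OF dr(1,2) \<mu>(1)] isogeny_card_zeros(1)[OF dr(1,3) \<mu>(2)]
  have m: "\<mu> \<noteq> 0" "\<mu>' \<noteq> 0" using \<mu> by (auto simp: isogeny_iff)
  obtain g where g: "\<mu>' = g \<star> \<mu>" using skew_factor[OF m(1) card(1), of \<mu>'] z by blast
  then have "g \<noteq> 0" using m by auto
  have "degree \<mu>' = degree \<mu>" using card z q_gt_1 by simp
  then have "degree g = 0" using degree_skew[OF \<open>g \<noteq> 0\<close> m(1)] g by simp
  then obtain c where c: "g = [:c:]" by (auto elim: degree_eq_zeroE)
  have "g \<star> \<psi> a = \<psi>' a \<star> g" for a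
  proof (rule skew_right_cancel[OF m(1)])
    have "g \<star> \<psi> a \<star> \<mu> = g \<star> (\<mu> \<star> \<phi> a)" using \<mu>(1) by (simp add: isogeny_iff skew_assoc)
    also have "\<dots> = \<psi>' a \<star> \<mu>'" using \<mu>(2) by (simp add: isogeny_iff g flip: skew_assoc)
    also have "\<dots> = \<psi>' a \<star> g \<star> \<mu>" by (simp add: g skew_assoc)
    finally show "g \<star> \<psi> a \<star> \<mu> = \<psi>' a \<star> g \<star> \<mu>" .
  qed
  then have "isogeny [:c:] \<psi> \<psi>'" using \<open>g \<noteq> 0\<close> c by (simp add: isogeny_iff)
  then show ?thesis using that c g \<open>g \<noteq> 0\<close> by simp
qed

lemma degree_2_imp_nonconst: "degree (\<psi> (T :: 'f poly) :: 'k poly) = 2 \<Longrightarrow> \<exists>a. \<psi> a \<noteq> [:\<iota> a:]"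
  by (metis degree_pCons_0 zero_neq_numeral)

text \<open>The commutation with \<open>\<mu>\<close> determines \<open>\<psi>\<close>, and the module axioms for \<open>\<psi>\<close> follow from those for
  \<open>\<phi>\<close> on cancelling \<open>\<mu>\<close> on the right.\<close>

lemma push_forward_exists:
  assumes dr: "drinfeld \<iota> UNIV \<phi>" and \<mu>: "coeff \<mu> 0 \<noteq> 0" and push: "\<And>a. \<exists>g. \<mu> \<star> \<phi> a = g \<star> \<mu>"
  obtains \<psi> where "drinfeld \<iota> UNIV \<psi>" "isogeny \<mu> \<phi> \<psi>"
proof -
  have m0: "\<mu> \<noteq> 0" using \<mu> by auto
  obtain \<psi> where \<psi>: "\<And>a. \<mu> \<star> \<phi> a = \<psi> a \<star> \<mu>" using push by metis
  have "drinfeld \<iota> UNIV \<psi>"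
    unfolding drinfeld_def q_card[symmetric]
  proof (intro conjI allI)
    show "\<psi> [:c:] = [:\<kappa> c:]" for c
    proof (rule skew_right_cancel[OF m0])
      have "\<mu> \<star> [:\<kappa> c:] = [:\<kappa> c:] \<star> \<mu>" by (rule ev_inject) (simp add: ev_mult ev_linear)
      then show "\<psi> [:c:] \<star> \<mu> = [:\<kappa> c:] \<star> \<mu>" using \<psi>[of "[:c:]"] drinfeldD(2)[OF dr] by simp
    qed
    show "\<psi> (a + b) = \<psi> a + \<psi> b" for a b
    proof (rule skew_right_cancel[OF m0])
      show "\<psi> (a + b) \<star> \<mu> = (\<psi> a + \<psi> b) \<star> \<mu>"
        by (simp add: skew_add_left skew_add_right drinfeldD(3)[OF dr] flip: \<psi>)
    qed
    show "\<psi> (a * b) = \<psi> a \<star> \<psi> b" for a b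
    proof (rule skew_right_cancel[OF m0])
      have "\<psi> (a * b) \<star> \<mu> = \<mu> \<star> \<phi> a \<star> \<phi> b" by (simp add: drinfeldD(4)[OF dr] skew_assoc flip: \<psi>)
      also have "\<dots> = \<psi> a \<star> (\<mu> \<star> \<phi> b)" by (simp add: \<psi> skew_assoc)
      also have "\<dots> = \<psi> a \<star> \<psi> b \<star> \<mu>" by (simp add: \<psi> skew_assoc)
      finally show "\<psi> (a * b) \<star> \<mu> = \<psi> a \<star> \<psi> b \<star> \<mu>" .
    qed
    show "coeff (\<psi> a) 0 = \<iota> a" for a
    proof -
      have "coeff \<mu> 0 * \<iota> a = coeff (\<psi> a) 0 * coeff \<mu> 0"
        using arg_cong[OF \<psi>[of a], of "\<lambda>p. coeff p 0"] by (simp add: coeff_skew_0 drinfeldD(5)[OF dr])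
      then show ?thesis using \<mu> by simp
    qed
    show deg: "degree (\<psi> T) = 2"
    proof -
      have "\<phi> T \<noteq> 0" using module_eq_0_iff[OF dr] by simp
      then have "\<psi> T \<noteq> 0" using \<psi>[of T] m0 by (metis skew_eq_0_iff)
      then show ?thesis
        using arg_cong[OF \<psi>[of T], of degree] m0 \<open>\<phi> T \<noteq> 0\<close> drinfeldD(6)[OF dr]
        by (simp add: degree_skew del: One_nat_def)
    qed
    then show "\<exists>a. \<psi> a \<noteq> [:\<iota> a:]" by (rule degree_2_imp_nonconst)
  qed (simp add: polys_over_def)
  moreover have "isogeny \<mu> \<phi> \<psi>" using m0 \<psi> by (simp add: isogeny_iff)
  ultimately show ?thesis by (rule that)
qed

text \<open>The monic additive polynomial with zero set \<open>V\<close> divides \<open>\<mu> \<phi>\<^sub>a\<close> on the right, since \<open>\<phi>\<^sub>a\<close>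
  maps \<open>V\<close> into itself.\<close>

lemma quotient_exists:
  assumes dr: "drinfeld \<iota> UNIV \<phi>" and V: "fin_submodule \<phi> V"
  obtains \<mu> \<psi> where "lead_coeff \<mu> = 1" "coeff \<mu> 0 \<noteq> 0" "zeros \<mu> = V" "drinfeld \<iota> UNIV \<psi>" "isogeny \<mu> \<phi> \<psi>"
proof -
  note D = fin_submoduleD[OF dr V]
  have "subspace_q V"
    unfolding subspace_q_def
  proof (intro conjI ballI allI)
    show "\<kappa> c * x \<in> V" if "x \<in> V" for c x using D(4)[OF that, of "[:c:]"] act_const[OF dr] by simp
  qed (use D in auto)
  then obtain \<mu> where \<mu>: "lead_coeff \<mu> = 1" "coeff \<mu> 0 \<noteq> 0" "zeros \<mu> = V"
    using subspace_is_zeros[OF D(1)] by blast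
  then have m0: "\<mu> \<noteq> 0" by auto
  have "\<exists>g. \<mu> \<star> \<phi> a = g \<star> \<mu>" for a
  proof -
    have "zeros \<mu> \<subseteq> zeros (\<mu> \<star> \<phi> a)"
    proof
      fix z assume "z \<in> zeros \<mu>"
      then have "ev (\<phi> a) z \<in> zeros \<mu>" using D(4) \<mu>(3) by blast
      then show "z \<in> zeros (\<mu> \<star> \<phi> a)" by (simp add: ev_mult)
    qed
    then show ?thesis using skew_factor[OF m0 card_zeros[OF \<mu>(2)], of "\<mu> \<star> \<phi> a"] by metis
  qed
  then obtain \<psi> where "drinfeld \<iota> UNIV \<psi>" "isogeny \<mu> \<phi> \<psi>"
    by (rule push_forward_exists[OF dr \<mu>(2)])
  then show ?thesis by (rule that[OF \<mu>])
qed

text \<open>The ring \<open>A\<close> is generated by \<open>T\<close> and the constants in \<open>\<F>\<^sub>q\<close>, which commute with every skew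
  polynomial.\<close>

lemma skew_commute_from_T:
  assumes dr: "drinfeld \<iota> UNIV \<phi>" "drinfeld \<iota> UNIV \<psi>" and T: "\<mu> \<star> \<phi> T = \<psi> T \<star> \<mu>"
  shows "\<mu> \<star> \<phi> a = \<psi> a \<star> \<mu>"
proof (induction a)
  case 0
  then show ?case using module_eq_0_iff[OF dr(1), of 0] module_eq_0_iff[OF dr(2), of 0] by simp
next
  case (pCons c a)
  have e: "pCons c a = [:c:] + T * a" by (simp add: monom_altdef)
  have "\<mu> \<star> [:\<kappa> c:] = [:\<kappa> c:] \<star> \<mu>" by (rule ev_inject) (simp add: ev_mult ev_linear)
  moreover have "\<mu> \<star> (\<phi> T \<star> \<phi> a) = \<psi> T \<star> \<psi> a \<star> \<mu>"
    by (metis T pCons.IH skew_assoc)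
  ultimately show ?case
    unfolding e drinfeldD(3)[OF dr(1)] drinfeldD(3)[OF dr(2)] drinfeldD(4)[OF dr(1)] drinfeldD(4)[OF dr(2)]
      drinfeldD(2)[OF dr(1)] drinfeldD(2)[OF dr(2)]
    by (simp add: skew_add_left skew_add_right)
qed

lemma drinfeld_over_from_T:
  assumes dr: "drinfeld \<iota> UNIV \<phi>" and L: "subfield_of L" "range \<iota> \<subseteq> L" and T: "\<phi> T \<in> polys_over L"
  shows "drinfeld \<iota> L \<phi>"
proof -
  have "\<phi> a \<in> polys_over L" for a
  proof (induction a)
    case 0
    then show ?case using module_eq_0_iff[OF dr, of 0] polys_over_closed(1)[OF L(1)] by simp
  next
    case (pCons c a)
    have e: "pCons c a = [:c:] + T * a" by (simp add: monom_altdef)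
    have "\<phi> T \<star> \<phi> a \<in> polys_over L"
      using T pCons.IH unfolding polys_over_def mem_Collect_eq coeff_skew
      by (intro allI subfield_sum[OF L(1)] subfieldD(4,9)[OF L(1)]) auto
    moreover have "[:\<kappa> c:] \<in> polys_over L" using L by (intro polys_over_closed(3)) auto
    ultimately show ?case
      unfolding e drinfeldD(3)[OF dr] drinfeldD(4)[OF dr] drinfeldD(2)[OF dr]
      by (intro polys_over_closed(5)[OF L(1)])
  qed
  then show ?thesis using dr by (simp add: drinfeld_def)
qed

section \<open>The \<open>j\<close>-invariant\<close>

definition jinv :: "('f, 'k) amodule \<Rightarrow> 'k" where
  "jinv \<phi> = coeff (\<phi> T) 1 ^ (q + 1) / coeff (\<phi> T) 2"

lemma Delta_nonzero: "drinfeld \<iota> UNIV \<phi> \<Longrightarrow> coeff (\<phi> T) 2 \<noteq> 0"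
  using drinfeldD(6)[of UNIV \<phi>] by (metis degree_0 leading_coeff_neq_0 zero_neq_numeral)

lemma module_T_eq:
  assumes "drinfeld \<iota> UNIV \<phi>"
  shows "\<phi> T = [:\<iota> T, coeff (\<phi> T) 1, coeff (\<phi> T) 2:]"
proof (rule poly_eqI)
  fix i :: nat
  consider "i = 0" | "i = 1" | "i = 2" | "2 < i" by linarith
  then show "coeff (\<phi> T) i = coeff [:\<iota> T, coeff (\<phi> T) 1, coeff (\<phi> T) 2:] i"
    by cases (use drinfeldD(5)[OF assms, of T] drinfeldD(6)[OF assms] in
        \<open>auto simp: coeff_eq_0 coeff_pCons numeral_2_eq_2 split: nat.splits\<close>)
qed

lemma coeff_const_skew: "coeff ([:c:] \<star> f) n = c * coeff f n"
  and coeff_skew_const: "coeff (f \<star> [:c:]) n = coeff f n * c ^ (q ^ n)"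
proof -
  have "coeff ([:c:] \<star> f) n = (\<Sum>i\<in>{0}. coeff [:c:] i * coeff f (n - i) ^ (q ^ i))"
    unfolding coeff_skew by (rule sum.mono_neutral_right) (auto simp: coeff_pCons split: nat.splits)
  then show "coeff ([:c:] \<star> f) n = c * coeff f n" by simp
  have "coeff (f \<star> [:c:]) n = (\<Sum>i\<in>{n}. coeff f i * coeff [:c:] (n - i) ^ (q ^ i))"
    unfolding coeff_skew
  proof (rule sum.mono_neutral_right)
    show "\<forall>i\<in>{..n} - {n}. coeff f i * coeff [:c:] (n - i) ^ (q ^ i) = 0"
    proof
      fix i assume "i \<in> {..n} - {n}"
      then have "coeff [:c:] (n - i) = 0" by (intro coeff_eq_0) auto
      then show "coeff f i * coeff [:c:] (n - i) ^ (q ^ i) = 0" using q_pow_pos[of i] by simp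
    qed
  qed auto
  then show "coeff (f \<star> [:c:]) n = coeff f n * c ^ (q ^ n)" by simp
qed

lemma iso_iff_T:
  assumes dr: "drinfeld \<iota> UNIV \<phi>" "drinfeld \<iota> UNIV \<psi>" and c: "c \<noteq> 0"
  shows "isogeny [:c:] \<phi> \<psi> \<longleftrightarrow>
    coeff (\<phi> T) 1 = coeff (\<psi> T) 1 * c ^ (q - 1) \<and> coeff (\<phi> T) 2 = coeff (\<psi> T) 2 * c ^ (q ^ 2 - 1)"
proof -
  have "isogeny [:c:] \<phi> \<psi> \<longleftrightarrow> [:c:] \<star> \<phi> T = \<psi> T \<star> [:c:]"
    using skew_commute_from_T[OF dr] c by (auto simp: isogeny_iff)
  also have "\<dots> \<longleftrightarrow> (\<forall>i. c * coeff (\<phi> T) i = coeff (\<psi> T) i * c ^ (q ^ i))"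
    by (simp add: poly_eq_iff coeff_const_skew coeff_skew_const)
  also have "\<dots> \<longleftrightarrow> (\<forall>i. coeff (\<phi> T) i = coeff (\<psi> T) i * c ^ (q ^ i - 1))"
  proof -
    have "c ^ (q ^ i) = c * c ^ (q ^ i - 1)" for i
      using q_pow_pos[of i] by (simp flip: power_Suc)
    then show ?thesis using c by (simp add: mult.left_commute)
  qed
  also have "\<dots> \<longleftrightarrow> (\<forall>i\<in>{1, 2}. coeff (\<phi> T) i = coeff (\<psi> T) i * c ^ (q ^ i - 1))"
  proof -
    have "coeff (\<phi> T) i = coeff (\<psi> T) i * c ^ (q ^ i - 1)" if "i \<notin> {1, 2}" for i
    proof (cases "i = 0")
      case True
      then show ?thesis using drinfeldD(5)[OF dr(1), of T] drinfeldD(5)[OF dr(2), of T] by simp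
    next
      case False
      then have "2 < i" using that by auto
      then show ?thesis using drinfeldD(6)[OF dr(1)] drinfeldD(6)[OF dr(2)] by (simp add: coeff_eq_0)
    qed
    then show ?thesis by blast
  qed
  finally show ?thesis by simp
qed

lemma q2_minus_1: "q ^ 2 - 1 = (q - 1) * (q + 1)"
  using q_gt_1 by (simp add: power2_eq_square algebra_simps)

lemma jinv_iso:
  assumes dr: "drinfeld \<iota> UNIV \<phi>" "drinfeld \<iota> UNIV \<psi>" and "isogeny [:c:] \<phi> \<psi>"
  shows "jinv \<phi> = jinv \<psi>"
proof -
  have c: "c \<noteq> 0" using assms(3) by (auto simp: isogeny_iff)
  define t where "t = c ^ (q - 1)"
  have g: "coeff (\<phi> T) 1 = coeff (\<psi> T) 1 * t" and D: "coeff (\<phi> T) 2 = coeff (\<psi> T) 2 * t ^ (q + 1)"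
    using iso_iff_T[OF dr c] assms(3) unfolding t_def power_mult[symmetric] q2_minus_1 by blast+
  have "t ^ (q + 1) \<noteq> 0" using c by (simp add: t_def)
  then show ?thesis
    unfolding jinv_def g D power_mult_distrib by (rule mult_divide_mult_cancel_right)
qed

text \<open>If the coefficients \<open>g, g'\<close> of \<open>\<tau>\<close> are non-zero, a root \<open>c\<close> of \<open>c\<^sup>q\<^sup>-\<^sup>1 = g/g'\<close> works, because
  \<open>q\<^sup>2 - 1 = (q - 1)(q + 1)\<close>.  If they vanish, only the leading coefficients have to be matched.\<close>

lemma jinv_eq_imp_iso:
  assumes dr: "drinfeld \<iota> UNIV \<phi>" "drinfeld \<iota> UNIV \<psi>" and j: "jinv \<phi> = jinv \<psi>"
  obtains c where "c \<noteq> 0" "isogeny [:c:] \<phi> \<psi>"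
proof -
  let ?g = "coeff (\<phi> T) 1" and ?D = "coeff (\<phi> T) 2" and ?g' = "coeff (\<psi> T) 1" and ?D' = "coeff (\<psi> T) 2"
  have D: "?D \<noteq> 0" "?D' \<noteq> 0" using Delta_nonzero dr by auto
  have j': "?g ^ (q + 1) * ?D' = ?g' ^ (q + 1) * ?D" using j D by (simp add: jinv_def frac_eq_eq)
  have q1: "0 < q - 1" using q_gt_1 by simp
  then have q2: "0 < q ^ 2 - 1" unfolding q2_minus_1 by simp
  have "\<exists>c. c \<noteq> 0 \<and> ?g = ?g' * c ^ (q - 1) \<and> ?D = ?D' * c ^ (q ^ 2 - 1)"
  proof (cases "?g' = 0")
    case True
    have "?g ^ (q + 1) * ?D' = 0" unfolding j' True by simp
    then have "?g = 0" using D(2) by (simp only: mult_eq_0_iff power_eq_0_iff) blast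
    obtain c where c: "c ^ (q ^ 2 - 1) = ?D / ?D'" using nth_root_exists[OF q2] by blast
    then have "c \<noteq> 0" using D q2 by (metis divide_eq_0_iff zero_power)
    then show ?thesis using c D True \<open>?g = 0\<close> by (intro exI[of _ c]) simp
  next
    case False
    then have "?g ^ (q + 1) * ?D' \<noteq> 0" unfolding j' using D(1) by simp
    then have g: "?g \<noteq> 0" by auto
    obtain c where c: "c ^ (q - 1) = ?g / ?g'" using nth_root_exists[OF q1] by blast
    then have "c \<noteq> 0" using g False q1 by (metis divide_eq_0_iff zero_power)
    moreover have "?D = ?D' * c ^ (q ^ 2 - 1)"
      
    proof -
      have "?D' * (?g / ?g') ^ (q + 1) = (?g ^ (q + 1) * ?D') / ?g' ^ (q + 1)"
        by (simp only: power_divide times_divide_eq_right mult.commute)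
      also have "\<dots> = ?D" unfolding j' using False by simp
      finally show ?thesis unfolding q2_minus_1 power_mult c ..
    qed
    ultimately show ?thesis using c False by (intro exI[of _ c]) simp
  qed
  then show ?thesis using that iso_iff_T[OF dr] by blast
qed

end

section \<open>The Atkin-Lehner involutions\<close>

locale AL_base = A_base \<iota> q
  for \<iota> :: "'f::{finite,field} poly \<Rightarrow> 'k::alg_closed_field" and q :: nat +
  fixes \<nn> :: "'f poly set" and \<nu> :: "'f poly"
  assumes \<nn>: "\<nn> = {a. \<nu> dvd a}" and \<nu>: "\<nu> \<noteq> 0"
begin

subsection \<open>Idempotents modulo \<open>\<nu>\<close>\<close>

definition idem :: "'f poly \<Rightarrow> bool" where "idem e \<longleftrightarrow> \<nu> dvd e * e - e"

text \<open>The sum in the Boolean ring of idempotents, i.e. the symmetric difference.\<close>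

definition sdiff :: "'f poly \<Rightarrow> 'f poly \<Rightarrow> 'f poly" where "sdiff d e = d + e - 2 * d * e"

text \<open>For an idempotent \<open>e\<close> this is the ideal \<open>(1 - e) A + \<nn>\<close>, the annihilator of the summand
  \<open>e (A/\<nn>)\<close>.\<close>

definition comp_ideal :: "'f poly \<Rightarrow> 'f poly set" where "comp_ideal e = {a. \<nu> dvd a * e}"

abbreviation AL :: "'f poly \<Rightarrow> ('f, 'k) pt set \<Rightarrow> ('f, 'k) pt set" where
  "AL e \<equiv> atkin_lehner \<iota> \<nn> (comp_ideal e) (comp_ideal (1 - e))"

lemma idem_orth: "idem e \<Longrightarrow> \<nu> dvd (1 - e) * e" "idem e \<Longrightarrow> \<nu> dvd e * (1 - e)"
proof -
  have "(1 - e) * e = - (e * e - e)" "e * (1 - e) = - (e * e - e)" by (simp_all add: algebra_simps)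
  then show "idem e \<Longrightarrow> \<nu> dvd (1 - e) * e" "idem e \<Longrightarrow> \<nu> dvd e * (1 - e)"
    by (simp_all only: idem_def dvd_minus_iff)
qed

lemma idem_compl: "idem e \<Longrightarrow> idem (1 - e)"
proof -
  have "(1 - e) * (1 - e) - (1 - e) = e * e - e" by (simp add: algebra_simps)
  then show "idem e \<Longrightarrow> idem (1 - e)" by (simp only: idem_def)
qed

lemma idem_mult: "idem d \<Longrightarrow> idem e \<Longrightarrow> idem (d * e)"
proof -
  assume "idem d" "idem e"
  moreover have "d * e * (d * e) - d * e = (d * d - d) * (e * e) + d * (e * e - e)"
    by (simp add: algebra_simps)
  ultimately show ?thesis by (simp only: idem_def) (intro dvd_add dvd_mult dvd_mult2)
qed

lemma idem_sdiff: "idem d \<Longrightarrow> idem e \<Longrightarrow> idem (sdiff d e)"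
proof -
  assume "idem d" "idem e"
  moreover have "sdiff d e * sdiff d e - sdiff d e
    = (d * d - d) + (e * e - e) + 4 * (d * d - d) * (e * e - e)"
    by (simp add: sdiff_def algebra_simps)
  ultimately show ?thesis by (simp only: idem_def) (intro dvd_add dvd_mult dvd_mult2)
qed

lemma sdiff_commute: "sdiff d e = sdiff e d"
  and sdiff_assoc: "sdiff (sdiff d e) f = sdiff d (sdiff e f)"
  by (simp_all add: sdiff_def algebra_simps)

lemma idem_mod: "idem (e mod \<nu>) \<longleftrightarrow> idem e"
proof -
  have expand: "(k * \<nu> + r) * (k * \<nu> + r) - (k * \<nu> + r)
      = \<nu> * (k * k * \<nu> + 2 * k * r - k) + (r * r - r)" for k r
    by (simp add: algebra_simps)
  let ?r = "e mod \<nu>" and ?k = "e div \<nu>"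
  have "e * e - e = \<nu> * (?k * ?k * \<nu> + 2 * ?k * ?r - ?k) + (?r * ?r - ?r)"
    using expand[of ?k ?r] by (simp only: div_mult_mod_eq)
  then show ?thesis unfolding idem_def by (simp only: dvd_add_right_iff dvd_triv_left)
qed

lemma comp_ideal_cong:
  assumes "\<nu> dvd d - e"
  shows "comp_ideal d = comp_ideal e"
proof -
  have "\<nu> dvd a * d - a * e" for a using assms by (simp flip: right_diff_distrib)
  then have "\<nu> dvd a * d \<longleftrightarrow> \<nu> dvd a * e" for a
    by (metis diff_add_cancel dvd_add_right_iff)
  then show ?thesis by (simp add: comp_ideal_def)
qed


lemma is_ideal_comp_ideal: "is_ideal (comp_ideal e)"
  by (simp add: is_ideal_def comp_ideal_def distrib_right mult.assoc)

lemma in_comp_ideal: "a \<in> comp_ideal e \<longleftrightarrow> \<nu> dvd a * e"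
  by (simp add: comp_ideal_def)

lemma is_ideal_nn: "is_ideal \<nn>"
  by (simp add: is_ideal_def \<nn>)

lemma exact_factors_idem:
  assumes e: "idem e"
  shows "exact_factors \<nn> (comp_ideal e) (comp_ideal (1 - e))"
  unfolding exact_factors_def
proof (intro conjI is_ideal_comp_ideal)
  show "coprime_ideals (comp_ideal e) (comp_ideal (1 - e))"
    unfolding coprime_ideals_def
  proof (rule UNIV_eq_I[symmetric])
    fix a
    have "a * (1 - e) \<in> comp_ideal e" "a * e \<in> comp_ideal (1 - e)"
      using idem_orth[OF e] by (simp_all add: in_comp_ideal mult.assoc)
    then have "a * (1 - e) + a * e \<in> comp_ideal e + comp_ideal (1 - e)" by (rule set_plus_intro)
    moreover have "a * (1 - e) + a * e = a" by (simp add: algebra_simps)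
    ultimately show "a \<in> comp_ideal e + comp_ideal (1 - e)" by simp
  qed
  have "x * y \<in> \<nn>" if "x \<in> comp_ideal e" "y \<in> comp_ideal (1 - e)" for x y
  proof -
    have "x * y = (x * e) * y + x * (y * (1 - e))" by (simp add: algebra_simps)
    moreover have "\<nu> dvd (x * e) * y + x * (y * (1 - e))"
      using that by (intro dvd_add) (simp_all add: in_comp_ideal)
    ultimately show ?thesis by (simp add: \<nn>)
  qed
  then have "ideal_prod (comp_ideal e) (comp_ideal (1 - e)) \<subseteq> \<nn>"
    unfolding ideal_prod_def using is_ideal_nn by (intro Inter_lower) simp
  moreover have "\<nn> \<subseteq> L" if L: "is_ideal L" "\<forall>x\<in>comp_ideal e. \<forall>y\<in>comp_ideal (1 - e). x * y \<in> L" for L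
  proof
    fix s assume "s \<in> \<nn>"
    then have "s \<in> comp_ideal e" "s \<in> comp_ideal (1 - e)" by (simp_all add: \<nn> in_comp_ideal)
    moreover have "e \<in> comp_ideal (1 - e)" "1 - e \<in> comp_ideal e"
      using idem_orth[OF e] by (simp_all add: in_comp_ideal)
    ultimately have "s * e \<in> L" "(1 - e) * s \<in> L" using L(2) by blast+
    then have "s * e + (1 - e) * s \<in> L" by (rule is_idealD(2)[OF L(1)])
    moreover have "s * e + (1 - e) * s = s" by (simp add: algebra_simps)
    ultimately show "s \<in> L" by simp
  qed
  then have "\<nn> \<subseteq> ideal_prod (comp_ideal e) (comp_ideal (1 - e))"
    unfolding ideal_prod_def by (intro Inter_greatest) blast
  ultimately show "ideal_prod (comp_ideal e) (comp_ideal (1 - e)) = \<nn>" by (rule antisym)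
qed

text \<open>Writing \<open>1 = u + v\<close> with \<open>u \<in> \<mm>\<close> and \<open>v \<in> \<mm>'\<close>, the product \<open>u v\<close> lies in \<open>\<nn>\<close>, so \<open>v\<close> is
  idempotent modulo \<open>\<nn>\<close>.\<close>

lemma exact_factors_imp_idem:
  assumes "exact_factors \<nn> \<mm> \<mm>'"
  obtains e where "idem e" "e mod \<nu> = e" "\<mm> = comp_ideal e" "\<mm>' = comp_ideal (1 - e)"
proof -
  have I: "is_ideal \<mm>" "is_ideal \<mm>'" "\<mm> + \<mm>' = UNIV" "ideal_prod \<mm> \<mm>' = \<nn>"
    using assms by (simp_all add: exact_factors_def coprime_ideals_def)
  have prod: "x * y \<in> \<nn>" if "x \<in> \<mm>" "y \<in> \<mm>'" for x y
    unfolding I(4)[symmetric] ideal_prod_def using that by blast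
  have "1 \<in> \<mm> + \<mm>'" using I(3) by simp
  then obtain u v where uv: "u \<in> \<mm>" "v \<in> \<mm>'" "1 = u + v" by (rule set_plus_elim)
  have "is_ideal (\<mm> \<inter> \<mm>')" using I(1,2) by (auto simp: is_ideal_def)
  moreover have "\<forall>x\<in>\<mm>. \<forall>y\<in>\<mm>'. x * y \<in> \<mm> \<inter> \<mm>'" using is_idealD(4)[OF I(1)] is_idealD(3)[OF I(2)] by blast
  ultimately have sub: "\<nn> \<subseteq> \<mm> \<inter> \<mm>'"
    unfolding I(4)[symmetric] ideal_prod_def by (intro Inter_lower) simp
  have u: "u = 1 - v" using uv(3) by (simp add: eq_diff_eq)
  have "u * v \<in> \<nn>" by (rule prod[OF uv(1,2)])
  moreover have "v * v - v = - (u * v)" by (simp add: u algebra_simps)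
  ultimately have idv: "idem v" by (simp add: idem_def \<nn>)
  have mm: "\<mm> = comp_ideal v"
  proof (intro equalityI subsetI)
    show "x \<in> comp_ideal v" if "x \<in> \<mm>" for x using prod[OF that uv(2)] by (simp add: in_comp_ideal \<nn>)
    fix x assume "x \<in> comp_ideal v"
    then have "x * v \<in> \<nn>" by (simp add: in_comp_ideal \<nn>)
    then have "x * u + x * v \<in> \<mm>" using sub is_idealD(2,3)[OF I(1)] uv(1) by blast
    then show "x \<in> \<mm>" by (simp add: u algebra_simps)
  qed
  have mm': "\<mm>' = comp_ideal (1 - v)"
  proof (intro equalityI subsetI)
    show "x \<in> comp_ideal (1 - v)" if "x \<in> \<mm>'" for x
      using prod[OF uv(1) that] by (simp add: in_comp_ideal \<nn> u mult.commute)
    fix x assume "x \<in> comp_ideal (1 - v)"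
    then have "x * u \<in> \<nn>" by (simp add: in_comp_ideal \<nn> u)
    then have "x * v + x * u \<in> \<mm>'" using sub is_idealD(2,3)[OF I(2)] uv(2) by blast
    then show "x \<in> \<mm>'" by (simp add: u algebra_simps)
  qed
  have "comp_ideal (v mod \<nu>) = comp_ideal v" "comp_ideal (1 - v mod \<nu>) = comp_ideal (1 - v)"
    by (rule comp_ideal_cong; simp add: mod_eq_dvd_iff[symmetric] mod_diff_right_eq)+
  then show ?thesis using that[of "v mod \<nu>"] idv idem_mod mm mm' by simp
qed

lemma AL_group_eq: "AL_group \<iota> \<nn> = {AL e | e. idem e \<and> e mod \<nu> = e}"
proof (intro equalityI subsetI)
  fix w assume "w \<in> AL_group \<iota> \<nn>"
  then obtain \<mm> \<mm>' where w: "w = atkin_lehner \<iota> \<nn> \<mm> \<mm>'" "exact_factors \<nn> \<mm> \<mm>'"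
    unfolding AL_group_def by blast
  obtain e where "idem e" "e mod \<nu> = e" "\<mm> = comp_ideal e" "\<mm>' = comp_ideal (1 - e)"
    using w(2) by (rule exact_factors_imp_idem)
  then show "w \<in> {AL e | e. idem e \<and> e mod \<nu> = e}" using w(1) by blast
next
  fix w assume "w \<in> {AL e | e. idem e \<and> e mod \<nu> = e}"
  then show "w \<in> AL_group \<iota> \<nn>" unfolding AL_group_def using exact_factors_idem by blast
qed

lemma AL_mod: "AL (e mod \<nu>) = AL e"
proof -
  have "comp_ideal (e mod \<nu>) = comp_ideal e" "comp_ideal (1 - e mod \<nu>) = comp_ideal (1 - e)"
    by (rule comp_ideal_cong; simp add: mod_eq_dvd_iff[symmetric] mod_diff_right_eq)+
  then show ?thesis by simp
qed

subsection \<open>Pairs\<close>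

lemma pairs_iff:
  "(\<phi>, \<Lambda>) \<in> pairs \<iota> \<nn> \<longleftrightarrow>
     drinfeld \<iota> UNIV \<phi> \<and> finite \<Lambda> \<and> (\<exists>l. \<Lambda> = span1 \<phi> l \<and> ann \<phi> l = \<nn>)"
  unfolding pairs_def using cyclic_kernel_iff[OF _ is_ideal_nn] by auto

lemma pair_iso_iff:
  "((\<phi>, \<Lambda>), (\<phi>', \<Lambda>')) \<in> pair_iso \<iota> \<nn> \<longleftrightarrow> (\<phi>, \<Lambda>) \<in> pairs \<iota> \<nn> \<and> (\<phi>', \<Lambda>') \<in> pairs \<iota> \<nn> \<and>
     (\<exists>c. c \<noteq> 0 \<and> isogeny [:c:] \<phi> \<phi>' \<and> ev [:c:] ` \<Lambda> = \<Lambda>')"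
  by (simp add: pair_iso_def q_card)

lemma iso_inverse:
  assumes "c \<noteq> 0" "isogeny [:c:] (\<phi> :: ('f, 'k) amodule) \<psi>"
  shows "isogeny [:inverse c:] \<psi> \<phi>"
proof -
  have inv: "[:inverse c:] \<star> [:c:] = 1" "[:c:] \<star> [:inverse c:] = 1"
    by (rule ev_inject, simp add: ev_mult assms(1))+
  have "[:inverse c:] \<star> \<psi> a = \<phi> a \<star> [:inverse c:]" for a
  proof -
    have "[:inverse c:] \<star> \<psi> a = [:inverse c:] \<star> (\<psi> a \<star> [:c:]) \<star> [:inverse c:]"
      by (simp add: skew_assoc inv)
    also have "\<dots> = [:inverse c:] \<star> ([:c:] \<star> \<phi> a) \<star> [:inverse c:]"
      using assms(2) by (simp add: isogeny_iff)
    also have "\<dots> = \<phi> a \<star> [:inverse c:]" by (simp add: inv flip: skew_assoc)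
    finally show ?thesis .
  qed
  then show ?thesis using assms(1) by (simp add: isogeny_iff)
qed

lemma equiv_pair_iso: "equiv (pairs \<iota> \<nn>) (pair_iso \<iota> \<nn>)"
proof (rule equivI)
  show "pair_iso \<iota> \<nn> \<subseteq> pairs \<iota> \<nn> \<times> pairs \<iota> \<nn>" by (auto simp: pair_iso_def)
  show "refl_on (pairs \<iota> \<nn>) (pair_iso \<iota> \<nn>)"
  proof (rule refl_onI)
    fix p assume p: "p \<in> pairs \<iota> \<nn>"
    obtain \<phi> \<Lambda> where e: "p = (\<phi>, \<Lambda>)" by (cases p)
    have "isogeny [:1:] \<phi> \<phi>" unfolding isogeny_iff by (simp flip: one_pCons)
    moreover have "ev [:1:] ` \<Lambda> = \<Lambda>" by simp
    ultimately have "\<exists>c. c \<noteq> 0 \<and> isogeny [:c:] \<phi> \<phi> \<and> ev [:c:] ` \<Lambda> = \<Lambda>"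
      using zero_neq_one by metis
    then show "(p, p) \<in> pair_iso \<iota> \<nn>" using p unfolding e pair_iso_iff by blast
  qed
  show "Relation.sym (pair_iso \<iota> \<nn>)"
  proof (rule symI)
    fix p p' assume p: "(p, p') \<in> pair_iso \<iota> \<nn>"
    obtain \<phi> \<Lambda> \<phi>' \<Lambda>' where e: "p = (\<phi>, \<Lambda>)" "p' = (\<phi>', \<Lambda>')" by (metis surj_pair)
    obtain c where c: "c \<noteq> 0" "isogeny [:c:] \<phi> \<phi>'" "ev [:c:] ` \<Lambda> = \<Lambda>'"
      using p unfolding e pair_iso_iff by blast
    have "ev [:inverse c:] ` \<Lambda>' = \<Lambda>" using c(1) by (simp add: image_image flip: c(3) mult.assoc)
    then show "(p', p) \<in> pair_iso \<iota> \<nn>"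
      using p iso_inverse[OF c(1,2)] c(1) unfolding e pair_iso_iff
      by (metis inverse_nonzero_iff_nonzero)
  qed
  show "trans (pair_iso \<iota> \<nn>)"
  proof (rule transI)
    fix p p' p'' assume p: "(p, p') \<in> pair_iso \<iota> \<nn>" "(p', p'') \<in> pair_iso \<iota> \<nn>"
    obtain \<phi> \<Lambda> \<phi>' \<Lambda>' \<phi>'' \<Lambda>'' where e: "p = (\<phi>, \<Lambda>)" "p' = (\<phi>', \<Lambda>')" "p'' = (\<phi>'', \<Lambda>'')"
      by (metis surj_pair)
    obtain c where c: "c \<noteq> 0" "isogeny [:c:] \<phi> \<phi>'" "ev [:c:] ` \<Lambda> = \<Lambda>'"
      using p(1) unfolding e pair_iso_iff by blast
    obtain d where d: "d \<noteq> 0" "isogeny [:d:] \<phi>' \<phi>''" "ev [:d:] ` \<Lambda>' = \<Lambda>''"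
      using p(2) unfolding e pair_iso_iff by blast
    have dc: "[:d:] \<star> [:c:] = [:d * c:]" by (rule ev_inject) (simp add: ev_mult mult.assoc)
    have "isogeny [:d * c:] \<phi> \<phi>''" using isogeny_comp[OF c(2) d(2)] unfolding dc .
    moreover have "ev [:d * c:] ` \<Lambda> = \<Lambda>''"
      unfolding dc[symmetric] d(3)[symmetric] c(3)[symmetric] image_image ev_mult ..
    moreover have "d * c \<noteq> 0" using c(1) d(1) by simp
    ultimately show "(p, p'') \<in> pair_iso \<iota> \<nn>"
      using p unfolding e pair_iso_iff by blast
  qed
qed

lemma Y0_D:
  assumes "x \<in> Y0 \<iota> \<nn>"
  shows "x \<subseteq> pairs \<iota> \<nn>" "p \<in> x \<Longrightarrow> x = pair_iso \<iota> \<nn> `` {p}" "x \<noteq> {}"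
    "p \<in> x \<Longrightarrow> p' \<in> x \<longleftrightarrow> (p, p') \<in> pair_iso \<iota> \<nn>"
proof -
  note E = equiv_pair_iso
  have x: "x \<in> pairs \<iota> \<nn> // pair_iso \<iota> \<nn>" using assms by (simp add: Y0_def)
  show "x \<subseteq> pairs \<iota> \<nn>" using in_quotient_imp_subset[OF E x] .
  show "x \<noteq> {}" using in_quotient_imp_non_empty[OF E x] .
  show cl: "x = pair_iso \<iota> \<nn> `` {p}" if "p \<in> x"
  proof -
    obtain a where a: "x = pair_iso \<iota> \<nn> `` {a}" using x by (rule quotientE)
    then have "(a, p) \<in> pair_iso \<iota> \<nn>" using that by simp
    then show ?thesis unfolding a by (rule equiv_class_eq[OF E])
  qed
  show "p' \<in> x \<longleftrightarrow> (p, p') \<in> pair_iso \<iota> \<nn>" if "p \<in> x" using cl[OF that] by blast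
qed

lemma Y0_class: "p \<in> pairs \<iota> \<nn> \<Longrightarrow> pair_iso \<iota> \<nn> `` {p} \<in> Y0 \<iota> \<nn>"
  by (simp add: Y0_def quotientI)

lemma class_self: "p \<in> pairs \<iota> \<nn> \<Longrightarrow> p \<in> pair_iso \<iota> \<nn> `` {p}"
  using equiv_class_self[OF equiv_pair_iso] .


subsection \<open>The image pair\<close>

definition AL_ker :: "('f, 'k) amodule \<Rightarrow> 'k set \<Rightarrow> 'f poly \<Rightarrow> 'k set" where
  "AL_ker \<phi> \<Lambda> e = ev (\<phi> e) ` \<Lambda>"

text \<open>This is \<open>\<phi>[\<mm>] + (1 - e)\<Lambda>\<close> for \<open>\<mm> = comp_ideal e\<close>.\<close>

definition AL_sub :: "('f, 'k) amodule \<Rightarrow> 'k set \<Rightarrow> 'f poly \<Rightarrow> 'k set" where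
  "AL_sub \<phi> \<Lambda> e = {z. ev (\<phi> \<nu>) z = 0 \<and> ev (\<phi> (1 - e)) z \<in> \<Lambda>}"

context
  fixes \<phi> \<Lambda>
  assumes p: "(\<phi>, \<Lambda>) \<in> pairs \<iota> \<nn>"
begin

lemma pair_drinfeld: "drinfeld \<iota> UNIV \<phi>"
  using p by (simp add: pairs_iff)

lemma Lambda_gen: obtains l where "\<Lambda> = span1 \<phi> l" "ann \<phi> l = \<nn>"
  using p by (auto simp: pairs_iff)

lemma Lambda_submodule: "fin_submodule \<phi> \<Lambda>"
  using p fin_submodule_span1[OF pair_drinfeld] by (auto simp: pairs_iff)

lemmas Lambda_D = fin_submoduleD[OF pair_drinfeld Lambda_submodule]

lemma Lambda_torsion: "z \<in> \<Lambda> \<Longrightarrow> ev (\<phi> \<nu>) z = 0"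
proof -
  assume z: "z \<in> \<Lambda>"
  obtain l where l: "\<Lambda> = span1 \<phi> l" "ann \<phi> l = \<nn>" by (rule Lambda_gen)
  obtain a where a: "z = ev (\<phi> a) l" using z l(1) by (auto simp: span1_def)
  have "\<nu> \<in> ann \<phi> l" using l(2) by (simp add: \<nn>)
  then show ?thesis by (simp add: a act_commute[OF pair_drinfeld, of \<nu>] ann_def)
qed

lemma act_cong: "ev (\<phi> \<nu>) z = 0 \<Longrightarrow> \<nu> dvd a - b \<Longrightarrow> ev (\<phi> a) z = ev (\<phi> b) z"
  using act_dvd[OF pair_drinfeld, of \<nu> "a - b" z] act_diff[OF pair_drinfeld, of a b z] by simp

lemma act_vanish: "ev (\<phi> \<nu>) z = 0 \<Longrightarrow> \<nu> dvd a \<Longrightarrow> ev (\<phi> a) z = 0"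
  using act_dvd[OF pair_drinfeld] by blast

lemma act_idem: "ev (\<phi> \<nu>) z = 0 \<Longrightarrow> idem e \<Longrightarrow> ev (\<phi> e) (ev (\<phi> e) z) = ev (\<phi> e) z"
  using act_cong[of z "e * e" e] by (simp add: idem_def act_mult[OF pair_drinfeld])

lemma act_orth:
  assumes "ev (\<phi> \<nu>) z = 0" "idem e"
  shows "ev (\<phi> (1 - e)) (ev (\<phi> e) z) = 0" "ev (\<phi> e) (ev (\<phi> (1 - e)) z) = 0"
  using act_vanish[OF assms(1) idem_orth(1)[OF assms(2)]] act_vanish[OF assms(1) idem_orth(2)[OF assms(2)]]
  by (simp_all add: act_mult[OF pair_drinfeld])

lemma act_compl: "ev (\<phi> (1 - e)) z = z - ev (\<phi> e) z"
  by (simp add: act_diff[OF pair_drinfeld] act_1[OF pair_drinfeld])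

lemma act_torsion: "ev (\<phi> \<nu>) z = 0 \<Longrightarrow> ev (\<phi> \<nu>) (ev (\<phi> a) z) = 0"
  by (simp add: act_commute[OF pair_drinfeld, of \<nu>])

lemma torsion_comp_ideal:
  assumes e: "idem e"
  shows "z \<in> torsion \<phi> (comp_ideal e) \<longleftrightarrow> ev (\<phi> \<nu>) z = 0 \<and> ev (\<phi> e) z = z"
proof
  assume z: "z \<in> torsion \<phi> (comp_ideal e)"
  have "\<nu> \<in> comp_ideal e" "1 - e \<in> comp_ideal e" using idem_orth[OF e] by (simp_all add: in_comp_ideal)
  then have "ev (\<phi> \<nu>) z = 0" "ev (\<phi> (1 - e)) z = 0" using z unfolding torsion_ev by blast+
  then show "ev (\<phi> \<nu>) z = 0 \<and> ev (\<phi> e) z = z" by (simp add: act_compl)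
next
  assume z: "ev (\<phi> \<nu>) z = 0 \<and> ev (\<phi> e) z = z"
  have "ev (\<phi> a) z = 0" if "a \<in> comp_ideal e" for a
  proof -
    have "ev (\<phi> (a * e)) z = 0" using act_vanish z that by (simp add: in_comp_ideal)
    then show ?thesis using z by (simp add: act_mult[OF pair_drinfeld])
  qed
  then show "z \<in> torsion \<phi> (comp_ideal e)" unfolding torsion_ev by blast
qed

lemma AL_ker_eq:
  assumes e: "idem e"
  shows "AL_ker \<phi> \<Lambda> e = {z \<in> \<Lambda>. ev (\<phi> e) z = z}"
  unfolding AL_ker_def
proof (intro equalityI subsetI)
  fix z assume "z \<in> ev (\<phi> e) ` \<Lambda>"
  then obtain m where "m \<in> \<Lambda>" "z = ev (\<phi> e) m" by (rule imageE)
  then show "z \<in> {z \<in> \<Lambda>. ev (\<phi> e) z = z}"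
    using act_idem[OF Lambda_torsion e] Lambda_D(4) by simp
next
  fix z assume "z \<in> {z \<in> \<Lambda>. ev (\<phi> e) z = z}"
  then have "z \<in> \<Lambda>" "z = ev (\<phi> e) z" by simp_all
  then show "z \<in> ev (\<phi> e) ` \<Lambda>" by (rule rev_image_eqI)
qed

lemma AL_ker_torsion: "idem e \<Longrightarrow> AL_ker \<phi> \<Lambda> e = \<Lambda> \<inter> torsion \<phi> (comp_ideal e)"
  using torsion_comp_ideal Lambda_torsion by (auto simp: AL_ker_eq)

lemma AL_ker_cyclic:
  assumes e: "idem e"
  obtains l where "AL_ker \<phi> \<Lambda> e = span1 \<phi> l" "ann \<phi> l = comp_ideal e"
proof -
  obtain l where l: "\<Lambda> = span1 \<phi> l" "ann \<phi> l = \<nn>" by (rule Lambda_gen)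
  have "AL_ker \<phi> \<Lambda> e = span1 \<phi> (ev (\<phi> e) l)"
    unfolding AL_ker_def l(1) span1_def image_image
    by (intro image_cong refl) (rule act_commute[OF pair_drinfeld])
  moreover have "ann \<phi> (ev (\<phi> e) l) = comp_ideal e"
    unfolding ann_def act_mult[OF pair_drinfeld, symmetric] comp_ideal_def
    using l(2) by (auto simp: ann_def \<nn> set_eq_iff)
  ultimately show ?thesis by (rule that)
qed

lemma AL_ker_cyclic_kernel: "idem e \<Longrightarrow> cyclic_kernel \<phi> (comp_ideal e) (AL_ker \<phi> \<Lambda> e)"
proof -
  assume e: "idem e"
  obtain l where "AL_ker \<phi> \<Lambda> e = span1 \<phi> l" "ann \<phi> l = comp_ideal e" by (rule AL_ker_cyclic[OF e])
  moreover have "finite (AL_ker \<phi> \<Lambda> e)" unfolding AL_ker_def using Lambda_D(1) by simp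
  ultimately show ?thesis unfolding cyclic_kernel_iff[OF pair_drinfeld is_ideal_comp_ideal] by blast
qed

lemma AL_ker_submodule: "idem e \<Longrightarrow> fin_submodule \<phi> (AL_ker \<phi> \<Lambda> e)"
  using AL_ker_cyclic_kernel by (simp add: fin_submodule_iff cyclic_kernel_def)

lemma AL_ker_sum:
  assumes e: "idem e"
  shows "\<Lambda> = AL_ker \<phi> \<Lambda> e + AL_ker \<phi> \<Lambda> (1 - e)" "AL_ker \<phi> \<Lambda> e \<inter> AL_ker \<phi> \<Lambda> (1 - e) = {0}"
proof -
  show "\<Lambda> = AL_ker \<phi> \<Lambda> e + AL_ker \<phi> \<Lambda> (1 - e)"
  proof (intro equalityI subsetI)
    fix z assume z: "z \<in> \<Lambda>"
    have "ev (\<phi> e) z + ev (\<phi> (1 - e)) z \<in> AL_ker \<phi> \<Lambda> e + AL_ker \<phi> \<Lambda> (1 - e)"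
      unfolding AL_ker_def using z by (intro set_plus_intro imageI)
    then show "z \<in> AL_ker \<phi> \<Lambda> e + AL_ker \<phi> \<Lambda> (1 - e)" by (simp add: act_compl)
  next
    fix z assume "z \<in> AL_ker \<phi> \<Lambda> e + AL_ker \<phi> \<Lambda> (1 - e)"
    then obtain a b where "z = a + b" "a \<in> AL_ker \<phi> \<Lambda> e" "b \<in> AL_ker \<phi> \<Lambda> (1 - e)"
      by (rule set_plus_elim)
    then show "z \<in> \<Lambda>" using Lambda_D(3) by (simp add: AL_ker_eq e idem_compl)
  qed
  show "AL_ker \<phi> \<Lambda> e \<inter> AL_ker \<phi> \<Lambda> (1 - e) = {0}"
    using Lambda_D(2) by (auto simp: AL_ker_eq e idem_compl act_compl)
qed

text \<open>The idempotent \<open>e\<close> acts as the identity on the first summand and as zero on the second.\<close>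

lemma AL_ker_unique:
  assumes e: "idem e" and \<Lambda>1: "cyclic_kernel \<phi> (comp_ideal e) \<Lambda>\<^sub>1"
    and \<Lambda>2: "cyclic_kernel \<phi> (comp_ideal (1 - e)) \<Lambda>\<^sub>2" and sum: "\<Lambda> = \<Lambda>\<^sub>1 + \<Lambda>\<^sub>2"
  shows "\<Lambda>\<^sub>1 = AL_ker \<phi> \<Lambda> e" "\<Lambda>\<^sub>2 = AL_ker \<phi> \<Lambda> (1 - e)"
proof -
  have sub: "0 \<in> N \<and> N \<subseteq> torsion \<phi> (comp_ideal f)" if N: "cyclic_kernel \<phi> (comp_ideal f) N" for N f
  proof -
    obtain l where l: "N = span1 \<phi> l" "ann \<phi> l = comp_ideal f"
      using N unfolding cyclic_kernel_iff[OF pair_drinfeld is_ideal_comp_ideal] by blast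
    have "ev (\<phi> a) z = 0" if "z \<in> N" "a \<in> comp_ideal f" for z a
    proof -
      obtain b where "z = ev (\<phi> b) l" using \<open>z \<in> N\<close> l(1) by (auto simp: span1_def)
      moreover have "a \<in> ann \<phi> l" using that(2) l(2) by simp
      ultimately show ?thesis by (simp add: ann_def act_commute[OF pair_drinfeld, of a])
    qed
    moreover have "0 \<in> N" using N by (simp add: cyclic_kernel_def submodule_def)
    ultimately show ?thesis unfolding torsion_ev by blast
  qed
  have z1: "ev (\<phi> e) z = z" "ev (\<phi> (1 - e)) z = 0" if "z \<in> \<Lambda>\<^sub>1" for z
    using sub[OF \<Lambda>1] that torsion_comp_ideal[OF e, of z] by (auto simp: act_compl)
  have z2: "ev (\<phi> (1 - e)) z = z" "ev (\<phi> e) z = 0" if "z \<in> \<Lambda>\<^sub>2" for z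
    using sub[OF \<Lambda>2] that torsion_comp_ideal[OF idem_compl[OF e], of z] by (auto simp: act_compl)
  have in1: "z \<in> \<Lambda>" if "z \<in> \<Lambda>\<^sub>1" for z
    using set_plus_intro[OF that, of 0 \<Lambda>\<^sub>2] sub[OF \<Lambda>2] sum by simp
  have in2: "z \<in> \<Lambda>" if "z \<in> \<Lambda>\<^sub>2" for z
    using set_plus_intro[OF _ that, of 0 \<Lambda>\<^sub>1] sub[OF \<Lambda>1] sum by simp
  have dec: "ev (\<phi> e) z \<in> \<Lambda>\<^sub>1 \<and> ev (\<phi> (1 - e)) z \<in> \<Lambda>\<^sub>2" if "z \<in> \<Lambda>" for z
  proof -
    have "z \<in> \<Lambda>\<^sub>1 + \<Lambda>\<^sub>2" using that sum by simp
    then obtain a b where "z = a + b" "a \<in> \<Lambda>\<^sub>1" "b \<in> \<Lambda>\<^sub>2" by (rule set_plus_elim)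
    then show ?thesis by (simp add: ev_add z1 z2)
  qed
  show "\<Lambda>\<^sub>1 = AL_ker \<phi> \<Lambda> e"
    unfolding AL_ker_def using dec in1 z1(1) by (metis image_eqI image_subsetI subsetI subset_antisym)
  show "\<Lambda>\<^sub>2 = AL_ker \<phi> \<Lambda> (1 - e)"
    unfolding AL_ker_def using dec in2 z2(1) by (metis image_eqI image_subsetI subsetI subset_antisym)
qed

lemma AL_sub_eq:
  assumes e: "idem e"
  shows "torsion \<phi> (comp_ideal e) + AL_ker \<phi> \<Lambda> (1 - e) = AL_sub \<phi> \<Lambda> e"
proof (intro equalityI subsetI)
  fix z assume "z \<in> torsion \<phi> (comp_ideal e) + AL_ker \<phi> \<Lambda> (1 - e)"
  then obtain a b where ab: "z = a + b" "a \<in> torsion \<phi> (comp_ideal e)" "b \<in> AL_ker \<phi> \<Lambda> (1 - e)"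
    by (rule set_plus_elim)
  have b: "b \<in> \<Lambda>" "ev (\<phi> (1 - e)) b = b" using ab(3) by (simp_all add: AL_ker_eq idem_compl e)
  have a: "ev (\<phi> \<nu>) a = 0" "ev (\<phi> (1 - e)) a = 0"
    using ab(2) torsion_comp_ideal[OF e, of a] by (simp_all add: act_compl)
  show "z \<in> AL_sub \<phi> \<Lambda> e" using a b Lambda_torsion[OF b(1)] by (simp add: AL_sub_def ab(1) ev_add)
next
  fix z assume z: "z \<in> AL_sub \<phi> \<Lambda> e"
  then have t: "ev (\<phi> \<nu>) z = 0" and m: "ev (\<phi> (1 - e)) z \<in> \<Lambda>" by (simp_all add: AL_sub_def)
  have "ev (\<phi> e) z \<in> torsion \<phi> (comp_ideal e)"
    using torsion_comp_ideal[OF e] act_torsion[OF t] act_idem[OF t e] by blast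
  moreover have "ev (\<phi> (1 - e)) z \<in> AL_ker \<phi> \<Lambda> (1 - e)"
    using m act_idem[OF t idem_compl[OF e]] by (simp add: AL_ker_eq idem_compl e)
  ultimately have "ev (\<phi> e) z + ev (\<phi> (1 - e)) z \<in> torsion \<phi> (comp_ideal e) + AL_ker \<phi> \<Lambda> (1 - e)"
    by (rule set_plus_intro)
  then show "z \<in> torsion \<phi> (comp_ideal e) + AL_ker \<phi> \<Lambda> (1 - e)" by (simp add: act_compl)
qed

lemma AL_sub_submodule: "fin_submodule \<phi> (AL_sub \<phi> \<Lambda> e)"
  unfolding fin_submodule_def
proof (intro conjI ballI allI)
  show "finite (AL_sub \<phi> \<Lambda> e)"
    unfolding AL_sub_def using finite_zeros_module[OF pair_drinfeld \<nu>] by (rule finite_subset[rotated]) blast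
  show "0 \<in> AL_sub \<phi> \<Lambda> e" using Lambda_D(2) by (simp add: AL_sub_def)
  show "x + y \<in> AL_sub \<phi> \<Lambda> e" if "x \<in> AL_sub \<phi> \<Lambda> e" "y \<in> AL_sub \<phi> \<Lambda> e" for x y
    using that Lambda_D(3) by (simp add: AL_sub_def ev_add)
  show "ev (\<phi> a) x \<in> AL_sub \<phi> \<Lambda> e" if "x \<in> AL_sub \<phi> \<Lambda> e" for a x
    using that Lambda_D(4) act_torsion
    by (simp add: AL_sub_def act_commute[OF pair_drinfeld, of "1 - e"])
qed

lemma Lambda_subset_AL_sub: "\<Lambda> \<subseteq> AL_sub \<phi> \<Lambda> e"
  using Lambda_torsion Lambda_D(4) by (auto simp: AL_sub_def)

lemma AL_ker_card:
  assumes e: "idem e" and a: "comp_ideal e = {b. a dvd b}"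
  shows "card (AL_ker \<phi> \<Lambda> e) = q ^ degree a" "a \<noteq> 0"
proof -
  have "\<nu> \<in> comp_ideal e" by (simp add: in_comp_ideal)
  then show a0: "a \<noteq> 0" using \<nu> a by auto
  obtain l where "AL_ker \<phi> \<Lambda> e = span1 \<phi> l" "ann \<phi> l = comp_ideal e" by (rule AL_ker_cyclic[OF e])
  then show "card (AL_ker \<phi> \<Lambda> e) = q ^ degree a" using card_span1(2)[OF pair_drinfeld _ a0] a by simp
qed

end

end

context AL_base
begin

text \<open>The image of \<open>S = AL_sub \<phi> \<Lambda> e\<close> has an element \<open>z\<close> whose annihilator \<open>(b)\<close> kills the whole
  image.  Writing \<open>\<nu> = b c\<close>, the group \<open>b \<phi>[\<nu>] = \<phi>[c]\<close> is contained in the \<open>c\<close>-torsion of \<open>\<Lambda>\<close>.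
  The former is free of rank two over \<open>A/c\<close> and the latter of rank one, so \<open>c\<close> is constant, and \<open>z\<close> generates
  the image by comparison of orders.\<close>

lemma AL_image_pair:
  assumes p: "(\<phi>, \<Lambda>) \<in> pairs \<iota> \<nn>" and e: "idem e" and \<psi>: "drinfeld \<iota> UNIV \<psi>"
    and \<mu>: "isogeny \<mu> \<phi> \<psi>" and ker: "zeros \<mu> = AL_ker \<phi> \<Lambda> e"
  shows "(\<psi>, ev \<mu> ` AL_sub \<phi> \<Lambda> e) \<in> pairs \<iota> \<nn>"
proof -
  note dr = pair_drinfeld[OF p]
  note LD = Lambda_D[OF p] and Lt = Lambda_torsion[OF p]
  let ?S = "AL_sub \<phi> \<Lambda> e"
  note SD = fin_submoduleD[OF dr AL_sub_submodule[OF p, of e]]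
  have \<mu>act: "ev \<mu> (ev (\<phi> a) z) = ev (\<psi> a) (ev \<mu> z)" for a z by (rule isogeny_ev[OF \<mu>])
  have M: "fin_submodule \<psi> (ev \<mu> ` ?S)"
    unfolding fin_submodule_def
  proof (intro conjI ballI allI)
    show "finite (ev \<mu> ` ?S)" using SD(1) by (rule finite_imageI)
    show "0 \<in> ev \<mu> ` ?S" using SD(2) by (intro image_eqI[of _ _ 0]) simp_all
    fix x assume "x \<in> ev \<mu> ` ?S"
    then obtain s where s: "s \<in> ?S" "x = ev \<mu> s" by blast
    show "ev (\<psi> a) x \<in> ev \<mu> ` ?S" for a
      using SD(4)[OF s(1), of a] by (intro image_eqI[of _ _ "ev (\<phi> a) s"]) (simp_all add: s(2) \<mu>act)
    fix y assume "y \<in> ev \<mu> ` ?S"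
    then obtain t where t: "t \<in> ?S" "y = ev \<mu> t" by blast
    show "x + y \<in> ev \<mu> ` ?S"
      using SD(3)[OF s(1) t(1)] by (intro image_eqI[of _ _ "s + t"]) (simp_all add: s(2) t(2) ev_add)
  qed
  obtain z b where z: "z \<in> ev \<mu> ` ?S" "b \<noteq> 0" "ann \<psi> z = {a. b dvd a}"
    "\<And>y. y \<in> ev \<mu> ` ?S \<Longrightarrow> ev (\<psi> b) y = 0" using exponent_element[OF \<psi> M] by blast
  have bS: "ev (\<phi> b) s \<in> AL_ker \<phi> \<Lambda> e" if "s \<in> ?S" for s
    unfolding ker[symmetric] using z(4)[OF imageI[OF that]] by (simp add: \<mu>act)
  obtain l where l: "\<Lambda> = span1 \<phi> l" "ann \<phi> l = \<nn>" by (rule Lambda_gen[OF p])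
  have "\<nu> \<in> ann \<phi> l" using l(2) by (simp add: \<nn>)
  then have lt: "ev (\<phi> \<nu>) l = 0" by (simp add: ann_def)
  obtain s where s: "s \<in> ?S" "z = ev \<mu> s" using z(1) by blast
  then have "ev (\<phi> \<nu>) s = 0" by (simp add: AL_sub_def)
  then have "\<nu> \<in> ann \<psi> z" by (simp add: ann_def s(2) flip: \<mu>act)
  then obtain c where c: "\<nu> = b * c" using z(3) by (auto elim: dvdE)
  then have c0: "c \<noteq> 0" using \<nu> by auto
  (* (1 - e) l lies in S, so that b (1 - e) l lies both in e \<Lambda> and in (1 - e) \<Lambda> *)
  have compl: "\<nu> dvd b * (1 - e)"
  proof -
    have lin: "l \<in> \<Lambda>" unfolding l(1) by (rule span1_gen[OF dr])
    then have "ev (\<phi> (1 - e)) l \<in> ?S" using LD(4) Lambda_subset_AL_sub[OF p] by blast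
    then have "ev (\<phi> e) (ev (\<phi> b) (ev (\<phi> (1 - e)) l)) = ev (\<phi> b) (ev (\<phi> (1 - e)) l)"
      using bS by (simp add: AL_ker_eq[OF p e])
    moreover have "ev (\<phi> e) (ev (\<phi> b) (ev (\<phi> (1 - e)) l)) = 0"
      by (simp add: act_commute[OF dr, of e b] act_orth[OF p lt e])
    ultimately have "b * (1 - e) \<in> ann \<phi> l" by (simp add: ann_def act_mult[OF dr])
    then show ?thesis unfolding l(2) by (simp add: \<nn>)
  qed
  have b\<Lambda>: "ev (\<phi> b) y \<in> {y \<in> \<Lambda>. ev (\<phi> c) y = 0}" if y: "y \<in> zeros (\<phi> \<nu>)" for y
  proof -
    have yt: "ev (\<phi> \<nu>) y = 0" using y by simp
    have "ev (\<phi> e) y \<in> ?S" using act_orth(1)[OF p yt e] act_torsion[OF p yt] LD(2) by (simp add: AL_sub_def)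
    then have "ev (\<phi> b) (ev (\<phi> e) y) \<in> \<Lambda>" using bS by (simp add: AL_ker_eq[OF p e])
    moreover have "ev (\<phi> b) (ev (\<phi> (1 - e)) y) = 0"
      using act_vanish[OF p yt compl] by (simp add: act_mult[OF dr])
    then have "ev (\<phi> b) (ev (\<phi> e) y) = ev (\<phi> b) y"
      by (simp add: act_compl[OF p] ev_diff)
    moreover have "ev (\<phi> c) (ev (\<phi> b) y) = 0"
      using yt unfolding c by (simp add: mult.commute[of b] act_mult[OF dr])
    ultimately show ?thesis by simp
  qed
  have tors: "finite (zeros (\<phi> \<nu>))" using finite_zeros_module[OF dr \<nu>] .
  have "2 * degree c \<le> degree c"
  proof -
    have "card (zeros (\<phi> \<nu>)) = card (ev (\<phi> b) ` zeros (\<phi> \<nu>)) * card {y \<in> zeros (\<phi> \<nu>). ev (\<phi> b) y = 0}"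
      by (rule card_image_kernel[OF tors]) (simp_all add: ev_add ev_diff)
    moreover have "{y \<in> zeros (\<phi> \<nu>). ev (\<phi> b) y = 0} = zeros (\<phi> b)"
      using act_dvd[OF dr, of b \<nu>] c by auto
    ultimately have "q ^ (2 * degree \<nu>) = card (ev (\<phi> b) ` zeros (\<phi> \<nu>)) * q ^ (2 * degree b)"
      by (simp add: card_zeros_module[OF dr] \<nu> z(2))
    moreover have "degree \<nu> = degree c + degree b" using c c0 z(2) by (simp add: degree_mult_eq)
    then have "q ^ (2 * degree \<nu>) = q ^ (2 * degree c) * q ^ (2 * degree b)"
      by (simp add: power_add[symmetric] algebra_simps)
    ultimately have bcard: "card (ev (\<phi> b) ` zeros (\<phi> \<nu>)) = q ^ (2 * degree c)"
      using q_gt_1 by auto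
    have sub: "{y \<in> \<Lambda>. ev (\<phi> c) y = 0} \<subseteq> span1 \<phi> (ev (\<phi> b) l)"
    proof
      fix y assume y: "y \<in> {y \<in> \<Lambda>. ev (\<phi> c) y = 0}"
      then obtain a where a: "y = ev (\<phi> a) l" using l(1) by (auto simp: span1_def)
      have "c * a \<in> ann \<phi> l" using y by (simp add: ann_def act_mult[OF dr] a)
      then have "c * b dvd c * a" unfolding l(2) by (simp add: \<nn> c mult.commute)
      then have "b dvd a" using c0 by simp
      then obtain k where k: "a = b * k" by (rule dvdE)
      then show "y \<in> span1 \<phi> (ev (\<phi> b) l)"
        unfolding span1_def a by (intro range_eqI[of _ _ k]) (simp add: k mult.commute[of b] act_mult[OF dr])
    qed
    have ann: "ann \<phi> (ev (\<phi> b) l) = {a. c dvd a}"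
    proof -
      have "ann \<phi> (ev (\<phi> b) l) = {a. a * b \<in> ann \<phi> l}" by (simp add: ann_def act_mult[OF dr])
      also have "\<dots> = {a. c dvd a}" unfolding l(2) using z(2) by (simp add: \<nn> c mult.commute[of _ b])
      finally show ?thesis .
    qed
    have "ev (\<phi> b) ` zeros (\<phi> \<nu>) \<subseteq> span1 \<phi> (ev (\<phi> b) l)"
      using b\<Lambda> sub by (intro image_subsetI) blast
    then have "q ^ (2 * degree c) \<le> q ^ degree c"
      unfolding bcard[symmetric] card_span1(2)[OF dr ann c0, symmetric]
      by (rule card_mono[OF card_span1(1)[OF dr ann c0]])
    then show ?thesis using q_gt_1 by simp
  qed
  then have dc: "degree c = 0" by simp
  then have "c dvd 1" using c0 by (simp add: is_unit_iff_degree)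
  then have "b * c dvd x \<longleftrightarrow> b dvd x" for x by (rule mult_unit_dvd_iff)
  then have "{a. b * c dvd a} = {a. b dvd a}" by (rule Collect_cong)
  then have ann\<psi>: "ann \<psi> z = \<nn>" unfolding z(3) \<nn> c by (rule sym)
  have span: "card (span1 \<psi> z) = q ^ degree \<nu>" "finite (span1 \<psi> z)"
    using card_span1[OF \<psi> ann\<psi>[unfolded \<nn>] \<nu>] by simp_all
  have card\<Lambda>: "card \<Lambda> = q ^ degree \<nu>"
    unfolding l(1) using card_span1(2)[OF dr l(2)[unfolded \<nn>] \<nu>] .
  have "card (ev \<mu> ` ?S) = card \<Lambda>"
  proof -
    obtain a where a: "comp_ideal e = {b. a dvd b}" by (rule ideal_principal[OF is_ideal_comp_ideal])
    note ka = AL_ker_card[OF p e a]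
    let ?L = "ev (\<phi> (1 - e)) ` \<Lambda>"
    have kersub: "AL_ker \<phi> \<Lambda> e \<subseteq> ?S"
      using Lambda_subset_AL_sub[OF p] by (auto simp: AL_ker_eq[OF p e])
    have "card ?S = card (ev \<mu> ` ?S) * card {y \<in> ?S. ev \<mu> y = 0}"
      by (rule card_image_kernel[OF SD(1)]) (simp_all add: SD ev_diff)
    moreover have "{y \<in> ?S. ev \<mu> y = 0} = AL_ker \<phi> \<Lambda> e" using ker kersub by auto
    moreover have "card ?S = card (ev (\<phi> (1 - e)) ` ?S) * card {y \<in> ?S. ev (\<phi> (1 - e)) y = 0}"
      by (rule card_image_kernel[OF SD(1)]) (simp_all add: SD ev_diff)
    moreover have "ev (\<phi> (1 - e)) ` ?S = ?L"
    proof (intro equalityI subsetI)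
      fix y assume "y \<in> ev (\<phi> (1 - e)) ` ?S"
      then obtain s where s: "s \<in> ?S" "y = ev (\<phi> (1 - e)) s" by blast
      then have "ev (\<phi> \<nu>) s = 0" "ev (\<phi> (1 - e)) s \<in> \<Lambda>" by (simp_all add: AL_sub_def)
      moreover from this have "y = ev (\<phi> (1 - e)) (ev (\<phi> (1 - e)) s)"
        using act_idem[OF p _ idem_compl[OF e]] s(2) by simp
      ultimately show "y \<in> ?L" by blast
    next
      fix y assume "y \<in> ?L"
      then show "y \<in> ev (\<phi> (1 - e)) ` ?S" using image_mono[OF Lambda_subset_AL_sub[OF p]] by (rule subsetD[rotated])
    qed
    moreover have "{y \<in> ?S. ev (\<phi> (1 - e)) y = 0} = torsion \<phi> (comp_ideal e)"
    proof (intro equalityI subsetI)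
      fix y assume "y \<in> {y \<in> ?S. ev (\<phi> (1 - e)) y = 0}"
      then show "y \<in> torsion \<phi> (comp_ideal e)"
        unfolding torsion_comp_ideal[OF p e] by (simp add: AL_sub_def act_compl[OF p])
    next
      fix y assume "y \<in> torsion \<phi> (comp_ideal e)"
      then show "y \<in> {y \<in> ?S. ev (\<phi> (1 - e)) y = 0}"
        unfolding torsion_comp_ideal[OF p e] using LD(2) by (simp add: AL_sub_def act_compl[OF p])
    qed
    moreover have "card (torsion \<phi> (comp_ideal e)) = q ^ degree a * q ^ degree a"
      unfolding a torsion_principal[OF dr] card_zeros_module[OF dr ka(2)] by (simp add: mult_2 power_add)
    moreover have "card \<Lambda> = card ?L * card {y \<in> \<Lambda>. ev (\<phi> (1 - e)) y = 0}"
      by (rule card_image_kernel[OF LD(1)]) (simp_all add: LD ev_diff)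
    moreover have "{y \<in> \<Lambda>. ev (\<phi> (1 - e)) y = 0} = AL_ker \<phi> \<Lambda> e"
      by (auto simp: AL_ker_eq[OF p e] act_compl[OF p])
    ultimately show ?thesis using ka(1) q_gt_1 by auto
  qed
  then have "span1 \<psi> z = ev \<mu> ` ?S"
    using span1_subset[OF \<psi> M z(1)] span(1) card\<Lambda> SD(1) by (intro card_subset_eq) simp_all
  then show ?thesis unfolding pairs_iff using \<psi> SD(1) ann\<psi> by (metis finite_imageI)
qed

subsection \<open>The action on isomorphism classes\<close>

text \<open>If \<open>c\<close> is the isomorphism of the given pairs, then \<open>\<mu>\<close> and \<open>\<mu>' c\<close> have the same kernel.\<close>

lemma AL_image_iso:
  assumes pp: "((\<phi>, \<Lambda>), (\<phi>', \<Lambda>')) \<in> pair_iso \<iota> \<nn>" and e: "idem e"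
    and \<psi>: "drinfeld \<iota> UNIV \<psi>" "isogeny \<mu> \<phi> \<psi>" "zeros \<mu> = AL_ker \<phi> \<Lambda> e"
    and \<psi>': "drinfeld \<iota> UNIV \<psi>'" "isogeny \<mu>' \<phi>' \<psi>'" "zeros \<mu>' = AL_ker \<phi>' \<Lambda>' e"
  shows "((\<psi>, ev \<mu> ` AL_sub \<phi> \<Lambda> e), (\<psi>', ev \<mu>' ` AL_sub \<phi>' \<Lambda>' e)) \<in> pair_iso \<iota> \<nn>"
proof -
  obtain c where c: "c \<noteq> 0" "isogeny [:c:] \<phi> \<phi>'" "ev [:c:] ` \<Lambda> = \<Lambda>'"
    and p: "(\<phi>, \<Lambda>) \<in> pairs \<iota> \<nn>" "(\<phi>', \<Lambda>') \<in> pairs \<iota> \<nn>" using pp by (auto simp: pair_iso_iff)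
  have cact: "c * ev (\<phi> a) z = ev (\<phi>' a) (c * z)" for a z using isogeny_ev[OF c(2), of a z] by simp
  have in\<Lambda>: "c * z \<in> \<Lambda>' \<longleftrightarrow> z \<in> \<Lambda>" for z using c(1) by (auto simp flip: c(3))
  have iso: "isogeny (\<mu>' \<star> [:c:]) \<phi> \<psi>'" by (rule isogeny_comp[OF c(2) \<psi>'(2)])
  have "z \<in> zeros (\<mu>' \<star> [:c:]) \<longleftrightarrow> z \<in> zeros \<mu>" for z
  proof -
    have "z \<in> zeros (\<mu>' \<star> [:c:]) \<longleftrightarrow> c * z \<in> AL_ker \<phi>' \<Lambda>' e" by (simp add: ev_mult flip: \<psi>'(3))
    also have "\<dots> \<longleftrightarrow> z \<in> AL_ker \<phi> \<Lambda> e"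
      using c(1) by (simp add: AL_ker_eq p e in\<Lambda> flip: cact)
    finally show ?thesis by (simp only: \<psi>(3))
  qed
  then have "zeros \<mu> = zeros (\<mu>' \<star> [:c:])" by blast
  then obtain d where d: "d \<noteq> 0" "\<mu>' \<star> [:c:] = [:d:] \<star> \<mu>" "isogeny [:d:] \<psi> \<psi>'"
    using isogeny_same_zeros[OF pair_drinfeld[OF p(1)] \<psi>(1) \<psi>'(1) \<psi>(2) iso] by blast
  have sub: "AL_sub \<phi>' \<Lambda>' e = ev [:c:] ` AL_sub \<phi> \<Lambda> e"
  proof (intro equalityI subsetI)
    fix z assume z: "z \<in> AL_sub \<phi>' \<Lambda>' e"
    define y where "y = z / c"
    have zy: "z = c * y" using c(1) by (simp add: y_def)
    have "y \<in> AL_sub \<phi> \<Lambda> e" using z c(1) unfolding zy by (simp add: AL_sub_def in\<Lambda> flip: cact)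
    then show "z \<in> ev [:c:] ` AL_sub \<phi> \<Lambda> e" unfolding zy by (intro image_eqI[of _ _ y]) simp_all
  next
    fix z assume "z \<in> ev [:c:] ` AL_sub \<phi> \<Lambda> e"
    then obtain y where "y \<in> AL_sub \<phi> \<Lambda> e" "z = c * y" by auto
    then show "z \<in> AL_sub \<phi>' \<Lambda>' e" by (simp add: AL_sub_def in\<Lambda> flip: cact)
  qed
  have "ev [:d:] ` (ev \<mu> ` AL_sub \<phi> \<Lambda> e) = ev \<mu>' ` AL_sub \<phi>' \<Lambda>' e"
    unfolding sub image_image ev_mult[symmetric] d(2) ..
  then show ?thesis
    unfolding pair_iso_iff
    using AL_image_pair[OF p(1) e \<psi>] AL_image_pair[OF p(2) e \<psi>'] d(1,3) by blast
qed

lemma AL_image_exists: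
  assumes p: "(\<phi>, \<Lambda>) \<in> pairs \<iota> \<nn>" and e: "idem e"
  obtains \<mu> \<psi> where "lead_coeff \<mu> = 1" "coeff \<mu> 0 \<noteq> 0" "zeros \<mu> = AL_ker \<phi> \<Lambda> e"
    "drinfeld \<iota> UNIV \<psi>" "isogeny \<mu> \<phi> \<psi>"
  by (rule quotient_exists[OF pair_drinfeld[OF p] AL_ker_submodule[OF p e]])

lemma AL_class:
  assumes x: "x \<in> Y0 \<iota> \<nn>" and p: "(\<phi>, \<Lambda>) \<in> x" and e: "idem e"
    and \<psi>: "drinfeld \<iota> UNIV \<psi>" "isogeny \<mu> \<phi> \<psi>" "zeros \<mu> = AL_ker \<phi> \<Lambda> e"
  shows "AL e x = pair_iso \<iota> \<nn> `` {(\<psi>, ev \<mu> ` AL_sub \<phi> \<Lambda> e)}"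
proof (intro equalityI subsetI)
  have pp: "(\<phi>, \<Lambda>) \<in> pairs \<iota> \<nn>" using p Y0_D(1)[OF x] by blast
  fix r assume "r \<in> AL e x"
  then obtain \<phi>' \<Lambda>' \<Lambda>\<^sub>1 \<Lambda>\<^sub>2 \<psi>' \<mu>' where r: "(\<phi>', \<Lambda>') \<in> x"
    "cyclic_kernel \<phi>' (comp_ideal e) \<Lambda>\<^sub>1" "cyclic_kernel \<phi>' (comp_ideal (1 - e)) \<Lambda>\<^sub>2" "\<Lambda>' = \<Lambda>\<^sub>1 + \<Lambda>\<^sub>2"
    "drinfeld \<iota> UNIV \<psi>'" "isogeny \<mu>' \<phi>' \<psi>'" "zeros \<mu>' = \<Lambda>\<^sub>1"
    "((\<psi>', ev \<mu>' ` (torsion \<phi>' (comp_ideal e) + \<Lambda>\<^sub>2)), r) \<in> pair_iso \<iota> \<nn>"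
    unfolding atkin_lehner_def q_card by blast
  have pp': "(\<phi>', \<Lambda>') \<in> pairs \<iota> \<nn>" using r(1) Y0_D(1)[OF x] by blast
  have \<Lambda>: "\<Lambda>\<^sub>1 = AL_ker \<phi>' \<Lambda>' e" "\<Lambda>\<^sub>2 = AL_ker \<phi>' \<Lambda>' (1 - e)"
    using AL_ker_unique[OF pp' e r(2-4)] by auto
  have "((\<phi>, \<Lambda>), (\<phi>', \<Lambda>')) \<in> pair_iso \<iota> \<nn>" using Y0_D(4)[OF x p] r(1) by blast
  then have "((\<psi>, ev \<mu> ` AL_sub \<phi> \<Lambda> e), (\<psi>', ev \<mu>' ` AL_sub \<phi>' \<Lambda>' e)) \<in> pair_iso \<iota> \<nn>"
    using AL_image_iso[OF _ e \<psi> r(5,6)] r(7) \<Lambda>(1) by simp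
  moreover have "((\<psi>', ev \<mu>' ` AL_sub \<phi>' \<Lambda>' e), r) \<in> pair_iso \<iota> \<nn>"
    using r(8) unfolding \<Lambda>(2) AL_sub_eq[OF pp' e] .
  ultimately show "r \<in> pair_iso \<iota> \<nn> `` {(\<psi>, ev \<mu> ` AL_sub \<phi> \<Lambda> e)}"
    using equiv_pair_iso unfolding equiv_def by (meson ImageI insertI1 transD)
next
  have pp: "(\<phi>, \<Lambda>) \<in> pairs \<iota> \<nn>" using p Y0_D(1)[OF x] by blast
  fix r assume "r \<in> pair_iso \<iota> \<nn> `` {(\<psi>, ev \<mu> ` AL_sub \<phi> \<Lambda> e)}"
  then have "((\<psi>, ev \<mu> ` (torsion \<phi> (comp_ideal e) + AL_ker \<phi> \<Lambda> (1 - e))), r) \<in> pair_iso \<iota> \<nn>"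
    unfolding AL_sub_eq[OF pp e] by simp
  then show "r \<in> AL e x"
    unfolding atkin_lehner_def mem_Collect_eq q_card[symmetric]
    using p AL_ker_cyclic_kernel[OF pp e] AL_ker_cyclic_kernel[OF pp idem_compl[OF e]]
      AL_ker_sum[OF pp e] \<psi>
    by (intro exI[of _ \<phi>] exI[of _ \<Lambda>] exI[of _ "AL_ker \<phi> \<Lambda> e"] exI[of _ "AL_ker \<phi> \<Lambda> (1 - e)"]
        exI[of _ \<psi>] exI[of _ \<mu>] conjI)
qed

lemma AL_Y0:
  assumes x: "x \<in> Y0 \<iota> \<nn>" and e: "idem e"
  shows "AL e x \<in> Y0 \<iota> \<nn>"
proof -
  obtain \<phi> \<Lambda> where p: "(\<phi>, \<Lambda>) \<in> x" using Y0_D(3)[OF x] by auto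
  have pp: "(\<phi>, \<Lambda>) \<in> pairs \<iota> \<nn>" using p Y0_D(1)[OF x] by blast
  obtain \<mu> \<psi> where \<psi>: "zeros \<mu> = AL_ker \<phi> \<Lambda> e" "drinfeld \<iota> UNIV \<psi>" "isogeny \<mu> \<phi> \<psi>"
    by (rule AL_image_exists[OF pp e])
  show ?thesis
    unfolding AL_class[OF x p e \<psi>(2,3,1)] using AL_image_pair[OF pp e \<psi>(2,3,1)] by (rule Y0_class)
qed

definition J :: "('f, 'k) pt set \<Rightarrow> 'k" where "J x = jinv (fst (SOME p. p \<in> x))"

lemma J_eq:
  assumes x: "x \<in> Y0 \<iota> \<nn>" and p: "(\<phi>, \<Lambda>) \<in> x"
  shows "J x = jinv \<phi>"
proof -
  have "(SOME p. p \<in> x) \<in> x" using p by (rule someI)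
  then obtain \<phi>' \<Lambda>' where p': "(\<phi>', \<Lambda>') \<in> x" "(SOME p. p \<in> x) = (\<phi>', \<Lambda>')" by (metis surj_pair)
  have "((\<phi>', \<Lambda>'), (\<phi>, \<Lambda>)) \<in> pair_iso \<iota> \<nn>" using Y0_D(4)[OF x p'(1)] p by blast
  then have "jinv \<phi>' = jinv \<phi>" using jinv_iso pair_drinfeld by (auto simp: pair_iso_iff)
  then show ?thesis by (simp add: J_def p'(2))
qed

lemma J_AL:
  assumes x: "x \<in> Y0 \<iota> \<nn>" and p: "(\<phi>, \<Lambda>) \<in> x" and e: "idem e"
    and \<psi>: "drinfeld \<iota> UNIV \<psi>" "isogeny \<mu> \<phi> \<psi>" "zeros \<mu> = AL_ker \<phi> \<Lambda> e"
  shows "J (AL e x) = jinv \<psi>" "(\<psi>, ev \<mu> ` AL_sub \<phi> \<Lambda> e) \<in> AL e x"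
proof -
  have pp: "(\<phi>, \<Lambda>) \<in> pairs \<iota> \<nn>" using p Y0_D(1)[OF x] by blast
  show c: "(\<psi>, ev \<mu> ` AL_sub \<phi> \<Lambda> e) \<in> AL e x"
    unfolding AL_class[OF x p e \<psi>] by (rule class_self[OF AL_image_pair[OF pp e \<psi>]])
  show "J (AL e x) = jinv \<psi>" by (rule J_eq[OF AL_Y0[OF x e] c])
qed

text \<open>Both \<open>w\<^sub>d \<circ> w\<^sub>e\<close> and \<open>w\<^sub>f\<close>, for the sum \<open>f\<close> of \<open>d\<close> and \<open>e\<close> in the Boolean ring of
  idempotents, come from isogenies with the kernel \<open>d e \<phi>[\<nu>] + f \<Lambda>\<close>, if the isogeny for \<open>f\<close> is
  preceded by multiplication by a generator \<open>a\<close> of the annihilator of \<open>d e \<phi>[\<nu>]\<close>.\<close>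

lemma J_AL_AL:
  assumes x: "x \<in> Y0 \<iota> \<nn>" and d: "idem d" and e: "idem e"
  shows "J (AL d (AL e x)) = J (AL (sdiff d e) x)"
proof -
  define f where "f = sdiff d e"
  have f: "idem f" unfolding f_def using d e by (rule idem_sdiff)
  obtain \<phi> \<Lambda> where px: "(\<phi>, \<Lambda>) \<in> x" using Y0_D(3)[OF x] by auto
  have p: "(\<phi>, \<Lambda>) \<in> pairs \<iota> \<nn>" using px Y0_D(1)[OF x] by blast
  note dr = pair_drinfeld[OF p]
  note LD = Lambda_D[OF p] and Lt = Lambda_torsion[OF p]
  let ?S = "AL_sub \<phi> \<Lambda> e"
  note SD = fin_submoduleD[OF dr AL_sub_submodule[OF p, of e]]
  have LS: "\<Lambda> \<subseteq> ?S" by (rule Lambda_subset_AL_sub[OF p])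
  obtain \<mu>1 \<psi>1 where 1: "zeros \<mu>1 = AL_ker \<phi> \<Lambda> e" "drinfeld \<iota> UNIV \<psi>1" "isogeny \<mu>1 \<phi> \<psi>1"
    by (rule AL_image_exists[OF p e])
  let ?\<Lambda>1 = "ev \<mu>1 ` ?S"
  have p1: "(\<psi>1, ?\<Lambda>1) \<in> pairs \<iota> \<nn>" by (rule AL_image_pair[OF p e 1(2,3,1)])
  obtain \<mu>2 \<psi>2 where 2: "zeros \<mu>2 = AL_ker \<psi>1 ?\<Lambda>1 d" "drinfeld \<iota> UNIV \<psi>2" "isogeny \<mu>2 \<psi>1 \<psi>2"
    by (rule AL_image_exists[OF p1 d])
  obtain \<mu>3 \<psi>3 where 3: "zeros \<mu>3 = AL_ker \<phi> \<Lambda> f" "drinfeld \<iota> UNIV \<psi>3" "isogeny \<mu>3 \<phi> \<psi>3"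
    by (rule AL_image_exists[OF p f])
  obtain a where a: "comp_ideal (d * e) = {b. a dvd b}" by (rule ideal_principal[OF is_ideal_comp_ideal])
  have "\<nu> \<in> comp_ideal (d * e)" by (simp add: in_comp_ideal)
  then have a0: "a \<noteq> 0" using \<nu> a by auto
  have "1 - d * e \<in> comp_ideal (d * e)" using idem_orth(1)[OF idem_mult[OF d e]] by (simp add: in_comp_ideal)
  then obtain r where r: "1 - d * e = a * r" using a by (auto elim: dvdE)
  have ade: "\<nu> dvd a * (d * e)" using a by (simp add: set_eq_iff in_comp_ideal)
  have id: "\<nu> dvd d * d - d" "\<nu> dvd e * e - e" using d e by (simp_all add: idem_def)
  (* d (1 - e) and e (1 - d) are the two orthogonal parts of f, and f is orthogonal to d e *)
  have fd: "\<nu> dvd f * (d * (1 - e)) - d * (1 - e)"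
  proof -
    have "f * (d * (1 - e)) - d * (1 - e) = (d * d - d) * (1 - e) - (e * e - e) * (d - 2 * d * d)"
      by (simp add: f_def sdiff_def algebra_simps)
    then show ?thesis using id by simp
  qed
  have fe: "\<nu> dvd f * (e * (1 - d)) - e * (1 - d)"
  proof -
    have "f * (e * (1 - d)) - e * (1 - d) = (e * e - e) * (1 - d) - (d * d - d) * (e - 2 * e * e)"
      by (simp add: f_def sdiff_def algebra_simps)
    then show ?thesis using id by simp
  qed
  have fde: "\<nu> dvd (1 - d * e) * f - f"
  proof -
    have "(1 - d * e) * f - f = - ((d * d - d) * e + (e * e - e) * d
        - 2 * ((d * d - d) * (e * e) + d * (e * e - e)))"
      by (simp add: f_def sdiff_def algebra_simps)
    moreover have "\<nu> dvd (d * d - d) * e + (e * e - e) * d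
        - 2 * ((d * d - d) * (e * e) + d * (e * e - e))"
      by (rule dvd_diff[OF dvd_add[OF dvd_mult2[OF id(1)] dvd_mult2[OF id(2)]]
            dvd_mult[OF dvd_add[OF dvd_mult2[OF id(1)] dvd_mult[OF id(2)]]]])
    ultimately show ?thesis by (simp only: dvd_minus_iff)
  qed
  have fsum: "f = d * (1 - e) + e * (1 - d)" by (simp add: f_def sdiff_def algebra_simps)
  have in1: "z \<in> zeros (\<mu>2 \<star> \<mu>1) \<longleftrightarrow> (\<exists>s\<in>?S. \<exists>m\<in>\<Lambda>. z = ev (\<phi> d) s + ev (\<phi> e) m)" for z
  proof -
    have "z \<in> zeros (\<mu>2 \<star> \<mu>1) \<longleftrightarrow> (\<exists>s\<in>?S. ev \<mu>1 z = ev (\<psi>1 d) (ev \<mu>1 s))"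
      using 2(1) unfolding AL_ker_def by (auto simp: ev_mult set_eq_iff)
    also have "\<dots> \<longleftrightarrow> (\<exists>s\<in>?S. z - ev (\<phi> d) s \<in> zeros \<mu>1)"
      by (simp add: ev_diff isogeny_ev[OF 1(3)])
    also have "\<dots> \<longleftrightarrow> (\<exists>s\<in>?S. \<exists>m\<in>\<Lambda>. z - ev (\<phi> d) s = ev (\<phi> e) m)"
      unfolding 1(1) AL_ker_def by blast
    also have "\<dots> \<longleftrightarrow> (\<exists>s\<in>?S. \<exists>m\<in>\<Lambda>. z = ev (\<phi> d) s + ev (\<phi> e) m)"
      by (simp add: diff_eq_eq add.commute)
    finally show ?thesis .
  qed
  have in2: "z \<in> zeros (\<mu>3 \<star> \<phi> a) \<longleftrightarrow> (\<exists>m\<in>\<Lambda>. ev (\<phi> a) z = ev (\<phi> f) m)" for z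
    using 3(1) unfolding AL_ker_def by (auto simp: ev_mult set_eq_iff)
  have "z \<in> zeros (\<mu>3 \<star> \<phi> a)" if "z \<in> zeros (\<mu>2 \<star> \<mu>1)" for z
  proof -
    obtain s m where s: "s \<in> ?S" and m: "m \<in> \<Lambda>" and z: "z = ev (\<phi> d) s + ev (\<phi> e) m"
      using \<open>z \<in> zeros (\<mu>2 \<star> \<mu>1)\<close> unfolding in1 by blast
    define s' where "s' = ev (\<phi> (1 - e)) s"
    have st: "ev (\<phi> \<nu>) s = 0" and s': "s' \<in> \<Lambda>" using s by (simp_all add: AL_sub_def s'_def)
    have "ev (\<phi> (a * d)) s = ev (\<phi> (a * (f * (d * (1 - e))))) s'"
    proof -
      have eq: "a * d - a * (f * (d * (1 - e))) * (1 - e)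
        = a * (d * e) + a * d * ((1 - e) - (1 - e) * (1 - e)) - a * (1 - e) * (f * (d * (1 - e)) - d * (1 - e))"
        by (simp add: algebra_simps)
      have "(1 - e) - (1 - e) * (1 - e) = - (e * e - e)" by (simp add: algebra_simps)
      then have "\<nu> dvd (1 - e) - (1 - e) * (1 - e)" using id(2) by (simp only: dvd_minus_iff)
      then have "\<nu> dvd a * d - a * (f * (d * (1 - e))) * (1 - e)"
        unfolding eq using ade fd by (intro dvd_diff dvd_add) simp_all
      then have "ev (\<phi> (a * d)) s = ev (\<phi> (a * (f * (d * (1 - e))) * (1 - e))) s"
        by (rule act_cong[OF p st])
      then show ?thesis by (simp add: s'_def act_mult[OF dr])
    qed
    moreover have "ev (\<phi> (a * e)) m = ev (\<phi> (a * (f * (e * (1 - d))))) m"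
    proof -
      have eq: "a * e - a * (f * (e * (1 - d))) = a * (d * e) - a * (f * (e * (1 - d)) - e * (1 - d))"
        by (simp add: algebra_simps)
      have "\<nu> dvd a * e - a * (f * (e * (1 - d)))" unfolding eq using ade fe by (intro dvd_diff) simp_all
      then show ?thesis by (rule act_cong[OF p Lt[OF m]])
    qed
    ultimately have "ev (\<phi> a) z
      = ev (\<phi> f) (ev (\<phi> (a * (d * (1 - e)))) s' + ev (\<phi> (a * (e * (1 - d)))) m)"
      unfolding z ev_add act_mult[OF dr, symmetric] by (simp add: mult.left_commute)
    moreover have "ev (\<phi> (a * (d * (1 - e)))) s' + ev (\<phi> (a * (e * (1 - d)))) m \<in> \<Lambda>"
      using LD(3)[OF LD(4)[OF s'] LD(4)[OF m]] .
    ultimately show ?thesis unfolding in2 by blast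
  qed
  moreover have "z \<in> zeros (\<mu>2 \<star> \<mu>1)" if "z \<in> zeros (\<mu>3 \<star> \<phi> a)" for z
  proof -
    obtain m where m: "m \<in> \<Lambda>" "ev (\<phi> a) z = ev (\<phi> f) m"
      using \<open>z \<in> zeros (\<mu>3 \<star> \<phi> a)\<close> unfolding in2 by blast
    define y where "y = ev (\<phi> r) m"
    have y: "y \<in> \<Lambda>" unfolding y_def by (rule LD(4)[OF m(1)])
    define u where "u = z - ev (\<phi> f) y"
    have "ev (\<phi> a) (ev (\<phi> f) y) = ev (\<phi> ((1 - d * e) * f)) m"
      unfolding y_def r act_mult[OF dr, symmetric] by (simp add: mult_ac)
    also have "\<dots> = ev (\<phi> f) m" by (rule act_cong[OF p Lt[OF m(1)] fde])
    finally have "ev (\<phi> a) u = 0" by (simp add: u_def ev_diff m(2))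
    then have "u \<in> torsion \<phi> (comp_ideal (d * e))" unfolding a torsion_principal[OF dr] by simp
    then have u: "ev (\<phi> \<nu>) u = 0" "ev (\<phi> d) (ev (\<phi> e) u) = u"
      using torsion_comp_ideal[OF p idem_mult[OF d e]] by (simp_all add: act_mult[OF dr])
    have "ev (\<phi> e) u \<in> ?S"
      using act_orth(1)[OF p u(1) e] act_torsion[OF p u(1)] LD(2) by (simp add: AL_sub_def)
    then have "ev (\<phi> e) u + ev (\<phi> (1 - e)) y \<in> ?S" using LS LD(4)[OF y] by (intro SD(3)) blast+
    moreover have "ev (\<phi> (1 - d)) y \<in> \<Lambda>" by (rule LD(4)[OF y])
    moreover have "z = ev (\<phi> d) (ev (\<phi> e) u + ev (\<phi> (1 - e)) y) + ev (\<phi> e) (ev (\<phi> (1 - d)) y)"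
    proof -
      have "ev (\<phi> f) y = ev (\<phi> d) (ev (\<phi> (1 - e)) y) + ev (\<phi> e) (ev (\<phi> (1 - d)) y)"
        unfolding fsum act_add[OF dr] act_mult[OF dr] ..
      then show ?thesis using u(2) by (simp add: ev_add u_def)
    qed
    ultimately show ?thesis unfolding in1 by blast
  qed
  ultimately have zeq: "zeros (\<mu>2 \<star> \<mu>1) = zeros (\<mu>3 \<star> \<phi> a)" by blast
  obtain c where "isogeny [:c:] \<psi>2 \<psi>3"
    using isogeny_same_zeros[OF dr 2(2) 3(2) isogeny_comp[OF 1(3) 2(3)]
        isogeny_comp[OF isogeny_self[OF dr a0] 3(3)] zeq] by blast
  then have "jinv \<psi>2 = jinv \<psi>3" by (rule jinv_iso[OF 2(2) 3(2)])
  moreover have "J (AL d (AL e x)) = jinv \<psi>2"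
    by (rule J_AL(1)[OF AL_Y0[OF x e] J_AL(2)[OF x px e 1(2,3,1)] d 2(2,3,1)])
  moreover have "J (AL f x) = jinv \<psi>3" by (rule J_AL(1)[OF x px f 3(2,3,1)])
  ultimately show ?thesis by (simp add: f_def)
qed

end

section \<open>Coordinate functions\<close>

context AL_base
begin

abbreviation PF :: "(('f, 'k) pt \<Rightarrow> 'k) set" where "PF \<equiv> pair_functions \<iota> \<nn>"

lemma Q_field_emb: "\<iota> a \<in> Q_field \<iota>"
  unfolding Q_field_def by (rule CollectI, rule exI[of _ a], rule exI[of _ 1]) simp

lemma PF_const: "(\<lambda>_. \<iota> a) \<in> PF"
  by (rule pair_functions.const[OF Q_field_emb])

lemma PF_0: "(\<lambda>_. 0) \<in> PF" and PF_1: "(\<lambda>_. 1) \<in> PF"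
  using PF_const[of 0] PF_const[of 1] by simp_all

lemma PF_minus: "f \<in> PF \<Longrightarrow> (\<lambda>p. - f p) \<in> PF"
  using pair_functions.mult[OF PF_const[of "- 1"], of f] by (simp add: emb_minus)

lemma PF_diff: "f \<in> PF \<Longrightarrow> g \<in> PF \<Longrightarrow> (\<lambda>p. f p - g p) \<in> PF"
  using pair_functions.add[OF _ PF_minus, of f g] by simp

lemma PF_power: "f \<in> PF \<Longrightarrow> (\<lambda>p. f p ^ n) \<in> PF"
  by (induction n) (simp_all add: PF_1 pair_functions.mult)

lemma PF_sum: "(\<And>i. i \<in> I \<Longrightarrow> f i \<in> PF) \<Longrightarrow> (\<lambda>p. \<Sum>i\<in>I. f i p) \<in> PF"
  by (induction I rule: infinite_finite_induct) (simp_all add: PF_0 pair_functions.add)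

lemma PF_prod_linear:
  assumes "finite I" "\<And>i. i \<in> I \<Longrightarrow> f i \<in> PF"
  shows "(\<lambda>p. coeff (\<Prod>i\<in>I. [:- f i p, 1:]) n) \<in> PF"
  using assms
proof (induction I arbitrary: n)
  case empty
  then show ?case using PF_0 PF_1 by (cases n) simp_all
next
  case (insert i I)
  let ?P = "\<lambda>p. \<Prod>i\<in>I. [:- f i p, 1:]"
  have IH: "(\<lambda>p. coeff (?P p) m) \<in> PF" for m using insert by simp
  have m: "(\<lambda>p. - f i p * coeff (?P p) n) \<in> PF"
    using insert.prems by (intro pair_functions.mult IH PF_minus) simp
  have eq: "coeff (\<Prod>i\<in>insert i I. [:- f i p, 1:]) n
    = - f i p * coeff (?P p) n + (case n of 0 \<Rightarrow> 0 | Suc m \<Rightarrow> coeff (?P p) m)" for p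
    using insert.hyps by (simp add: coeff_pCons)
  have c: "(\<lambda>p. case n of 0 \<Rightarrow> 0 | Suc m \<Rightarrow> coeff (?P p) m) \<in> PF"
    by (cases n) (simp_all add: PF_0 IH)
  show ?case unfolding eq by (rule pair_functions.add[OF m c])
qed

lemma PF_in_subfield:
  assumes f: "f \<in> PF" and E: "subfield_of E" "Q_field \<iota> \<subseteq> E" and \<phi>: "\<phi> T \<in> polys_over E" and \<Lambda>: "\<Lambda> \<subseteq> E"
  shows "f (\<phi>, \<Lambda>) \<in> E"
  using f
proof (induction f)
  case (kernel \<mm> i)
  have "kernel_poly (\<Lambda> \<inter> torsion \<phi> \<mm>) \<in> polys_over E"
    unfolding kernel_poly_def using \<Lambda>
    by (intro polys_over_prod[OF E(1)] polys_over_closed(10)[OF E(1)] polys_over_closed(3)[OF E(1)]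
        subfieldD(2,5)[OF E(1)]) blast
  then show ?case by (simp add: polys_over_coeff)
next
  case (const c)
  then show ?case using E(2) by blast
next
  case (coeff_T i)
  show ?case using polys_over_coeff[OF \<phi>] by simp
next
  case inverse_Delta
  show ?case using subfieldD(6)[OF E(1) polys_over_coeff[OF \<phi>]] by simp
qed (simp_all add: subfieldD(3,4)[OF E(1)])

text \<open>The coefficients of \<open>\<psi>\<^sub>T\<close> follow from \<open>\<psi>\<^sub>T \<mu> = \<mu> \<phi>\<^sub>T\<close>, where \<open>\<mu>\<close> is the monic isogeny; its
  coefficients are those of the kernel polynomial.\<close>

lemma quotient_coeffs:
  assumes dr: "drinfeld \<iota> UNIV \<phi>" "drinfeld \<iota> UNIV \<psi>" and \<mu>: "isogeny \<mu> \<phi> \<psi>" "lead_coeff \<mu> = 1"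
    and d: "degree \<mu> = d" and b: "b = (if d = 0 then 0 else coeff \<mu> (d - 1))"
  shows "coeff (\<psi> T) 2 = coeff (\<phi> T) 2 ^ (q ^ d)"
    "coeff (\<psi> T) 1 = coeff (\<phi> T) 1 ^ (q ^ d) + b * coeff (\<phi> T) 2 ^ (q ^ (d - 1))
       - coeff (\<phi> T) 2 ^ (q ^ d) * b ^ (q ^ 2)"
proof -
  have eq: "\<mu> \<star> \<phi> T = \<psi> T \<star> \<mu>" using \<mu>(1) by (simp add: isogeny_iff)
  have deg: "degree (\<phi> T) \<le> 2" "degree (\<psi> T) \<le> 2" using drinfeldD(6) dr by (metis order_refl)+
  have m1: "coeff \<mu> d = 1" using \<mu>(2) d by simp
  have high: "coeff (\<phi> T) i = 0" "coeff (\<psi> T) i = 0" if "2 < i" for i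
    using that deg by (auto intro: coeff_eq_0)
  have "coeff (\<mu> \<star> \<phi> T) (d + 2) = coeff (\<phi> T) 2 ^ (q ^ d)"
    using coeff_skew_lead[of \<mu> d "\<phi> T" 2] d deg(1) m1 by simp
  moreover have "coeff (\<psi> T \<star> \<mu>) (d + 2) = coeff (\<psi> T) 2"
    using coeff_skew_lead[of "\<psi> T" 2 \<mu> d] d deg(2) m1 by (simp add: add.commute)
  ultimately show D: "coeff (\<psi> T) 2 = coeff (\<phi> T) 2 ^ (q ^ d)" using eq by simp
  have l: "coeff (\<mu> \<star> \<phi> T) (d + 1) = coeff (\<phi> T) 1 ^ (q ^ d) + b * coeff (\<phi> T) 2 ^ (q ^ (d - 1))"
  proof (cases "d = 0")
    case True
    then have "coeff (\<mu> \<star> \<phi> T) (d + 1) = (\<Sum>i\<in>{0}. coeff \<mu> i * coeff (\<phi> T) (d + 1 - i) ^ (q ^ i))"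
      unfolding coeff_skew using d by (intro sum.mono_neutral_right) (auto simp: coeff_eq_0)
    then show ?thesis using True m1 b by simp
  next
    case False
    have "coeff (\<mu> \<star> \<phi> T) (d + 1) = (\<Sum>i\<in>{d - 1, d}. coeff \<mu> i * coeff (\<phi> T) (d + 1 - i) ^ (q ^ i))"
      unfolding coeff_skew
    proof (rule sum.mono_neutral_right)
      show "\<forall>i\<in>{..d + 1} - {d - 1, d}. coeff \<mu> i * coeff (\<phi> T) (d + 1 - i) ^ (q ^ i) = 0"
      proof
        fix i assume i: "i \<in> {..d + 1} - {d - 1, d}"
        then have "i = d + 1 \<or> 2 < d + 1 - i" by auto
        then show "coeff \<mu> i * coeff (\<phi> T) (d + 1 - i) ^ (q ^ i) = 0"
          using d high(1) q_pow_pos[of i] by (auto simp: coeff_eq_0 power_0_left)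
      qed
    qed auto
    moreover have "d + 1 - (d - 1) = 2" using False by simp
    ultimately show ?thesis using False m1 b by simp
  qed
  have "coeff (\<psi> T \<star> \<mu>) (d + 1) = coeff (\<psi> T) 1 + coeff (\<psi> T) 2 * b ^ (q ^ 2)"
  proof (cases "d = 0")
    case True
    have "coeff (\<psi> T \<star> \<mu>) (d + 1) = (\<Sum>i\<in>{1}. coeff (\<psi> T) i * coeff \<mu> (d + 1 - i) ^ (q ^ i))"
      unfolding coeff_skew using True d q_pow_pos[of 0]
      by (intro sum.mono_neutral_right) (auto simp: coeff_eq_0 q_gt_1)
    then show ?thesis using True m1 b q_gt_1 by simp
  next
    case False
    have "coeff (\<psi> T \<star> \<mu>) (d + 1) = (\<Sum>i\<in>{1, 2}. coeff (\<psi> T) i * coeff \<mu> (d + 1 - i) ^ (q ^ i))"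
      unfolding coeff_skew
    proof (rule sum.mono_neutral_right)
      show "\<forall>i\<in>{..d + 1} - {1, 2}. coeff (\<psi> T) i * coeff \<mu> (d + 1 - i) ^ (q ^ i) = 0"
      proof
        fix i assume i: "i \<in> {..d + 1} - {1, 2}"
        then have "i = 0 \<or> 2 < i" by auto
        then show "coeff (\<psi> T) i * coeff \<mu> (d + 1 - i) ^ (q ^ i) = 0"
          using d high(2) by (auto simp: coeff_eq_0)
      qed
      show "{1, 2} \<subseteq> {..d + 1}" using False by auto
    qed simp
    moreover have "d + 1 - 2 = d - 1" using False by simp
    ultimately show ?thesis using False m1 b by simp
  qed
  then have "coeff (\<psi> T) 1 + coeff (\<psi> T) 2 * b ^ (q ^ 2)
    = coeff (\<phi> T) 1 ^ (q ^ d) + b * coeff (\<phi> T) 2 ^ (q ^ (d - 1))" using l eq by simp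
  then show "coeff (\<psi> T) 1 = coeff (\<phi> T) 1 ^ (q ^ d) + b * coeff (\<phi> T) 2 ^ (q ^ (d - 1))
       - coeff (\<phi> T) 2 ^ (q ^ d) * b ^ (q ^ 2)"
    unfolding D by (simp only: eq_diff_eq)
qed

text \<open>The degree \<open>d\<close> of \<open>\<mu>\<close> depends only on \<open>e\<close>, because \<open>e \<Lambda>\<close> is isomorphic to \<open>A/(a)\<close>, where \<open>a\<close>
  generates the annihilator \<open>comp_ideal e\<close>.\<close>

lemma J_AL_function:
  assumes e: "idem e"
  shows "\<exists>f\<in>PF. \<forall>x\<in>Y0 \<iota> \<nn>. \<forall>p\<in>x. J (AL e x) = f p"
proof -
  obtain a where a: "comp_ideal e = {b. a dvd b}" by (rule ideal_principal[OF is_ideal_comp_ideal])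
  define d where "d = degree a"
  define G where "G = (\<lambda>(\<phi> :: ('f, 'k) amodule, \<Lambda> :: 'k set). coeff (\<phi> T) 1)"
  define D where "D = (\<lambda>(\<phi> :: ('f, 'k) amodule, \<Lambda> :: 'k set). coeff (\<phi> T) 2)"
  define D' where "D' = (\<lambda>(\<phi> :: ('f, 'k) amodule, \<Lambda> :: 'k set). inverse (coeff (\<phi> T) 2))"
  define B where "B = (if d = 0 then (\<lambda>_. 0) else (\<lambda>(\<phi> :: ('f, 'k) amodule, \<Lambda>).
    coeff (kernel_poly (\<Lambda> \<inter> torsion \<phi> (comp_ideal e))) (q ^ (d - 1))))"
  define f where "f = (\<lambda>p. (G p ^ (q ^ d) + B p * D p ^ (q ^ (d - 1)) - D p ^ (q ^ d) * B p ^ (q ^ 2)) ^ (q + 1)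
    * D' p ^ (q ^ d))"
  have nsub: "\<nn> \<subseteq> comp_ideal e" by (auto simp: \<nn> in_comp_ideal)
  have "G \<in> PF" "D \<in> PF" "D' \<in> PF"
    unfolding G_def D_def D'_def by (rule pair_functions.coeff_T pair_functions.inverse_Delta)+
  moreover have "B \<in> PF"
  proof (cases "d = 0")
    case True
    then show ?thesis by (simp add: B_def PF_0)
  next
    case False
    show ?thesis unfolding B_def if_not_P[OF False] by (rule pair_functions.kernel[OF is_ideal_comp_ideal nsub])
  qed
  ultimately have fPF: "f \<in> PF"
    unfolding f_def by (intro pair_functions.mult pair_functions.add PF_power PF_diff)
  have val: "J (AL e x) = f p" if x: "x \<in> Y0 \<iota> \<nn>" and px: "p \<in> x" for x p
  proof -
    obtain \<phi> \<Lambda> where p: "p = (\<phi>, \<Lambda>)" by (cases p)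
    have pp: "(\<phi>, \<Lambda>) \<in> pairs \<iota> \<nn>" using px Y0_D(1)[OF x] p by blast
    obtain \<mu> \<psi> where \<mu>: "lead_coeff \<mu> = 1" "coeff \<mu> 0 \<noteq> 0" "zeros \<mu> = AL_ker \<phi> \<Lambda> e"
      and \<psi>: "drinfeld \<iota> UNIV \<psi>" "isogeny \<mu> \<phi> \<psi>" by (rule AL_image_exists[OF pp e])
    have "q ^ degree \<mu> = q ^ d"
      using card_zeros[OF \<mu>(2)] AL_ker_card(1)[OF pp e a] \<mu>(3) by (simp add: d_def)
    then have deg: "degree \<mu> = d" using q_pow_inj by simp
    have "coeff (kernel_poly (\<Lambda> \<inter> torsion \<phi> (comp_ideal e))) (q ^ i) = coeff \<mu> i" for i
      using kernel_poly_zeros[OF \<mu>(1,2)] coeff_lin by (simp add: \<mu>(3) AL_ker_torsion[OF pp e])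
    then have B: "B p = (if d = 0 then 0 else coeff \<mu> (d - 1))" by (simp add: B_def p)
    note qc = quotient_coeffs[OF pair_drinfeld[OF pp] \<psi> \<mu>(1) deg B]
    have "J (AL e x) = jinv \<psi>" using J_AL(1)[OF x _ e \<psi> \<mu>(3)] px p by simp
    also have "\<dots> = (coeff (\<phi> T) 1 ^ (q ^ d) + B p * coeff (\<phi> T) 2 ^ (q ^ (d - 1))
        - coeff (\<phi> T) 2 ^ (q ^ d) * B p ^ (q ^ 2)) ^ (q + 1) / coeff (\<phi> T) 2 ^ (q ^ d)"
      unfolding jinv_def qc ..
    also have "\<dots> = f p"
    proof -
      have G: "G p = coeff (\<phi> T) 1" "D p = coeff (\<phi> T) 2" "D' p = inverse (coeff (\<phi> T) 2)"
        by (simp_all add: G_def D_def D'_def p)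
      show ?thesis unfolding f_def G divide_inverse power_inverse ..
    qed
    finally show ?thesis .
  qed
  show ?thesis by (rule bexI[OF _ fPF]) (intro ballI val)
qed

section \<open>The Galois action on the fibre\<close>

definition idems :: "'f poly set" where "idems = {e. idem e \<and> e mod \<nu> = e}"

lemma finite_idems: "finite idems"
proof -
  have "idems \<subseteq> {e. e = 0 \<or> degree e < degree \<nu>}"
  proof
    fix e assume "e \<in> idems"
    then show "e \<in> {e. e = 0 \<or> degree e < degree \<nu>}"
      using degree_mod_less[OF \<nu>, of e] by (simp add: idems_def)
  qed
  then show ?thesis by (rule finite_subset[OF _ conjunct1[OF card_degree_less]])
qed

lemma idem_0: "idem 0" by (simp add: idem_def)

lemma zero_idems: "0 \<in> idems" by (simp add: idems_def idem_0)

lemma sdiff_mod: "m \<in> idems \<Longrightarrow> e \<in> idems \<Longrightarrow> sdiff m e mod \<nu> \<in> idems"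
  by (simp add: idems_def idem_mod idem_sdiff)

lemma idems_idem: "e \<in> idems \<Longrightarrow> idem e" by (simp add: idems_def)

lemma sdiff_0: "sdiff 0 e = e" by (simp add: sdiff_def)

lemma sdiff_mod_right: "sdiff m (e mod \<nu>) mod \<nu> = sdiff m e mod \<nu>"
proof -
  have "sdiff m e - sdiff m (e mod \<nu>) = (1 - 2 * m) * (e - e mod \<nu>)" by (simp add: sdiff_def algebra_simps)
  then have "\<nu> dvd sdiff m e - sdiff m (e mod \<nu>)" by (simp add: dvd_minus_mod)
  then show ?thesis by (simp add: mod_eq_dvd_iff[symmetric])
qed

lemma sdiff_involution:
  assumes m: "idem m" and e: "e \<in> idems"
  shows "sdiff m (sdiff m e mod \<nu>) mod \<nu> = e"
proof -
  have "sdiff m (sdiff m e) - e = (m * m - m) * (4 * e - 2)" by (simp add: sdiff_def algebra_simps)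
  then have "\<nu> dvd sdiff m (sdiff m e) - e" using m by (simp add: idem_def)
  then have "sdiff m (sdiff m e) mod \<nu> = e mod \<nu>" by (simp add: mod_eq_dvd_iff[symmetric])
  then show ?thesis using e by (simp add: sdiff_mod_right idems_def)
qed

lemma sdiff_bij: "m \<in> idems \<Longrightarrow> bij_betw (\<lambda>e. sdiff m e mod \<nu>) idems idems"
  by (rule bij_betwI[of _ _ _ "\<lambda>e. sdiff m e mod \<nu>"])
     (simp_all add: sdiff_mod sdiff_involution idems_idem)

lemma J_AL_mod: "J (AL (e mod \<nu>) x) = J (AL e x)"
  unfolding AL_mod ..

text \<open>A linear form in the values \<open>j(w\<^sub>d w\<^sub>m x)\<close> at the point \<open>w\<^sub>m x\<close>, and the polynomial whose roots are
  the values of this form on the orbit of \<open>x\<close>.  Powers of \<open>t\<close> as coefficients allow to separate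
  finitely many vectors by the choice of \<open>t\<close>.\<close>

definition linear_form :: "('f poly \<Rightarrow> nat) \<Rightarrow> 'k \<Rightarrow> ('f, 'k) pt set \<Rightarrow> 'f poly \<Rightarrow> 'k" where
  "linear_form i t x m = (\<Sum>d\<in>idems. t ^ i d * J (AL (sdiff m d) x))"

definition orbit_poly :: "('f poly \<Rightarrow> nat) \<Rightarrow> 'k \<Rightarrow> ('f, 'k) pt set \<Rightarrow> 'k poly" where
  "orbit_poly i t x = (\<Prod>m\<in>idems. [:- linear_form i t x m, 1:])"

text \<open>Replacing \<open>x\<close> by \<open>w\<^sub>e x\<close> translates the index of the linear forms by \<open>e\<close>, which permutes the
  factors.\<close>

lemma orbit_poly_invariant:
  assumes x: "x \<in> Y0 \<iota> \<nn>" and e: "e \<in> idems"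
  shows "orbit_poly i t (AL e x) = orbit_poly i t x"
proof -
  have "linear_form i t (AL e x) m = linear_form i t x (sdiff e m mod \<nu>)" if m: "m \<in> idems" for m
    unfolding linear_form_def
  proof (intro sum.cong refl)
    fix d assume d: "d \<in> idems"
    have "J (AL (sdiff m d) (AL e x)) = J (AL (sdiff (sdiff m d) e) x)"
      using d m e by (intro J_AL_AL x idem_sdiff idems_idem)
    also have "sdiff (sdiff m d) e = sdiff d (sdiff e m)"
      using sdiff_assoc sdiff_commute by metis
    also have "J (AL (sdiff d (sdiff e m)) x) = J (AL (sdiff d (sdiff e m) mod \<nu>) x)" by (simp only: J_AL_mod)
    also have "\<dots> = J (AL (sdiff d (sdiff e m mod \<nu>) mod \<nu>) x)" by (simp only: sdiff_mod_right)
    also have "\<dots> = J (AL (sdiff (sdiff e m mod \<nu>) d) x)" by (simp only: J_AL_mod sdiff_commute)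
    finally show "t ^ i d * J (AL (sdiff m d) (AL e x)) = t ^ i d * J (AL (sdiff (sdiff e m mod \<nu>) d) x)"
      by simp
  qed
  then have "orbit_poly i t (AL e x) = (\<Prod>m\<in>idems. [:- linear_form i t x (sdiff e m mod \<nu>), 1:])"
    unfolding orbit_poly_def by (intro prod.cong) simp_all
  also have "\<dots> = orbit_poly i t x"
    unfolding orbit_poly_def by (rule prod.reindex_bij_betw[OF sdiff_bij[OF e]])
  finally show ?thesis .
qed

lemma orbit_poly_Ystar:
  assumes t: "t \<in> Q_field \<iota>"
  shows "(\<lambda>x. coeff (orbit_poly i t x) n) \<in> O_Ystar \<iota> \<nn>"
proof -
  have "\<forall>e\<in>{e. idem e}. \<exists>f. f \<in> PF \<and> (\<forall>x\<in>Y0 \<iota> \<nn>. \<forall>p\<in>x. J (AL e x) = f p)"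
    using J_AL_function by blast
  from bchoice[OF this] obtain f where
    f': "\<forall>e\<in>{e. idem e}. f e \<in> PF \<and> (\<forall>x\<in>Y0 \<iota> \<nn>. \<forall>p\<in>x. J (AL e x) = f e p)" ..
  have f: "f e \<in> PF" "x \<in> Y0 \<iota> \<nn> \<Longrightarrow> p \<in> x \<Longrightarrow> J (AL e x) = f e p" if "idem e" for e x p
    using f' that by blast+
  define g where "g = (\<lambda>p. coeff (\<Prod>m\<in>idems. [:- (\<Sum>d\<in>idems. t ^ i d * f (sdiff m d) p), 1:]) n)"
  have "(\<lambda>_. t ^ k) \<in> PF" for k by (rule PF_power[OF pair_functions.const[OF t]])
  then have "g \<in> PF"
    unfolding g_def
    by (intro PF_prod_linear finite_idems PF_sum pair_functions.mult f(1) idem_sdiff idems_idem)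
  moreover have "coeff (orbit_poly i t x) n = g p" if "x \<in> Y0 \<iota> \<nn>" "p \<in> x" for x p
    unfolding orbit_poly_def linear_form_def g_def using f(2)[OF _ that]
    by (simp add: idem_sdiff idems_idem)
  ultimately have "(\<lambda>x. coeff (orbit_poly i t x) n) \<in> O_Y0 \<iota> \<nn>"
    unfolding O_Y0_def by blast
  moreover have "coeff (orbit_poly i t (w x)) n = coeff (orbit_poly i t x) n"
    if "w \<in> AL_group \<iota> \<nn>" "x \<in> Y0 \<iota> \<nn>" for w x
    using that orbit_poly_invariant unfolding AL_group_eq idems_def by auto
  ultimately show ?thesis unfolding O_Ystar_def by blast
qed

text \<open>A homomorphism over \<open>K\<close> permutes the orbit: the linear form takes a root of the orbit polynomial
  to a root, and for suitable \<open>t\<close> it separates the finitely many vectors in question.\<close>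

lemma khom_permutes_orbit:
  assumes x: "x \<in> Y0 \<iota> \<nn>" and K: "subfield_of K" "Q_field \<iota> \<subseteq> K"
    and xK: "\<forall>F\<in>O_Ystar \<iota> \<nn>. F x \<in> K"
    and E: "subfield_of E" "K \<subseteq> E" and s: "khom K E s"
    and JE: "\<And>d. d \<in> idems \<Longrightarrow> J (AL d x) \<in> E"
  shows "\<exists>m\<in>idems. \<forall>d\<in>idems. s (J (AL d x)) = J (AL (sdiff m d) x)"
proof -
  obtain i :: "'f poly \<Rightarrow> nat" where i: "inj_on i idems" using finite_imp_inj_to_nat_seg[OF finite_idems] by metis
  define P where "P = (\<lambda>m. \<Sum>d\<in>idems. monom (J (AL (sdiff m d) x) - s (J (AL d x))) (i d))"
  have cP: "coeff (P m) (i d) = J (AL (sdiff m d) x) - s (J (AL d x))" if d: "d \<in> idems" for m d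
  proof -
    have "coeff (P m) (i d) = (\<Sum>d'\<in>idems. if d' = d then J (AL (sdiff m d) x) - s (J (AL d x)) else 0)"
      unfolding P_def coeff_sum using d i by (intro sum.cong) (auto dest: inj_onD)
    then show ?thesis using d finite_idems by simp
  qed
  (* P m vanishes at t iff the linear form takes equal values at two vectors *)
  define bad where "bad = (\<Union>m\<in>{m \<in> idems. P m \<noteq> 0}. {t. poly (P m) t = 0})"
  have "finite bad" unfolding bad_def using finite_idems by (intro finite_UN_I poly_roots_finite) auto
  moreover have "infinite (Q_field \<iota>)"
    using Q_field_emb by (intro infinite_super[OF _ infinite_range_emb]) blast
  ultimately have "infinite (Q_field \<iota> - bad)" by (rule Diff_infinite_finite)
  then obtain t where t: "t \<in> Q_field \<iota>" "t \<notin> bad" using infinite_imp_nonempty by blast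
  have tK: "t \<in> K" using t(1) K(2) by blast
  let ?R = "orbit_poly i t x"
  have RK: "?R \<in> polys_over K" unfolding polys_over_def using bspec[OF xK orbit_poly_Ystar[OF t(1)]] by simp
  have roots: "poly ?R z = 0 \<longleftrightarrow> (\<exists>m\<in>idems. z = linear_form i t x m)" for z
    unfolding orbit_poly_def using finite_idems by (auto simp: poly_prod)
  let ?\<theta> = "linear_form i t x 0"
  have \<theta>: "?\<theta> = (\<Sum>d\<in>idems. t ^ i d * J (AL d x))" by (simp add: linear_form_def sdiff_0)
  have terms: "t ^ i d * J (AL d x) \<in> E" if "d \<in> idems" for d
    using JE[OF that] tK E by (intro subfieldD(4,9)[OF E(1)]) auto
  have "?\<theta> \<in> E" unfolding \<theta> using terms by (rule subfield_sum[OF E(1)])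
  then have "poly ?R (s ?\<theta>) = s (poly ?R ?\<theta>)" using khom_poly_base[OF K(1) E s RK] by simp
  also have "poly ?R ?\<theta> = 0" using roots zero_idems by blast
  also have "s 0 = 0" by (rule khom_simps(2)[OF K(1) E s])
  finally obtain m where m: "m \<in> idems" "s ?\<theta> = linear_form i t x m" using roots by blast
  have "s (t ^ i d * J (AL d x)) = t ^ i d * s (J (AL d x))" if "d \<in> idems" for d
  proof -
    have tE: "t \<in> E" using tK E(2) by blast
    show ?thesis
      using khom_simps(5)[OF K(1) E s subfieldD(9)[OF E(1) tE] JE[OF that]]
        khom_simps(8)[OF K(1) E s tE] khom_simps(1)[OF K(1) E s tK] by simp
  qed
  then have "s ?\<theta> = (\<Sum>d\<in>idems. t ^ i d * s (J (AL d x)))"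
    unfolding \<theta> using khom_sum[OF K(1) E s, of idems "\<lambda>d. t ^ i d * J (AL d x)"] terms by simp
  then have "poly (P m) t = 0"
    using m(2) by (simp add: P_def poly_sum poly_monom linear_form_def sum_subtractf algebra_simps)
  then have "P m = 0" using t(2) m(1) unfolding bad_def by blast
  then have "s (J (AL d x)) = J (AL (sdiff m d) x)" if "d \<in> idems" for d using cP[OF that, of m] by simp
  then show ?thesis using m(1) by blast
qed

lemma J_AL_0: "x \<in> Y0 \<iota> \<nn> \<Longrightarrow> J (AL 0 x) = J x"
proof -
  assume x: "x \<in> Y0 \<iota> \<nn>"
  obtain \<phi> \<Lambda> where px: "(\<phi>, \<Lambda>) \<in> x" using Y0_D(3)[OF x] by auto
  have p: "(\<phi>, \<Lambda>) \<in> pairs \<iota> \<nn>" using px Y0_D(1)[OF x] by blast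
  have "AL_ker \<phi> \<Lambda> 0 = {0}"
    using Lambda_D(2)[OF p] by (auto simp: AL_ker_def act_0[OF pair_drinfeld[OF p]])
  then have "zeros 1 = AL_ker \<phi> \<Lambda> 0" by simp
  moreover have "isogeny 1 \<phi> \<phi>" by (simp add: isogeny_iff)
  ultimately have "J (AL 0 x) = jinv \<phi>"
    using J_AL(1)[OF x px idem_0 pair_drinfeld[OF p]] by blast
  then show ?thesis using J_eq[OF x px] by simp
qed

section \<open>Models over small fields\<close>

lemma twist_pair:
  assumes p: "(\<phi>, \<Lambda>) \<in> pairs \<iota> \<nn>" and c: "c \<noteq> 0"
  obtains \<psi> where "drinfeld \<iota> UNIV \<psi>" "isogeny [:c:] \<phi> \<psi>"
    "((\<phi>, \<Lambda>), (\<psi>, ev [:c:] ` \<Lambda>)) \<in> pair_iso \<iota> \<nn>"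
proof -
  note dr = pair_drinfeld[OF p]
  have inv: "[:inverse c:] \<star> [:c:] = 1" by (rule ev_inject) (simp add: ev_mult c)
  have "[:c:] \<star> \<phi> a = ([:c:] \<star> \<phi> a \<star> [:inverse c:]) \<star> [:c:]" for a
    by (simp add: skew_assoc inv)
  then have "\<exists>g. [:c:] \<star> \<phi> a = g \<star> [:c:]" for a by blast
  moreover have "coeff [:c:] 0 \<noteq> 0" using c by simp
  ultimately obtain \<psi> where \<psi>: "drinfeld \<iota> UNIV \<psi>" "isogeny [:c:] \<phi> \<psi>"
    using push_forward_exists[OF dr] by blast
  have "AL_ker \<phi> \<Lambda> 0 = {0}" using Lambda_D(2)[OF p] by (auto simp: AL_ker_def act_0[OF dr])
  then have "zeros [:c:] = AL_ker \<phi> \<Lambda> 0" using c by simp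
  then have "(\<psi>, ev [:c:] ` AL_sub \<phi> \<Lambda> 0) \<in> pairs \<iota> \<nn>" by (rule AL_image_pair[OF p idem_0 \<psi>])
  moreover have "AL_sub \<phi> \<Lambda> 0 = \<Lambda>"
    using Lambda_torsion[OF p] by (auto simp: AL_sub_def act_1[OF dr])
  ultimately have "((\<phi>, \<Lambda>), (\<psi>, ev [:c:] ` \<Lambda>)) \<in> pair_iso \<iota> \<nn>"
    unfolding pair_iso_iff using p c \<psi>(2) by auto
  then show ?thesis using that \<psi> by blast
qed

text \<open>The module with \<open>\<psi>\<^sub>T = T + j \<tau> + j\<^sup>q \<tau>\<^sup>2\<close> has the invariant \<open>j\<close> if \<open>j \<noteq> 0\<close>, and \<open>T + \<tau>\<^sup>2\<close> has the
  invariant \<open>0\<close>.\<close>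

lemma model_over_field_of_j:
  assumes x: "x \<in> Y0 \<iota> \<nn>" and L: "subfield_of L" "range \<iota> \<subseteq> L" and j: "J x \<in> L"
  obtains \<phi> \<Lambda> where "(\<phi>, \<Lambda>) \<in> x" "drinfeld \<iota> L \<phi>"
proof -
  obtain \<phi> \<Lambda> where px: "(\<phi>, \<Lambda>) \<in> x" using Y0_D(3)[OF x] by auto
  have p: "(\<phi>, \<Lambda>) \<in> pairs \<iota> \<nn>" using px Y0_D(1)[OF x] by blast
  note dr = pair_drinfeld[OF p]
  let ?g = "coeff (\<phi> T) 1" and ?D = "coeff (\<phi> T) 2"
  have D: "?D \<noteq> 0" by (rule Delta_nonzero[OF dr])
  have j': "J x = ?g ^ (q + 1) / ?D" unfolding J_eq[OF x px] jinv_def ..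
  have q1: "0 < q - 1" using q_gt_1 by simp
  then have q2: "0 < q ^ 2 - 1" unfolding q2_minus_1 by simp
  have "\<exists>c g' D'. c \<noteq> 0 \<and> g' \<in> L \<and> D' \<in> L \<and> ?g = g' * c ^ (q - 1) \<and> ?D = D' * c ^ (q ^ 2 - 1)"
  proof (cases "?g = 0")
    case True
    obtain c where c: "c ^ (q ^ 2 - 1) = ?D" using nth_root_exists[OF q2] by blast
    then have "c \<noteq> 0" using D q2 by (metis zero_power)
    then show ?thesis
      using c True subfieldD(1,2)[OF L(1)] by (intro exI[of _ c] exI[of _ 0] exI[of _ 1]) simp
  next
    case False
    obtain c where c: "c ^ (q - 1) = ?g / J x" using nth_root_exists[OF q1] by blast
    have J0: "J x \<noteq> 0" using False D by (simp add: j')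
    then have "?g / J x \<noteq> 0" using False by simp
    then have "c \<noteq> 0" using c q1 by (metis zero_power)
    moreover have "?g = J x * c ^ (q - 1)" using c J0 by simp
    moreover have "?D = J x ^ q * c ^ (q ^ 2 - 1)"
    proof -
      have "J x ^ q * (?g / J x) ^ (q + 1) = ?g ^ (q + 1) / J x" using J0 by (simp add: power_divide)
      also have "\<dots> = ?D" unfolding j' using False D by simp
      finally show ?thesis unfolding q2_minus_1 power_mult c ..
    qed
    ultimately show ?thesis using j subfieldD(9)[OF L(1) j] by blast
  qed
  then obtain c g' D' where c: "c \<noteq> 0" and L': "g' \<in> L" "D' \<in> L"
    and eq: "?g = g' * c ^ (q - 1)" "?D = D' * c ^ (q ^ 2 - 1)" by blast
  obtain \<psi> where \<psi>: "drinfeld \<iota> UNIV \<psi>" "isogeny [:c:] \<phi> \<psi>"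
    "((\<phi>, \<Lambda>), (\<psi>, ev [:c:] ` \<Lambda>)) \<in> pair_iso \<iota> \<nn>" by (rule twist_pair[OF p c])
  have "coeff (\<psi> T) 1 = g'" "coeff (\<psi> T) 2 = D'"
    using iso_iff_T[OF dr \<psi>(1) c] \<psi>(2) eq c by simp_all
  then have "\<psi> T = [:\<iota> T, g', D':]" using module_T_eq[OF \<psi>(1)] by simp
  then have "\<psi> T \<in> polys_over L"
    using L L' by (auto intro!: polys_over_closed(3,10)[OF L(1)])
  then have "drinfeld \<iota> L \<psi>" by (rule drinfeld_over_from_T[OF \<psi>(1) L])
  moreover have "(\<psi>, ev [:c:] ` \<Lambda>) \<in> x" using Y0_D(4)[OF x px] \<psi>(3) by blast
  ultimately show ?thesis using that by blast
qed

lemma conj_drinfeld: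
  assumes dr: "drinfeld \<iota> E \<phi>" and K: "subfield_of K" "range \<iota> \<subseteq> K" and E: "subfield_of E" "K \<subseteq> E"
    and s: "khom K E s"
  shows "drinfeld \<iota> UNIV (conj_module s \<phi>)" "jinv (conj_module s \<phi>) = s (jinv \<phi>)"
proof -
  note hom = khom_simps[OF K(1) E s]
  note D = drinfeldD[OF dr]
  have c: "coeff (conj_module s \<phi> a) i = s (coeff (\<phi> a) i)" for a i
    by (simp add: conj_module_def coeff_map_poly hom(2))
  have cE: "coeff (\<phi> a) i \<in> E" for a i using polys_over_coeff[OF D(1)] .
  have fix_emb: "s (\<iota> a) = \<iota> a" for a using K(2) by (intro hom(1)) blast
  have deg: "degree (conj_module s \<phi> T) = 2"
  proof -
    have "coeff (\<phi> T) 2 \<noteq> 0" by (rule Delta_nonzero[OF drinfeld_UNIV[OF dr]])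
    then have "s (coeff (\<phi> T) 2) \<noteq> 0"
      using khom_inj[OF K(1) E s cE subfieldD(1)[OF E(1)], of T 2] hom(2) by auto
    then have "2 \<le> degree (conj_module s \<phi> T)" by (intro le_degree) (simp add: c)
    moreover have "degree (conj_module s \<phi> T) \<le> 2"
      unfolding conj_module_def using map_poly_degree_leq[of s "\<phi> T"] D(6) by simp
    ultimately show ?thesis by simp
  qed
  show "drinfeld \<iota> UNIV (conj_module s \<phi>)"
    unfolding drinfeld_def q_card[symmetric]
  proof (intro conjI allI)
    show "conj_module s \<phi> [:k:] = [:\<kappa> k:]" for k
      by (rule poly_eqI) (simp add: c D(2) coeff_pCons hom(2) fix_emb split: nat.splits)
    show "conj_module s \<phi> (a + b) = conj_module s \<phi> a + conj_module s \<phi> b" for a b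
      by (rule poly_eqI) (simp add: c D(3) hom(4) cE)
    show "conj_module s \<phi> (a * b) = conj_module s \<phi> a \<star> conj_module s \<phi> b" for a b
    proof (rule poly_eqI)
      fix n
      have "coeff (conj_module s \<phi> (a * b)) n = (\<Sum>i\<le>n. s (coeff (\<phi> a) i * coeff (\<phi> b) (n - i) ^ (q ^ i)))"
        unfolding c D(4) coeff_skew
        by (rule khom_sum[OF K(1) E s]) (intro subfieldD(4,9)[OF E(1)] cE)
      also have "\<dots> = coeff (conj_module s \<phi> a \<star> conj_module s \<phi> b) n"
        unfolding coeff_skew c using cE subfieldD(9)[OF E(1)] by (simp add: hom(5,8))
      finally show "coeff (conj_module s \<phi> (a * b)) n = coeff (conj_module s \<phi> a \<star> conj_module s \<phi> b) n" .
    qed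
    show "coeff (conj_module s \<phi> a) 0 = \<iota> a" for a by (simp add: c D(5) fix_emb)
    show "degree (conj_module s \<phi> T) = 2" by (rule deg)
    then show "\<exists>a. conj_module s \<phi> a \<noteq> [:\<iota> a:]" by (rule degree_2_imp_nonconst)
  qed (simp add: polys_over_def)
  show "jinv (conj_module s \<phi>) = s (jinv \<phi>)"
    unfolding jinv_def c using cE subfieldD(9)[OF E(1)] by (simp only: hom(8,10))
qed

end

section \<open>Rationality of the points in the fibre\<close>

context AL_base
begin

text \<open>The coordinates of a point over the separable closure are separable, because the
  separable closure is separably closed, and \<open>j(w\<^sub>e x)\<close> is a regular function of them.\<close>

lemma J_values_separable:
  assumes sb: "sep_base K" and KQ: "Q_field \<iota> \<subseteq> K" and x: "x \<in> Y0_points \<iota> \<nn> (sep_closure K)" and e: "idem e"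
  shows "J (AL e x) \<in> sep_closure K"
proof -
  interpret sep_base K by (rule sb)
  obtain \<phi> \<Lambda> where p: "(\<phi>, \<Lambda>) \<in> x" "drinfeld \<iota> (sep_closure K) \<phi>" "\<Lambda> \<subseteq> sep_closure (sep_closure K)"
    and xY: "x \<in> Y0 \<iota> \<nn>" using x by (auto simp: Y0_points_def)
  obtain f where f: "f \<in> PF" "\<forall>x\<in>Y0 \<iota> \<nn>. \<forall>p\<in>x. J (AL e x) = f p" using J_AL_function[OF e] by blast
  have "f (\<phi>, \<Lambda>) \<in> sep_closure K"
  proof (rule PF_in_subfield[OF f(1) sep_closure_subfield])
    show "Q_field \<iota> \<subseteq> sep_closure K" using KQ base_subset_sep_closure by blast
    show "\<phi> T \<in> polys_over (sep_closure K)" by (rule drinfeldD(1)[OF p(2)])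
    show "\<Lambda> \<subseteq> sep_closure K" using p(3) sep_closure_sep_closure by blast
  qed
  then show ?thesis using f(2) xY p(1) by simp
qed

text \<open>The field \<open>L = K(j(w\<^sub>d x) : d)\<close>.  A primitive element \<open>c\<close> of \<open>L\<close> lies in every subfield that
  contains \<open>K\<close> and the values \<open>j(w\<^sub>d x)\<close>.  This is applied to the elements whose image under an
  embedding lies in \<open>L\<close> again, and to the fixed field of the square of an automorphism.\<close>

lemma polyquadratic_field_of_j:
  assumes sb: "sep_base K" and KQ: "Q_field \<iota> \<subseteq> K" and x: "x \<in> Y0 \<iota> \<nn>"
    and xK: "\<forall>F\<in>O_Ystar \<iota> \<nn>. F x \<in> K"
    and sep: "\<forall>d\<in>idems. J (AL d x) \<in> sep_closure K"
  shows "\<exists>L. polyquadratic K L \<and> J x \<in> L"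
proof -
  interpret sep_base K by (rule sb)
  let ?Z = "(\<lambda>d. J (AL d x)) ` idems"
  obtain c where c: "c \<in> sep_closure K" "?Z \<subseteq> adj K c"
    "\<And>L. subfield_of L \<Longrightarrow> K \<subseteq> L \<Longrightarrow> ?Z \<subseteq> L \<Longrightarrow> c \<in> L"
    by (rule primitive_element_finite[of ?Z]) (use finite_idems sep in auto)
  obtain M where M: "is_minpoly K c M" "rsquarefree M" using c(1) by (auto simp: sep_closure_def)
  let ?L = "adj K c"
  have L: "subfield_of ?L" "K \<subseteq> ?L" using adj_field adj_base[OF K] by auto
  have JL: "J (AL d x) \<in> ?L" if "d \<in> idems" for d using c(2) that by blast
  have norm: "y \<in> ?L" if y: "poly M y = 0" for y
  proof -
    obtain s where s: "khom K ?L s" "\<forall>p\<in>polys_over K. s (poly p c) = poly p y"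
      using khom_adj[OF K M(1) y] by blast
    obtain m where m: "m \<in> idems" "\<And>d. d \<in> idems \<Longrightarrow> s (J (AL d x)) = J (AL (sdiff m d) x)"
      using khom_permutes_orbit[OF x K KQ xK L s(1) JL] by blast
    note hom = khom_simps[OF K L s(1)]
    define E where "E = {z \<in> ?L. s z \<in> ?L}"
    have "subfield_of E"
      unfolding subfield_of_def E_def
      by (auto simp: hom(2,3) hom(4-6,9) intro: subfieldD(1-6)[OF L(1)])
    moreover have "K \<subseteq> E" using L(2) by (auto simp: E_def hom)
    moreover have "?Z \<subseteq> E"
    proof (rule image_subsetI)
      fix d assume d: "d \<in> idems"
      have "s (J (AL d x)) = J (AL (sdiff m d mod \<nu>) x)" using m(2)[OF d] by (simp only: J_AL_mod)
      then show "J (AL d x) \<in> E" using JL[OF d] JL[OF sdiff_mod[OF m(1) d]] by (simp add: E_def)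
    qed
    ultimately have "c \<in> E" by (rule c(3))
    moreover have "s c = y"
      using bspec[OF s(2), of "[:0,1:]"] polys_over_closed(3,10)[OF K] subfieldD(1,2)[OF K] by simp
    ultimately show ?thesis by (simp add: E_def)
  qed
  have invol: "s (s c) = c" if s: "s \<in> carrier (gal_group ?L K)" for s
  proof -
    note G = gal_groupD[OF s]
    obtain m where m: "m \<in> idems" "\<And>d. d \<in> idems \<Longrightarrow> s (J (AL d x)) = J (AL (sdiff m d) x)"
      using khom_permutes_orbit[OF x K KQ xK L G(2) JL] by blast
    note hom = khom_simps[OF K L G(2)]
    define E where "E = {z \<in> ?L. s (s z) = z}"
    have "subfield_of E"
      unfolding subfield_of_def E_def
      by (auto simp: hom(2,3) hom(4-6,9) G(3) intro: subfieldD(1-6)[OF L(1)])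
    moreover have "K \<subseteq> E" using L(2) by (auto simp: E_def hom)
    moreover have "?Z \<subseteq> E"
    proof (rule image_subsetI)
      fix d assume d: "d \<in> idems"
      have *: "s (J (AL e x)) = J (AL (sdiff m e mod \<nu>) x)" if "e \<in> idems" for e
        using m(2)[OF that] by (simp only: J_AL_mod)
      have "s (s (J (AL d x))) = J (AL (sdiff m (sdiff m d mod \<nu>) mod \<nu>) x)"
        unfolding *[OF d] *[OF sdiff_mod[OF m(1) d]] ..
      then show "J (AL d x) \<in> E"
        using JL[OF d] sdiff_involution[OF idems_idem[OF m(1)] d] by (simp add: E_def)
    qed
    ultimately have "c \<in> E" by (rule c(3))
    then show ?thesis by (simp add: E_def)
  qed
  have "polyquadratic K ?L" by (rule polyquadratic_adjI[OF M]) (erule norm, erule invol)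
  moreover have "J x \<in> ?L" using JL[OF zero_idems] J_AL_0[OF x] by simp
  ultimately show ?thesis by blast
qed

text \<open>If \<open>s\<close> takes \<open>j(\<phi>)\<close> to \<open>j(w\<^sub>m x)\<close>, then the conjugate of \<open>\<phi>\<close> is isomorphic to the quotient of
  \<open>\<phi>\<close> that underlies \<open>w\<^sub>m x\<close>.\<close>

lemma virtually_rational_model:
  assumes sb: "sep_base K" and KQ: "Q_field \<iota> \<subseteq> K" and x: "x \<in> Y0 \<iota> \<nn>"
    and xK: "\<forall>F\<in>O_Ystar \<iota> \<nn>. F x \<in> K"
    and sep: "\<forall>d\<in>idems. J (AL d x) \<in> sep_closure K"
    and p: "(\<phi>, \<Lambda>) \<in> x" and \<phi>: "drinfeld \<iota> (sep_closure K) \<phi>"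
  shows "virtually_rational \<iota> K \<phi>"
  unfolding virtually_rational_def
proof (intro conjI ballI)
  show "drinfeld \<iota> (sep_closure K) \<phi>" by (rule \<phi>)
  interpret sep_base K by (rule sb)
  fix s assume "s \<in> abs_galois K"
  then have s: "khom K (sep_closure K) s" unfolding abs_galois_def by (rule gal_groupD(2))
  have pp: "(\<phi>, \<Lambda>) \<in> pairs \<iota> \<nn>" using p Y0_D(1)[OF x] by blast
  note E = sep_closure_subfield base_subset_sep_closure
  obtain m where m: "m \<in> idems" "\<And>d. d \<in> idems \<Longrightarrow> s (J (AL d x)) = J (AL (sdiff m d) x)"
    using khom_permutes_orbit[OF x K KQ xK E s] sep by blast
  obtain \<mu> \<psi> where \<psi>: "zeros \<mu> = AL_ker \<phi> \<Lambda> m" "drinfeld \<iota> UNIV \<psi>" "isogeny \<mu> \<phi> \<psi>"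
    by (rule AL_image_exists[OF pp idems_idem[OF m(1)]])
  have emb_K: "range \<iota> \<subseteq> K" using Q_field_emb KQ by blast
  note conj = conj_drinfeld[OF \<phi> K emb_K E s]
  have "jinv \<psi> = J (AL (sdiff m 0) x)"
    using J_AL(1)[OF x p idems_idem[OF m(1)] \<psi>(2,3,1)] by (simp add: sdiff_def)
  also have "\<dots> = s (jinv \<phi>)"
    using m(2)[OF zero_idems] J_AL_0[OF x] J_eq[OF x p] by simp
  finally obtain c where "isogeny [:c:] \<psi> (conj_module s \<phi>)"
    using jinv_eq_imp_iso[OF \<psi>(2) conj(1)] conj(2) by metis
  then have "isogeny ([:c:] \<star> \<mu>) \<phi> (conj_module s \<phi>)" by (rule isogeny_comp[OF \<psi>(3)])
  then show "isogenous \<phi> (conj_module s \<phi>)" unfolding isogenous_def by blast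
qed

end

theorem proposition4p7:
  fixes \<iota> :: "'f::{finite,field} poly \<Rightarrow> 'k::alg_closed_field"
    and K :: "'k set"
    and \<nn> :: "'f poly set"
    and y :: "('f, 'k) pt set set"
    and x :: "('f, 'k) pt set"
  assumes "A_embedding \<iota>"
    and "subfield_of K" and "Q_field \<iota> \<subseteq> K" and "algebraic_closure_of K"
    and "is_ideal \<nn>" and "\<nn> \<noteq> {0}"
    and "y \<in> Ystar_points \<iota> \<nn> K"
    and "fibre \<iota> \<nn> y \<subseteq> Y0_points \<iota> \<nn> (sep_closure K)"
    and "x \<in> fibre \<iota> \<nn> y"
  shows "\<exists>\<phi> \<Lambda>. (\<phi>, \<Lambda>) \<in> x \<and> virtually_rational \<iota> K \<phi> \<and>
           (\<exists>L. polyquadratic K L \<and> drinfeld \<iota> L \<phi>)"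
proof -
  obtain \<nu> where \<nu>: "\<nn> = {a. \<nu> dvd a}" using assms(5) by (rule ideal_principal)
  interpret AL_base \<iota> "CARD('f)" \<nn> \<nu>
  proof
    show "\<nu> \<noteq> 0" using assms(6) \<nu> by auto
  qed (use assms(1) \<nu> in simp_all)
  have emb_K: "range \<iota> \<subseteq> K" using Q_field_emb assms(3) by blast
  have sb: "sep_base K"
  proof
    show "infinite K" by (rule infinite_super[OF emb_K infinite_range_emb])
  qed (use assms(2,4) char_k_pos in simp_all)
  have x: "x \<in> Y0 \<iota> \<nn>" using assms(9) by (simp add: fibre_def)
  have xK: "\<forall>F\<in>O_Ystar \<iota> \<nn>. F x \<in> K"
    using assms(7,9) unfolding Ystar_points_def by blast
  have "x \<in> Y0_points \<iota> \<nn> (sep_closure K)" using assms(8,9) by blast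
  then have sep: "\<forall>d\<in>idems. J (AL d x) \<in> sep_closure K"
    using J_values_separable[OF sb assms(3)] idems_idem by blast
  obtain L where L: "polyquadratic K L" "J x \<in> L"
    using polyquadratic_field_of_j[OF sb assms(3) x xK sep] by blast
  have L': "subfield_of L" "K \<subseteq> L" "L \<subseteq> sep_closure K"
    using L(1) by (simp_all add: polyquadratic_def finite_galois_def finite_extension_def)
  have emb_L: "range \<iota> \<subseteq> L" using emb_K L'(2) by blast
  obtain \<phi> \<Lambda> where \<phi>: "(\<phi>, \<Lambda>) \<in> x" "drinfeld \<iota> L \<phi>"
    by (rule model_over_field_of_j[OF x L'(1) emb_L L(2)])
  have "drinfeld \<iota> (sep_closure K) \<phi>"
    using \<phi>(2) polys_over_mono[OF L'(3)] by (auto simp: drinfeld_def)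
  then have "virtually_rational \<iota> K \<phi>"
    by (rule virtually_rational_model[OF sb assms(3) x xK sep \<phi>(1)])
  then show ?thesis using \<phi> L(1) by blast
qed

end
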